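(* Let $E$ be a maximal operator space and $F$ a minimal operator space. For every operator $T:F\to E$ of rank at most $n$, $$\|T\|_{cb}\le\gamma_2^*(T)\le 170\,\big\|T\otimes \mathrm{Id}_{M_n}:M_n(F)\to M_n(E)\big\|.$$ In particular, for every $n$-dimensional Banach space $E$, $$\frac{\sqrt n}{170}\le\big\|\mathrm{Id}:\min(E)\to\max(E)\big\|_{cb}.$$
   Context: All spaces are complex. An operator space is a closed subspace of some $B(H)$ with the induced matrix norms on $M_n(E)$; $\|u\|_{cb}=\sup_n\|\mathrm{Id}_{M_n}\otimes u\|$. The operator space dual $E^*$ has the matrix norms $M_n(E^* )=CB(E,M_n)$. For a Banach space $E$, $\min(E)$ is $E$ with the structure induced by the isometric embedding $E\hookrightarrow C(B_{E^*})$, and $\max(E)$ is $E$ with the structure induced by the embedding $E\hookrightarrow(\min(E^* ))^*$. A minimal (maximal) operator space is one of the form $\min(X)$ ($\max(X)$) for a Banach space $X$. For an operator $S:X\to Y$ between Banach spaces, $\gamma_2(S)=\inf\|u\|\,\|v\|$, the infimum over all Hilbert spaces $H$ and factorizations $\iota_YS=uv$ with $v:X\to H$, $u:H\to Y^{**}$ bounded, $\iota_Y:Y\to Y^{**}$ the canonical embedding. For $T:Y\to X$, $\gamma_2^*(T)=\sup\{|\mathrm{tr}(ST)|: S:X\to Y \text{ of finite rank},\ \gamma_2(S)\le1\}$. *)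

theory Defs
  imports "HOL-Analysis.Analysis"
begin

section \<open>Complex Banach spaces\<close>

class complex_vector = real_vector +
  fixes scaleC :: "complex \<Rightarrow> 'a \<Rightarrow> 'a"  (infixr \<open>*\<^sub>C\<close> 75)
  assumes scaleC_add_right: "c *\<^sub>C (x + y) = c *\<^sub>C x + c *\<^sub>C y"
    and scaleC_add_left: "(c + d) *\<^sub>C x = c *\<^sub>C x + d *\<^sub>C x"
    and scaleC_scaleC: "c *\<^sub>C d *\<^sub>C x = (c * d) *\<^sub>C x"
    and scaleC_of_real: "complex_of_real r *\<^sub>C x = r *\<^sub>R x"

class complex_normed_vector = complex_vector + real_normed_vector +
  assumes norm_scaleC: "norm (c *\<^sub>C x) = cmod c * norm x"

class cbanach = complex_normed_vector + banach

instantiation complex :: cbanach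
begin
definition "scaleC_complex (c :: complex) x = c * x"
instance
  by standard (simp_all add: scaleC_complex_def ring_distribs scaleR_conv_of_real norm_mult)
end

interpretation complex_vector: vector_space "scaleC :: complex \<Rightarrow> 'a \<Rightarrow> 'a::complex_vector"
proof
  show "1 *\<^sub>C x = x" for x :: 'a
    using scaleC_of_real[of 1 x] by simp
qed (simp_all add: scaleC_add_right scaleC_add_left scaleC_scaleC)

definition bounded_clinear ::
    "('a::complex_normed_vector \<Rightarrow> 'b::complex_normed_vector) \<Rightarrow> bool" where
  "bounded_clinear T \<longleftrightarrow> bounded_linear T \<and> (\<forall>c x. T (c *\<^sub>C x) = c *\<^sub>C T x)"

text \<open>The constant \<^term>\<open>complex_vector.dim\<close> is \<open>0\<close> on infinite-dimensional sets, so
  finite-dimensionality always has to be required separately.\<close>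

definition finite_cdim :: "'a::complex_vector set \<Rightarrow> bool" where
  "finite_cdim V \<longleftrightarrow> (\<exists>B. finite B \<and> V \<subseteq> complex_vector.span B)"

definition finite_rank :: "('a \<Rightarrow> 'b::complex_vector) \<Rightarrow> bool" where
  "finite_rank T \<longleftrightarrow> finite_cdim (range T)"

definition rank_of :: "('a \<Rightarrow> 'b::complex_vector) \<Rightarrow> nat" where
  "rank_of T = complex_vector.dim (range T)"


section \<open>The Banach space dual\<close>

typedef (overloaded) 'a cdual =
  "{\<xi> :: 'a::complex_normed_vector \<Rightarrow>\<^sub>L complex. \<forall>c x. blinfun_apply \<xi> (c *\<^sub>C x) = c * blinfun_apply \<xi> x}"
  by (rule exI[of _ 0]) simp

setup_lifting type_definition_cdual

lift_definition cdual_apply :: "'a::complex_normed_vector cdual \<Rightarrow> 'a \<Rightarrow> complex"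
  is blinfun_apply .

instantiation cdual :: (complex_normed_vector) complex_normed_vector
begin

lift_definition zero_cdual :: "'a cdual" is 0 by simp
lift_definition plus_cdual :: "'a cdual \<Rightarrow> 'a cdual \<Rightarrow> 'a cdual" is "(+)"
  by (simp add: blinfun.add_left ring_distribs)
lift_definition minus_cdual :: "'a cdual \<Rightarrow> 'a cdual \<Rightarrow> 'a cdual" is "(-)"
  by (simp add: blinfun.diff_left ring_distribs)
lift_definition uminus_cdual :: "'a cdual \<Rightarrow> 'a cdual" is uminus
  by (simp add: blinfun.minus_left)
lift_definition scaleR_cdual :: "real \<Rightarrow> 'a cdual \<Rightarrow> 'a cdual" is "(*\<^sub>R)"
  by (simp add: blinfun.scaleR_left)
lift_definition scaleC_cdual :: "complex \<Rightarrow> 'a cdual \<Rightarrow> 'a cdual"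
  is "\<lambda>c \<xi>. blinfun_mult_right c o\<^sub>L \<xi>" by simp
lift_definition norm_cdual :: "'a cdual \<Rightarrow> real" is norm .
definition "dist_cdual (\<xi> :: 'a cdual) \<eta> = norm (\<xi> - \<eta>)"
definition "sgn_cdual (\<xi> :: 'a cdual) = inverse (norm \<xi>) *\<^sub>R \<xi>"
definition [code del]:
  "uniformity_cdual = (INF e\<in>{0<..}. principal {(\<xi> :: 'a cdual, \<eta>). dist \<xi> \<eta> < e})"
definition [code del]:
  "open_cdual (U :: 'a cdual set) \<longleftrightarrow> (\<forall>\<xi>\<in>U. \<forall>\<^sub>F (\<xi>', \<eta>) in uniformity. \<xi>' = \<xi> \<longrightarrow> \<eta> \<in> U)"

instance
proof
  fix \<xi> \<eta> \<zeta> :: "'a cdual" and r s :: real and c d :: complex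
  show "\<xi> + \<eta> + \<zeta> = \<xi> + (\<eta> + \<zeta>)" by transfer simp
  show "\<xi> + \<eta> = \<eta> + \<xi>" by transfer simp
  show "0 + \<xi> = \<xi>" by transfer simp
  show "- \<xi> + \<xi> = 0" by transfer simp
  show "\<xi> - \<eta> = \<xi> + - \<eta>" by transfer simp
  show "r *\<^sub>R (\<xi> + \<eta>) = r *\<^sub>R \<xi> + r *\<^sub>R \<eta>" by transfer (simp add: scaleR_add_right)
  show "(r + s) *\<^sub>R \<xi> = r *\<^sub>R \<xi> + s *\<^sub>R \<xi>" by transfer (simp add: scaleR_add_left)
  show "r *\<^sub>R s *\<^sub>R \<xi> = (r * s) *\<^sub>R \<xi>" by transfer simp
  show "1 *\<^sub>R \<xi> = \<xi>" by transfer simp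
  show "c *\<^sub>C (\<xi> + \<eta>) = c *\<^sub>C \<xi> + c *\<^sub>C \<eta>"
    by transfer (auto intro!: blinfun_eqI simp: blinfun.add_left ring_distribs)
  show "(c + d) *\<^sub>C \<xi> = c *\<^sub>C \<xi> + d *\<^sub>C \<xi>"
    by transfer (auto intro!: blinfun_eqI simp: blinfun.add_left ring_distribs)
  show "c *\<^sub>C d *\<^sub>C \<xi> = (c * d) *\<^sub>C \<xi>"
    by transfer (auto intro!: blinfun_eqI)
  show "complex_of_real r *\<^sub>C \<xi> = r *\<^sub>R \<xi>"
    by transfer (auto intro!: blinfun_eqI simp: blinfun.scaleR_left scaleR_conv_of_real)
  show "dist \<xi> \<eta> = norm (\<xi> - \<eta>)" by (rule dist_cdual_def)
  show "sgn \<xi> = inverse (norm \<xi>) *\<^sub>R \<xi>" by (rule sgn_cdual_def)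
  show "uniformity = (INF e\<in>{0<..}. principal {(\<xi> :: 'a cdual, \<eta>). dist \<xi> \<eta> < e})"
    by (rule uniformity_cdual_def)
  show "open U \<longleftrightarrow> (\<forall>\<xi>\<in>U. \<forall>\<^sub>F (\<xi>', \<eta>) in uniformity. \<xi>' = \<xi> \<longrightarrow> \<eta> \<in> U)"
    for U :: "'a cdual set" by (rule open_cdual_def)
  show "norm \<xi> = 0 \<longleftrightarrow> \<xi> = 0" by transfer simp
  show "norm (\<xi> + \<eta>) \<le> norm \<xi> + norm \<eta>" by transfer (rule norm_triangle_ineq)
  show "norm (r *\<^sub>R \<xi>) = \<bar>r\<bar> * norm \<xi>" by transfer simp
  show "norm (c *\<^sub>C \<xi>) = cmod c * norm \<xi>"
  proof (transfer, goal_cases)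
    case (1 c \<xi>)
    have "onorm (\<lambda>x. c * blinfun_apply \<xi> x) = cmod c * onorm (blinfun_apply \<xi>)"
    proof (cases "c = 0")
      case False
      let ?f = "blinfun_apply \<xi>"
      have le: "onorm (\<lambda>x. a * g x) \<le> cmod a * onorm g" if "bounded_linear g" 
        for a and g :: "'a \<Rightarrow> complex"
        using onorm_compose[of "(*) a" g] that onorm_le[of "(*) a" "cmod a"]
          mult_right_mono[of "onorm ((*) a)" "cmod a" "onorm g"] onorm_pos_le[OF that]
        by (fastforce simp: bounded_linear_mult_right norm_mult o_def)
      have "onorm ?f = onorm (\<lambda>x. inverse c * (c * ?f x))"
        using False by (simp add: mult.assoc[symmetric])
      also have "\<dots> \<le> cmod (inverse c) * onorm (\<lambda>x. c * ?f x)"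
        by (intro le bounded_linear_intros)
      finally have "cmod c * onorm ?f \<le> cmod c * (cmod (inverse c) * onorm (\<lambda>x. c * ?f x))"
        by (intro mult_left_mono) auto
      also have "\<dots> = onorm (\<lambda>x. c * ?f x)"
        using False by (simp add: norm_inverse)
      finally have "cmod c * onorm ?f \<le> onorm (\<lambda>x. c * ?f x)" .
      with le[of ?f c] show ?thesis by (simp add: blinfun.bounded_linear_right antisym)
    qed (simp add: onorm_zero)
    then show ?case by (simp add: norm_blinfun.rep_eq blinfun_compose.rep_eq o_def)
  qed
qed

end

lemma cdual_apply_simps [simp]:
  "cdual_apply (\<xi> + \<eta>) x = cdual_apply \<xi> x + cdual_apply \<eta> x"
  "cdual_apply (\<xi> - \<eta>) x = cdual_apply \<xi> x - cdual_apply \<eta> x"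
  "cdual_apply (c *\<^sub>C \<xi>) x = c * cdual_apply \<xi> x"
  "cdual_apply (r *\<^sub>R \<xi>) x = r *\<^sub>R cdual_apply \<xi> x"
  "cdual_apply \<xi> (x + y) = cdual_apply \<xi> x + cdual_apply \<xi> y"
  "cdual_apply \<xi> (c *\<^sub>C x) = c * cdual_apply \<xi> x"
  by (transfer; simp add: blinfun.add_left blinfun.diff_left blinfun.scaleR_left blinfun.add_right)+

lemma norm_cdual_apply_le: "norm (cdual_apply \<xi> x) \<le> norm \<xi> * norm x"
  by transfer (rule norm_blinfun)

instance cdual :: (complex_normed_vector) cbanach
proof
  fix X :: "nat \<Rightarrow> 'a cdual"
  assume "Cauchy X"
  have dist_Rep: "dist (Rep_cdual \<xi>) (Rep_cdual \<eta>) = dist \<xi> \<eta>" for \<xi> \<eta> :: "'a cdual"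
    by (simp add: dist_norm norm_cdual.rep_eq minus_cdual.rep_eq)
  with \<open>Cauchy X\<close> have "Cauchy (\<lambda>n. Rep_cdual (X n))" by (simp add: Cauchy_def)
  then obtain f where f: "(\<lambda>n. Rep_cdual (X n)) \<longlonglongrightarrow> f"
    using convergent_eq_Cauchy by blast
  have "blinfun_apply f (c *\<^sub>C x) = c * blinfun_apply f x" for c x
  proof (rule LIMSEQ_unique)
    have lim: "(\<lambda>n. blinfun_apply (Rep_cdual (X n)) y) \<longlonglongrightarrow> blinfun_apply f y" for y
      by (intro tendsto_intros f)
    show "(\<lambda>n. blinfun_apply (Rep_cdual (X n)) (c *\<^sub>C x)) \<longlonglongrightarrow> blinfun_apply f (c *\<^sub>C x)"
      by (rule lim)
    show "(\<lambda>n. blinfun_apply (Rep_cdual (X n)) (c *\<^sub>C x)) \<longlonglongrightarrow> c * blinfun_apply f x"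
      using tendsto_mult_left[OF lim[of x], of c] Rep_cdual[of "X _"] by simp
  qed
  then have "Rep_cdual (Abs_cdual f) = f" by (simp add: Abs_cdual_inverse)
  then have "X \<longlonglongrightarrow> Abs_cdual f"
    using f dist_Rep[of "X _" "Abs_cdual f"] by (simp add: lim_sequentially)
  then show "convergent X" by (auto simp: convergent_def)
qed

definition cembed :: "'a::complex_normed_vector \<Rightarrow> 'a cdual cdual" where
  "cembed x = Abs_cdual (Blinfun (\<lambda>\<xi>. cdual_apply \<xi> x))"

lemma cdual_apply_cembed [simp]: "cdual_apply (cembed x) \<xi> = cdual_apply \<xi> x"
proof -
  let ?ev = "Blinfun (\<lambda>\<xi>. cdual_apply \<xi> x)"
  have "bounded_linear (\<lambda>\<xi>. cdual_apply \<xi> x)"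
    by (rule bounded_linear_intro[of _ "norm x"]) (simp_all add: norm_cdual_apply_le)
  then have ev: "blinfun_apply ?ev \<xi> = cdual_apply \<xi> x" for \<xi>
    by (simp add: bounded_linear_Blinfun_apply)
  then have "Rep_cdual (Abs_cdual ?ev) = ?ev"
    by (intro Abs_cdual_inverse) simp
  with ev show ?thesis
    unfolding cembed_def cdual_apply.rep_eq[of "Abs_cdual ?ev"] by simp
qed


section \<open>Matrix norms\<close>

text \<open>\<open>mat_opnorm I A\<close> is the operator norm of the matrix \<open>A\<close> on the Hilbert space \<open>\<ell>\<^sub>2(I)\<close>,
  for a finite index set \<open>I\<close>.\<close>

definition mat_opnorm :: "'i set \<Rightarrow> ('i \<Rightarrow> 'i \<Rightarrow> complex) \<Rightarrow> ennreal" where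
  "mat_opnorm I A =
    (SUP v\<in>{v. L2_set (\<lambda>j. cmod (v j)) I \<le> 1}.
      ennreal (L2_set (\<lambda>i. cmod (\<Sum>j\<in>I. A i j * v j)) I))"

text \<open>An operator space structure on a Banach space \<open>E\<close> is given by its matrix norms:
  \<open>N n x\<close> is the norm in \<open>M\<^sub>n(E)\<close> of the matrix with entries \<open>x i j\<close> for \<open>i, j < n\<close>.
  Only these entries matter.\<close>

type_synonym 'a matrix_norms = "nat \<Rightarrow> (nat \<Rightarrow> nat \<Rightarrow> 'a) \<Rightarrow> ennreal"

definition amplification_norm ::
    "'f matrix_norms \<Rightarrow> 'e matrix_norms \<Rightarrow> nat \<Rightarrow> ('f \<Rightarrow> 'e) \<Rightarrow> ennreal" where
  "amplification_norm F E n T = (SUP x\<in>{x. F n x \<le> 1}. E n (\<lambda>i j. T (x i j)))"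

definition cb_norm :: "'f matrix_norms \<Rightarrow> 'e matrix_norms \<Rightarrow> ('f \<Rightarrow> 'e) \<Rightarrow> ennreal" where
  "cb_norm F E T = (SUP n. amplification_norm F E n T)"

text \<open>The matrix norms of \<open>C(K)\<close>: here \<open>M\<^sub>n(C(K))\<close> is the C*-algebra \<open>C(K, M\<^sub>n)\<close> with the
  supremum norm.\<close>

definition C_norms :: "'t set \<Rightarrow> ('t \<Rightarrow> complex) matrix_norms" where
  "C_norms K n f = (SUP t\<in>K. mat_opnorm {..<n} (\<lambda>i j. f i j t))"

text \<open>The matrix norms of \<open>M\<^sub>k\<close>, using that \<open>M\<^sub>m(M\<^sub>k)\<close> is the space of all operators on
  \<open>\<ell>\<^sub>2({..<m} \<times> {..<k})\<close>.\<close>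

definition scalar_matrix_norms :: "nat \<Rightarrow> (nat \<Rightarrow> nat \<Rightarrow> complex) matrix_norms" where
  "scalar_matrix_norms k m A =
    mat_opnorm ({..<m} \<times> {..<k}) (\<lambda>(i, p) (j, q). A i j p q)"

text \<open>The operator space dual: \<open>M\<^sub>n(E\<^sup>*) = CB(E, M\<^sub>n)\<close>.\<close>

definition dual_norms :: "'a::cbanach matrix_norms \<Rightarrow> 'a cdual matrix_norms" where
  "dual_norms E n \<xi> = cb_norm E (scalar_matrix_norms n) (\<lambda>x i j. cdual_apply (\<xi> i j) x)"

text \<open>The structure induced by \<open>E \<hookrightarrow> C(B)\<close>, with \<open>B\<close> the unit ball of \<open>E\<^sup>*\<close>. The weak* topology
  of \<open>B\<close> does not enter, because the norms are suprema over \<open>B\<close>.\<close>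

definition min_norms :: "'a::cbanach matrix_norms" where
  "min_norms n x = C_norms {\<xi>. norm \<xi> \<le> 1} n (\<lambda>i j \<xi>. cdual_apply \<xi> (x i j))"

text \<open>The structure induced by the embedding of \<open>E\<close> into the dual of \<open>min(E\<^sup>*)\<close>.\<close>

definition max_norms :: "'a::cbanach matrix_norms" where
  "max_norms n x = dual_norms min_norms n (\<lambda>i j. cembed (x i j))"


section \<open>The trace of a finite rank operator\<close>

definition finite_rank_trace :: "('a::complex_vector \<Rightarrow> 'a) \<Rightarrow> complex" where
  "finite_rank_trace R =
    (let B = (SOME B. complex_vector.independent B \<and> complex_vector.span B = range R)
     in \<Sum>b\<in>B. complex_vector.representation B (R b) b)"

text \<open>The trace does not depend on the chosen basis of the range, and it is the usual one.\<close>

lemma finite_rank_trace_eq: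
  fixes R :: "'a::complex_vector \<Rightarrow> 'a" and y :: "'k \<Rightarrow> 'a"
  assumes K: "finite K"
    and f: "\<And>k. k \<in> K \<Longrightarrow> Vector_Spaces.linear scaleC (*) (f k)"
    and R: "\<And>x. R x = (\<Sum>k\<in>K. f k x *\<^sub>C y k)"
  shows "finite_rank_trace R = (\<Sum>k\<in>K. f k (y k))"
proof -
  note [simp] = complex_vector.span_base
  have f_add: "f k (x + z) = f k x + f k z" and f_scale: "f k (c *\<^sub>C x) = c * f k x"
    if "k \<in> K" for k x z c
    using f[OF that] by (simp_all add: Vector_Spaces.linear_iff)
  have f_sum: "f k (sum g C) = (\<Sum>c\<in>C. f k (g c))" if "k \<in> K" for k g and C :: "'a set"
  proof -
    interpret l: Vector_Spaces.linear scaleC "(*)" "f k" by (rule f[OF that])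
    show ?thesis by (rule l.sum)
  qed
  have "complex_vector.subspace (range R)"
  proof (rule complex_vector.subspaceI)
    have "f k 0 = 0" if "k \<in> K" for k using f_add[OF that, of 0 0] by simp
    then have "R 0 = 0" by (simp add: R)
    then show "0 \<in> range R" by (metis rangeI)
    have "R x + R z = R (x + z)" for x z
      by (simp add: R f_add scaleC_add_left sum.distrib)
    then show "x + z \<in> range R" if "x \<in> range R" "z \<in> range R" for x z
      using that by auto
    have "c *\<^sub>C R x = R (c *\<^sub>C x)" for c x
      by (simp add: R f_scale complex_vector.scale_sum_right)
    then show "c *\<^sub>C x \<in> range R" if "x \<in> range R" for c x
      using that by auto
  qed
  then have ex: "\<exists>B. complex_vector.independent B \<and> complex_vector.span B = range R"
    by (metis complex_vector.basis_exists complex_vector.span_subspace)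
  define B where "B = (SOME B. complex_vector.independent B \<and> complex_vector.span B = range R)"
  have B: "complex_vector.independent B" "complex_vector.span B = range R"
    using someI_ex[OF ex] by (simp_all add: B_def)
  define V where "V = complex_vector.span (y ` K)"
  have RV: "R x \<in> V" for x
    unfolding R V_def
    by (intro complex_vector.span_sum complex_vector.span_scale complex_vector.span_base) auto
  then have "range R \<subseteq> V" by auto
  then have "B \<subseteq> V" using complex_vector.span_superset[of B] unfolding B(2) by (rule order_trans[rotated])
  then obtain C where C: "B \<subseteq> C" "C \<subseteq> V" "complex_vector.independent C" "V \<subseteq> complex_vector.span C"
    by (rule complex_vector.maximal_independent_subset_extend[OF _ B(1)])
  have fin: "finite C"
    using complex_vector.independent_span_bound[of "y ` K" C] C K by (simp add: V_def)
  let ?r = "complex_vector.representation C"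
  have y: "y k \<in> V" if "k \<in> K" for k
    unfolding V_def using that by (intro complex_vector.span_base) auto
  have y_eq: "y k = (\<Sum>c\<in>C. ?r (y k) c *\<^sub>C c)" if "k \<in> K" for k
    using complex_vector.sum_representation_eq[of C "y k" C] C fin y[OF that] by auto
  have "finite_rank_trace R = (\<Sum>b\<in>B. complex_vector.representation B (R b) b)"
    by (simp add: finite_rank_trace_def B_def Let_def)
  also have "\<dots> = (\<Sum>c\<in>C. complex_vector.representation B (R c) c)"
    by (rule sum.mono_neutral_left) (use C fin complex_vector.representation_ne_zero in blast)+
  also have "\<dots> = (\<Sum>c\<in>C. ?r (R c) c)"
    using complex_vector.representation_extend[OF C(3) _ C(1)] B(2)
    by (intro sum.cong) auto
  also have "\<dots> = (\<Sum>c\<in>C. \<Sum>k\<in>K. ?r (y k) c * f k c)"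
  proof (rule sum.cong[OF refl])
    fix c
    have yC: "y k \<in> complex_vector.span C" if "k \<in> K" for k using y[OF that] C(4) by blast
    have "?r (R c) c = (\<Sum>k\<in>K. ?r (f k c *\<^sub>C y k) c)"
      unfolding R using C(3) yC
      by (subst complex_vector.representation_sum) (auto intro: complex_vector.span_scale)
    also have "\<dots> = (\<Sum>k\<in>K. ?r (y k) c * f k c)"
      using C(3) yC by (intro sum.cong) (auto simp: complex_vector.representation_scale)
    finally show "?r (R c) c = (\<Sum>k\<in>K. ?r (y k) c * f k c)" .
  qed
  also have "\<dots> = (\<Sum>k\<in>K. f k (\<Sum>c\<in>C. ?r (y k) c *\<^sub>C c))"
    by (subst sum.swap) (simp add: f_sum f_scale)
  also have "\<dots> = (\<Sum>k\<in>K. f k (y k))"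
    using y_eq by simp
  finally show ?thesis .
qed


section \<open>Factorization through Hilbert spaces\<close>

record 'h ip_space =
  carrier :: "'h set"
  vzero :: 'h
  vadd :: "'h \<Rightarrow> 'h \<Rightarrow> 'h"
  vscale :: "complex \<Rightarrow> 'h \<Rightarrow> 'h"
  vinner :: "'h \<Rightarrow> 'h \<Rightarrow> complex"

definition vnorm :: "'h ip_space \<Rightarrow> 'h \<Rightarrow> real" where
  "vnorm H x = sqrt (Re (vinner H x x))"

definition vdiff :: "'h ip_space \<Rightarrow> 'h \<Rightarrow> 'h \<Rightarrow> 'h" where
  "vdiff H x y = vadd H x (vscale H (-1) y)"

locale hilbert_space =
  fixes H :: "'h ip_space"
  assumes zero_closed: "vzero H \<in> carrier H"
    and add_closed: "\<lbrakk>x \<in> carrier H; y \<in> carrier H\<rbrakk> \<Longrightarrow> vadd H x y \<in> carrier H"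
    and scale_closed: "x \<in> carrier H \<Longrightarrow> vscale H c x \<in> carrier H"
    and add_assoc: "\<lbrakk>x \<in> carrier H; y \<in> carrier H; z \<in> carrier H\<rbrakk>
      \<Longrightarrow> vadd H (vadd H x y) z = vadd H x (vadd H y z)"
    and add_commute: "\<lbrakk>x \<in> carrier H; y \<in> carrier H\<rbrakk> \<Longrightarrow> vadd H x y = vadd H y x"
    and zero_add: "x \<in> carrier H \<Longrightarrow> vadd H (vzero H) x = x"
    and diff_self: "x \<in> carrier H \<Longrightarrow> vdiff H x x = vzero H"
    and scale_add_right: "\<lbrakk>x \<in> carrier H; y \<in> carrier H\<rbrakk>
      \<Longrightarrow> vscale H c (vadd H x y) = vadd H (vscale H c x) (vscale H c y)"
    and scale_add_left: "x \<in> carrier H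
      \<Longrightarrow> vscale H (c + d) x = vadd H (vscale H c x) (vscale H d x)"
    and scale_scale: "x \<in> carrier H \<Longrightarrow> vscale H c (vscale H d x) = vscale H (c * d) x"
    and scale_one: "x \<in> carrier H \<Longrightarrow> vscale H 1 x = x"
    and inner_add_left: "\<lbrakk>x \<in> carrier H; y \<in> carrier H; z \<in> carrier H\<rbrakk>
      \<Longrightarrow> vinner H (vadd H x y) z = vinner H x z + vinner H y z"
    and inner_scale_left: "\<lbrakk>x \<in> carrier H; y \<in> carrier H\<rbrakk>
      \<Longrightarrow> vinner H (vscale H c x) y = c * vinner H x y"
    and inner_cnj: "\<lbrakk>x \<in> carrier H; y \<in> carrier H\<rbrakk> \<Longrightarrow> vinner H x y = cnj (vinner H y x)"
    and inner_nonneg: "x \<in> carrier H \<Longrightarrow> 0 \<le> Re (vinner H x x)"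
    and inner_eq_zero: "\<lbrakk>x \<in> carrier H; vinner H x x = 0\<rbrakk> \<Longrightarrow> x = vzero H"
    and complete: "\<lbrakk>\<And>n. X n \<in> carrier H;
        \<And>e. 0 < e \<Longrightarrow> \<exists>N. \<forall>m\<ge>N. \<forall>n\<ge>N. vnorm H (vdiff H (X m) (X n)) < e\<rbrakk>
      \<Longrightarrow> \<exists>l\<in>carrier H. (\<lambda>n. vnorm H (vdiff H (X n) l)) \<longlonglongrightarrow> 0"

definition bounded_into :: "'h ip_space \<Rightarrow> ('a::cbanach \<Rightarrow> 'h) \<Rightarrow> bool" where
  "bounded_into H v \<longleftrightarrow> (\<forall>x. v x \<in> carrier H) \<and>
    (\<forall>x y. v (x + y) = vadd H (v x) (v y)) \<and> (\<forall>c x. v (c *\<^sub>C x) = vscale H c (v x)) \<and>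
    (\<exists>C. \<forall>x. vnorm H (v x) \<le> C * norm x)"

definition bounded_from :: "'h ip_space \<Rightarrow> ('h \<Rightarrow> 'b::cbanach) \<Rightarrow> bool" where
  "bounded_from H u \<longleftrightarrow>
    (\<forall>x\<in>carrier H. \<forall>y\<in>carrier H. u (vadd H x y) = u x + u y) \<and>
    (\<forall>c. \<forall>x\<in>carrier H. u (vscale H c x) = c *\<^sub>C u x) \<and>
    (\<exists>C. \<forall>x\<in>carrier H. norm (u x) \<le> C * vnorm H x)"

definition norm_into :: "'h ip_space \<Rightarrow> ('a::cbanach \<Rightarrow> 'h) \<Rightarrow> ennreal" where
  "norm_into H v = (SUP x\<in>{x. norm x \<le> 1}. ennreal (vnorm H (v x)))"

definition norm_from :: "'h ip_space \<Rightarrow> ('h \<Rightarrow> 'b::cbanach) \<Rightarrow> ennreal" where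
  "norm_from H u = (SUP x\<in>{x\<in>carrier H. vnorm H x \<le> 1}. ennreal (norm (u x)))"

definition hilbert_factorization ::
    "('a::cbanach \<Rightarrow> 'b::cbanach) \<Rightarrow> 'h ip_space \<Rightarrow> ('h \<Rightarrow> 'b) \<Rightarrow> ('a \<Rightarrow> 'h) \<Rightarrow> bool" where
  "hilbert_factorization S H u v \<longleftrightarrow>
    hilbert_space H \<and> bounded_from H u \<and> bounded_into H v \<and> (\<forall>x. S x = u (v x))"

text \<open>A definition cannot quantify over the type underlying \<open>H\<close>. Hilbert spaces with elements
  in \<^typ>\<open>nat \<Rightarrow> 'a\<close> are enough: only the closure of the range of \<open>v\<close> matters, and a point of
  it is determined by a sequence in \<^typ>\<open>'a\<close> whose image under \<open>v\<close> converges to it. The fact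
  \<open>gamma2_le\<close> below makes this precise.\<close>

definition gamma2 :: "('a::cbanach \<Rightarrow> 'b::cbanach) \<Rightarrow> ennreal" where
  "gamma2 S = (INF (H, u, v) \<in> {(H :: (nat \<Rightarrow> 'a) ip_space, u, v).
      hilbert_factorization (\<lambda>x. cembed (S x)) H u v}. norm_from H u * norm_into H v)"

definition gamma2_dual :: "('b::cbanach \<Rightarrow> 'a::cbanach) \<Rightarrow> ennreal" where
  "gamma2_dual T = (SUP S\<in>{S :: 'a \<Rightarrow> 'b. bounded_clinear S \<and> finite_rank S \<and> gamma2 S \<le> 1}.
      ennreal (cmod (finite_rank_trace (\<lambda>y. S (T y)))))"

context hilbert_space
begin

lemmas closed = zero_closed add_closed scale_closed

lemma inner_add_right: "\<lbrakk>x \<in> carrier H; y \<in> carrier H; z \<in> carrier H\<rbrakk>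
    \<Longrightarrow> vinner H z (vadd H x y) = vinner H z x + vinner H z y"
  using inner_cnj[of z "vadd H x y"] inner_cnj[of z x] inner_cnj[of z y]
  by (simp add: closed inner_add_left)

lemma inner_scale_right: "\<lbrakk>x \<in> carrier H; y \<in> carrier H\<rbrakk>
    \<Longrightarrow> vinner H y (vscale H c x) = cnj c * vinner H y x"
  using inner_cnj[of y "vscale H c x"] inner_cnj[of y x]
  by (simp add: closed inner_scale_left)

lemmas expand = vdiff_def closed inner_add_left inner_add_right inner_scale_left inner_scale_right

lemma diff_closed: "\<lbrakk>x \<in> carrier H; y \<in> carrier H\<rbrakk> \<Longrightarrow> vdiff H x y \<in> carrier H"
  by (simp add: expand)

lemma vnorm_sq: "x \<in> carrier H \<Longrightarrow> (vnorm H x)\<^sup>2 = Re (vinner H x x)"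
  by (simp add: vnorm_def inner_nonneg)

lemma vnorm_nonneg: "x \<in> carrier H \<Longrightarrow> 0 \<le> vnorm H x"
  by (simp add: vnorm_def inner_nonneg)

lemma vnorm_diff_commute:
  assumes "x \<in> carrier H" "y \<in> carrier H"
  shows "vnorm H (vdiff H x y) = vnorm H (vdiff H y x)"
  using assms by (simp add: vnorm_def expand)

lemma vnorm_diff_self: "x \<in> carrier H \<Longrightarrow> vnorm H (vdiff H x x) = 0"
  by (simp add: vnorm_def expand)

lemma eq_of_vnorm_diff:
  assumes x: "x \<in> carrier H" and y: "y \<in> carrier H" and 0: "vnorm H (vdiff H x y) = 0"
  shows "x = y"
proof -
  have "vdiff H x y = vzero H"
  proof (rule inner_eq_zero)
    show c: "vdiff H x y \<in> carrier H" using x y by (rule diff_closed)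
    have "Re (vinner H (vdiff H x y) (vdiff H x y)) = 0"
      using vnorm_sq[OF c] 0 by simp
    moreover have "Im (vinner H (vdiff H x y) (vdiff H x y)) = 0"
      using arg_cong[OF inner_cnj[OF c c], of Im] by simp
    ultimately show "vinner H (vdiff H x y) (vdiff H x y) = 0"
      by (simp add: complex_eq_iff)
  qed
  then have "vadd H (vdiff H x y) y = y" using y by (simp add: zero_add)
  moreover have "vadd H (vdiff H x y) y = vadd H x (vdiff H y y)"
    using x y add_commute[of "vscale H (-1) y" y] by (simp add: vdiff_def add_assoc closed)
  ultimately show ?thesis
    using x y add_commute[of x "vzero H"] by (simp add: diff_self zero_add closed)
qed

text \<open>Weak forms of the triangle inequality, obtained from the parallelogram law.\<close>

lemma parallelogram:
  assumes "x \<in> carrier H" "y \<in> carrier H"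
  shows "(vnorm H (vadd H x y))\<^sup>2 \<le> 2 * (vnorm H x)\<^sup>2 + 2 * (vnorm H y)\<^sup>2"
proof -
  have "0 \<le> Re (vinner H (vdiff H x y) (vdiff H x y))"
    using assms by (intro inner_nonneg diff_closed)
  with assms show ?thesis by (simp add: vnorm_sq expand)
qed

lemma vnorm_diff_triangle:
  assumes "x \<in> carrier H" "y \<in> carrier H" "z \<in> carrier H"
  shows "(vnorm H (vdiff H x z))\<^sup>2 \<le> 2 * (vnorm H (vdiff H x y))\<^sup>2 + 2 * (vnorm H (vdiff H y z))\<^sup>2"
proof -
  have "(vnorm H (vdiff H x z))\<^sup>2 = (vnorm H (vadd H (vdiff H x y) (vdiff H y z)))\<^sup>2"
    using assms by (simp add: vnorm_sq diff_closed closed) (simp add: expand algebra_simps)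
  then show ?thesis
    using parallelogram[of "vdiff H x y" "vdiff H y z"] assms by (simp add: diff_closed)
qed

lemma vnorm_diff_add:
  assumes "x \<in> carrier H" "y \<in> carrier H" "x' \<in> carrier H" "y' \<in> carrier H"
  shows "(vnorm H (vdiff H (vadd H x y) (vadd H x' y')))\<^sup>2
    \<le> 2 * (vnorm H (vdiff H x x'))\<^sup>2 + 2 * (vnorm H (vdiff H y y'))\<^sup>2"
proof -
  have "(vnorm H (vdiff H (vadd H x y) (vadd H x' y')))\<^sup>2 =
      (vnorm H (vadd H (vdiff H x x') (vdiff H y y')))\<^sup>2"
    using assms by (simp add: vnorm_sq diff_closed closed) (simp add: expand algebra_simps)
  then show ?thesis
    using parallelogram[of "vdiff H x x'" "vdiff H y y'"] assms by (simp add: diff_closed)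
qed

lemma vnorm_diff_scale:
  assumes "x \<in> carrier H" "y \<in> carrier H"
  shows "vnorm H (vdiff H (vscale H c x) (vscale H c y)) = cmod c * vnorm H (vdiff H x y)"
proof -
  have eq: "vinner H (vdiff H (vscale H c x) (vscale H c y)) (vdiff H (vscale H c x) (vscale H c y))
      = (c * cnj c) * vinner H (vdiff H x y) (vdiff H x y)"
    using assms by (simp add: expand algebra_simps)
  show ?thesis
    unfolding vnorm_def eq
    by (simp add: complex_norm_square[symmetric] real_sqrt_mult flip: of_real_power)
qed

definition converges :: "(nat \<Rightarrow> 'h) \<Rightarrow> 'h \<Rightarrow> bool" where
  "converges X l \<longleftrightarrow> (\<lambda>n. (vnorm H (vdiff H (X n) l))\<^sup>2) \<longlonglongrightarrow> 0"

lemma converges_iff: "converges X l \<longleftrightarrow> (\<lambda>n. vnorm H (vdiff H (X n) l)) \<longlonglongrightarrow> 0"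
  unfolding converges_def by (simp add: power_tendsto_0_iff)

lemma converges_unique:
  assumes X: "\<And>n. X n \<in> carrier H" and l: "l \<in> carrier H" "l' \<in> carrier H"
    and lim: "converges X l" "converges X l'"
  shows "l = l'"
proof (rule eq_of_vnorm_diff[OF l])
  have "(\<lambda>n. 2 * (vnorm H (vdiff H (X n) l))\<^sup>2 + 2 * (vnorm H (vdiff H (X n) l'))\<^sup>2) \<longlonglongrightarrow> 2 * 0 + 2 * 0"
    using lim unfolding converges_def by (intro tendsto_intros)
  moreover have "(vnorm H (vdiff H l l'))\<^sup>2
      \<le> 2 * (vnorm H (vdiff H (X n) l))\<^sup>2 + 2 * (vnorm H (vdiff H (X n) l'))\<^sup>2" for n
    using vnorm_diff_triangle[OF l(1) X[of n] l(2)] vnorm_diff_commute[OF l(1) X[of n]] by simp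
  ultimately have "(vnorm H (vdiff H l l'))\<^sup>2 \<le> 0"
    by (intro LIMSEQ_le_const) auto
  then show "vnorm H (vdiff H l l') = 0" by simp
qed

lemma converges_const: "x \<in> carrier H \<Longrightarrow> converges (\<lambda>_. x) x"
  by (simp add: converges_def vnorm_diff_self)

lemma converges_add:
  assumes c: "\<And>n. X n \<in> carrier H" "\<And>n. Y n \<in> carrier H" "l \<in> carrier H" "l' \<in> carrier H"
    and lim: "converges X l" "converges Y l'"
  shows "converges (\<lambda>n. vadd H (X n) (Y n)) (vadd H l l')"
proof -
  have "(\<lambda>n. 2 * (vnorm H (vdiff H (X n) l))\<^sup>2 + 2 * (vnorm H (vdiff H (Y n) l'))\<^sup>2) \<longlonglongrightarrow> 2 * 0 + 2 * 0"
    using lim unfolding converges_def by (intro tendsto_intros)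
  then have lim0: "(\<lambda>n. 2 * (vnorm H (vdiff H (X n) l))\<^sup>2 + 2 * (vnorm H (vdiff H (Y n) l'))\<^sup>2) \<longlonglongrightarrow> 0"
    by simp
  show ?thesis
    unfolding converges_def
    by (rule tendsto_sandwich[OF _ _ tendsto_const lim0])
      (use vnorm_diff_add c in \<open>auto intro!: always_eventually\<close>)
qed

lemma converges_scale:
  assumes c: "\<And>n. X n \<in> carrier H" "l \<in> carrier H" and lim: "converges X l"
  shows "converges (\<lambda>n. vscale H a (X n)) (vscale H a l)"
  using tendsto_mult_right_zero[of _ _ "cmod a"] lim
  by (simp add: converges_iff vnorm_diff_scale c)

text \<open>The closure of the range of \<open>v\<close>, carried over to the type \<^typ>\<open>nat \<Rightarrow> 'a\<close>.\<close>

definition range_closure :: "('a \<Rightarrow> 'h) \<Rightarrow> 'h set" where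
  "range_closure v = {z \<in> carrier H. \<exists>x. converges (\<lambda>k. v (x k)) z}"

definition code :: "('a \<Rightarrow> 'h) \<Rightarrow> 'h \<Rightarrow> nat \<Rightarrow> 'a" where
  "code v z = (SOME x. converges (\<lambda>k. v (x k)) z)"

definition decode :: "('a \<Rightarrow> 'h) \<Rightarrow> (nat \<Rightarrow> 'a) \<Rightarrow> 'h" where
  "decode v = inv_into (range_closure v) (code v)"

definition transported :: "('a \<Rightarrow> 'h) \<Rightarrow> (nat \<Rightarrow> 'a) ip_space" where
  "transported v = \<lparr>carrier = code v ` range_closure v, vzero = code v (vzero H),
    vadd = (\<lambda>a b. code v (vadd H (decode v a) (decode v b))),
    vscale = (\<lambda>c a. code v (vscale H c (decode v a))),
    vinner = (\<lambda>a b. vinner H (decode v a) (decode v b))\<rparr>"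

context
  fixes v :: "'a::cbanach \<Rightarrow> 'h"
  assumes v: "bounded_into H v"
begin

lemma v_closed: "v x \<in> carrier H"
  using v by (simp add: bounded_into_def)

lemma range_closure_carrier: "z \<in> range_closure v \<Longrightarrow> z \<in> carrier H"
  by (simp add: range_closure_def)

lemma v_range_closure: "v x \<in> range_closure v"
  using converges_const[OF v_closed[of x]] v_closed by (auto simp: range_closure_def)

lemma range_closure_add:
  assumes "z \<in> range_closure v" "w \<in> range_closure v"
  shows "vadd H z w \<in> range_closure v"
proof -
  obtain x y where "converges (\<lambda>k. v (x k)) z" "converges (\<lambda>k. v (y k)) w"
    using assms by (auto simp: range_closure_def)
  then have "converges (\<lambda>k. v (x k + y k)) (vadd H z w)"
    using converges_add[of "\<lambda>k. v (x k)" "\<lambda>k. v (y k)"] v assms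
    by (simp add: v_closed range_closure_carrier bounded_into_def)
  then show ?thesis
    using assms by (auto simp: range_closure_def closed)
qed

lemma range_closure_scale:
  assumes "z \<in> range_closure v"
  shows "vscale H c z \<in> range_closure v"
proof -
  obtain x where "converges (\<lambda>k. v (x k)) z"
    using assms by (auto simp: range_closure_def)
  then have "converges (\<lambda>k. v (c *\<^sub>C x k)) (vscale H c z)"
    using converges_scale[of "\<lambda>k. v (x k)" z c] v assms
    by (simp add: v_closed range_closure_carrier bounded_into_def)
  then show ?thesis
    using assms by (auto simp: range_closure_def closed)
qed

lemma range_closure_zero: "vzero H \<in> range_closure v"
  using range_closure_add[OF v_range_closure range_closure_scale[OF v_range_closure, of "-1"]]
    diff_self[OF v_closed] by (metis vdiff_def)

lemma range_closure_diff:
  "\<lbrakk>z \<in> range_closure v; w \<in> range_closure v\<rbrakk> \<Longrightarrow> vdiff H z w \<in> range_closure v"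
  by (simp add: vdiff_def range_closure_add range_closure_scale)

lemma range_closure_limit:
  assumes Z: "\<And>n. Z n \<in> range_closure v" and l: "l \<in> carrier H" and lim: "converges Z l"
  shows "l \<in> range_closure v"
proof -
  have "\<exists>x. (vnorm H (vdiff H (v x) (Z n)))\<^sup>2 < inverse (Suc n)" for n
  proof -
    obtain x where "(\<lambda>k. (vnorm H (vdiff H (v (x k)) (Z n)))\<^sup>2) \<longlonglongrightarrow> 0"
      using Z[of n] by (auto simp: range_closure_def converges_def)
    then have "\<forall>\<^sub>F k in sequentially. (vnorm H (vdiff H (v (x k)) (Z n)))\<^sup>2 < inverse (Suc n)"
      by (rule order_tendstoD) simp
    then show ?thesis by (auto dest: eventually_happens)
  qed
  then obtain x where x: "(vnorm H (vdiff H (v (x n)) (Z n)))\<^sup>2 < inverse (Suc n)" for n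
    by metis
  have "(\<lambda>n. 2 * inverse (real (Suc n)) + 2 * (vnorm H (vdiff H (Z n) l))\<^sup>2) \<longlonglongrightarrow> 2 * 0 + 2 * 0"
    using lim unfolding converges_def
    by (intro tendsto_intros LIMSEQ_inverse_real_of_nat)
  then have lim0: "(\<lambda>n. 2 * inverse (real (Suc n)) + 2 * (vnorm H (vdiff H (Z n) l))\<^sup>2) \<longlonglongrightarrow> 0"
    by simp
  have le: "(vnorm H (vdiff H (v (x n)) l))\<^sup>2
      \<le> 2 * inverse (real (Suc n)) + 2 * (vnorm H (vdiff H (Z n) l))\<^sup>2" for n
    using vnorm_diff_triangle[OF v_closed[of "x n"] range_closure_carrier[OF Z[of n]] l] x[of n]
    by linarith
  have "converges (\<lambda>n. v (x n)) l"
    unfolding converges_def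
    by (rule tendsto_sandwich[OF _ _ tendsto_const lim0]) (use le in auto)
  with l show ?thesis by (auto simp: range_closure_def)
qed

lemma decode_code:
  assumes "z \<in> range_closure v"
  shows "decode v (code v z) = z"
proof -
  have code: "converges (\<lambda>k. v (code v w k)) w" if "w \<in> range_closure v" for w
    using that someI_ex[of "\<lambda>x. converges (\<lambda>k. v (x k)) w"]
    unfolding code_def range_closure_def by blast
  have "inj_on (code v) (range_closure v)"
  proof (rule inj_onI)
    fix y w assume yw: "y \<in> range_closure v" "w \<in> range_closure v" "code v y = code v w"
    show "y = w"
      by (rule converges_unique[of "\<lambda>k. v (code v y k)"])
        (use yw code[OF yw(1)] code[OF yw(2)] v_closed range_closure_carrier in auto)
  qed
  then show ?thesis unfolding decode_def using assms by (rule inv_into_f_f)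
qed

lemma transported_select:
  "carrier (transported v) = code v ` range_closure v"
  "vzero (transported v) = code v (vzero H)"
  "vadd (transported v) a b = code v (vadd H (decode v a) (decode v b))"
  "vscale (transported v) c a = code v (vscale H c (decode v a))"
  "vinner (transported v) a b = vinner H (decode v a) (decode v b)"
  by (simp_all add: transported_def)

lemmas transported_simps = transported_select decode_code range_closure_add range_closure_scale
  range_closure_zero v_range_closure range_closure_carrier

lemma transported_vnorm: "vnorm (transported v) a = vnorm H (decode v a)"
  by (simp add: vnorm_def transported_def)

lemma transported_vdiff:
  "\<lbrakk>z \<in> range_closure v; w \<in> range_closure v\<rbrakk>
    \<Longrightarrow> vdiff (transported v) (code v z) (code v w) = code v (vdiff H z w)"
  by (simp add: vdiff_def transported_simps)

lemma hilbert_space_transported: "hilbert_space (transported v)"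
proof (unfold_locales, goal_cases)
  case (17 X)
  have "\<exists>z\<in>range_closure v. X n = code v z" for n
    using 17(1)[of n] by (auto simp: transported_def)
  then obtain Z where Z: "Z n \<in> range_closure v" and X: "X = (\<lambda>n. code v (Z n))" for n
    by metis
  have nrm: "vnorm (transported v) (vdiff (transported v) (code v z) (code v w)) =
      vnorm H (vdiff H z w)" if "z \<in> range_closure v" "w \<in> range_closure v" for z w
    using that by (simp add: transported_vnorm transported_vdiff decode_code range_closure_diff)
  obtain l where l: "l \<in> carrier H" "(\<lambda>n. vnorm H (vdiff H (Z n) l)) \<longlonglongrightarrow> 0"
    using complete[of Z] 17(2) Z by (auto simp: X nrm range_closure_carrier)
  then have "l \<in> range_closure v"
    using range_closure_limit[OF Z] by (simp add: converges_iff)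
  then show ?case
    using l Z by (intro bexI[of _ "code v l"]) (auto simp: X nrm transported_select)
next
  case (7 x)
  then show ?case
    by (auto simp: transported_vdiff diff_self transported_simps)
next
  case (12 x y z)
  then show ?case by (auto simp: transported_simps inner_add_left)
next
  case (13 x y z)
  then show ?case by (auto simp: transported_simps inner_scale_left)
next
  case (14 x y)
  then show ?case by (auto simp: transported_simps intro: inner_cnj)
next
  case (15 x)
  then show ?case by (auto simp: transported_simps inner_nonneg)
next
  case (16 x)
  then obtain z where "z \<in> range_closure v" "x = code v z" "vinner H z z = 0"
    by (auto simp: transported_simps)
  then show ?case using inner_eq_zero[of z] by (simp add: transported_simps)
next
  case (4 x y z)
  then show ?case by (auto simp: transported_simps add_assoc)
next
  case (5 x y)
  then show ?case by (auto simp: transported_simps add_commute)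
qed (auto simp: transported_simps zero_add scale_add_right scale_add_left scale_scale scale_one)

lemma bounded_into_transported: "bounded_into (transported v) (\<lambda>x. code v (v x))"
  using v by (auto simp: bounded_into_def transported_vnorm transported_simps)

lemma norm_into_transported: "norm_into (transported v) (\<lambda>x. code v (v x)) = norm_into H v"
  by (simp add: norm_into_def transported_vnorm decode_code v_range_closure)

lemma bounded_from_transported:
  "bounded_from H u \<Longrightarrow> bounded_from (transported v) (\<lambda>a. u (decode v a))"
  by (auto simp: bounded_from_def transported_vnorm transported_simps) (meson range_closure_carrier)

lemma norm_from_transported: "norm_from (transported v) (\<lambda>a. u (decode v a)) \<le> norm_from H u"
  unfolding norm_from_def
  by (rule SUP_least) (auto simp: transported_vnorm transported_simps intro!: SUP_upper2)

end

end

lemma gamma2_le: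
  fixes H :: "'h ip_space" and S :: "'a::cbanach \<Rightarrow> 'b::cbanach"
  assumes "hilbert_factorization (\<lambda>x. cembed (S x)) H u v"
  shows "gamma2 S \<le> norm_from H u * norm_into H v"
proof -
  interpret hilbert_space H using assms by (simp add: hilbert_factorization_def)
  have u: "bounded_from H u" and v: "bounded_into H v" and uv: "cembed (S x) = u (v x)" for x
    using assms by (simp_all add: hilbert_factorization_def)
  let ?H = "transported v" and ?u = "\<lambda>a. u (decode v a)" and ?v = "\<lambda>x. code v (v x)"
  have "hilbert_factorization (\<lambda>x. cembed (S x)) ?H ?u ?v"
    unfolding hilbert_factorization_def
    using hilbert_space_transported[OF v] bounded_from_transported[OF v u]
      bounded_into_transported[OF v] decode_code[OF v v_range_closure[OF v]] uv by simp
  then have "gamma2 S \<le> norm_from ?H ?u * norm_into ?H ?v"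
    unfolding gamma2_def by (intro INF_lower2[of "(?H, ?u, ?v)"]) auto
  also have "\<dots> \<le> norm_from H u * norm_into H v"
    unfolding norm_into_transported[OF v]
    by (intro mult_right_mono norm_from_transported[OF v]) simp
  finally show ?thesis .
qed

end

theory Submission
  imports Defs "Jordan_Normal_Form.Determinant"
begin

text \<open>
  Both inequalities compare suprema of traces.

  Unfolding the definitions, \<open>\<parallel>T\<parallel>\<^sub>c\<^sub>b\<close> is the supremum of the numbers
  \<open>\<bar>\<Sum> a (i, p) * (\<xi> i j) (T (x p q)) * b (j, q)\<bar>\<close>, where \<open>\<xi>\<close> and \<open>x\<close> are matrices over \<open>E\<^sup>*\<close> and
  \<open>F\<close> of minimal norm at most \<open>1\<close> and \<open>a\<close>, \<open>b\<close> are scalar matrices of Hilbert-Schmidt norm at most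
  \<open>1\<close>. Such a sum is the trace of \<open>S T\<close> for a map \<open>S : E \<rightarrow> F\<close> that factors through the
  Hilbert-Schmidt matrices via \<open>e \<mapsto> \<xi>(e) b\<close>. Since the product of a contraction with a
  Hilbert-Schmidt matrix has no larger Hilbert-Schmidt norm, \<open>\<gamma>\<^sub>2(S) \<le> 1\<close>. This is
  \<open>cb_norm_le_gamma2_dual\<close>.

  Conversely, let \<open>S\<close> factor as \<open>u v\<close> through a Hilbert space. Only the restriction of \<open>v\<close> to the
  range of \<open>T\<close> matters for \<open>tr (S T)\<close>. Orthonormalizing there with respect to the form
  \<open>\<langle>v x, v y\<rangle>\<close> gives \<open>tr (S T) = \<Sum>j<n. (\<xi> j) (T (x j))\<close> with sequences \<open>x\<close> in \<open>F\<close> and \<open>\<xi>\<close> in \<open>E\<^sup>*\<close>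
  that are weakly square summable with constants \<open>\<parallel>u\<parallel>\<close> and \<open>\<parallel>v\<parallel>\<close> (\<open>trace_semi_inner_le\<close>). To
  recover this sum from a single pairing of \<open>n \<times> n\<close> matrices one needs \<open>n\<close> scalar matrices \<open>G\<^sub>j\<close> of
  size \<open>n\<close> that span a Hilbert space up to a constant and are still as large as possible in the
  Hilbert-Schmidt sense. Random signs do this (\<open>sign_tensor\<close>): there are matrices \<open>G\<^sub>j\<close> with entries
  \<open>\<plusminus>1\<close> such that \<open>\<parallel>\<Sum>j. a j G\<^sub>j\<parallel>\<^sup>2 \<le> 108 n \<Sum>j. \<bar>a j\<bar>\<^sup>2\<close>, while \<open>\<parallel>G\<^sub>j\<parallel>\<^sub>H\<^sub>S\<^sup>2 = n\<^sup>2\<close>. The matrices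
  \<open>\<Sum>j. G\<^sub>j \<otimes> x j\<close> and \<open>\<Sum>j. G\<^sub>j \<otimes> \<xi> j\<close> then have minimal norms at most \<open>sqrt (108 n) \<parallel>u\<parallel>\<close> and
  \<open>sqrt (108 n) \<parallel>v\<parallel>\<close>, and their normalized pairing through \<open>T\<close> is at least \<open>n \<bar>tr (S T)\<bar>\<close>
  (\<open>trace_le_amplification_norm\<close>). So \<open>\<bar>tr (S T)\<bar> \<le> 108 \<parallel>u\<parallel> \<parallel>v\<parallel> \<parallel>T \<otimes> Id\<parallel>\<close>, and the constant
  \<open>120\<close> leaves room for the infimum in \<open>\<gamma>\<^sub>2\<close>.

  For an \<open>n\<close>-dimensional space, \<open>john_position\<close> factors the identity through a Hilbert space with
  constant \<open>sqrt (2 n)\<close>. Hence \<open>Id / sqrt (2 n)\<close> is a competitor in the definition of \<open>\<gamma>\<^sub>2\<^sup>*(Id)\<close>, with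
  trace \<open>sqrt (n / 2)\<close>, and \<open>120 * sqrt 2 < 170\<close> gives the last claim.
\<close>

section \<open>Functionals and finite sums\<close>

lemma cdual_eqI: "(\<And>x. cdual_apply \<xi> x = cdual_apply \<eta> x) \<Longrightarrow> \<xi> = \<eta>"
  by transfer (auto intro: blinfun_eqI)

lemma norm_cdual_le:
  assumes "\<And>x. cmod (cdual_apply \<xi> x) \<le> C * norm x" "0 \<le> C"
  shows "norm \<xi> \<le> C"
  using assms by transfer (rule norm_blinfun_bound)

lemma cdual_apply_zero [simp]: "cdual_apply 0 x = 0" "cdual_apply \<xi> 0 = 0"
  using cdual_apply_simps(2)[of 0 0 x] cdual_apply_simps(5)[of \<xi> 0 0] by simp_all

lemma cdual_apply_diff_right [simp]: "cdual_apply \<xi> (x - y) = cdual_apply \<xi> x - cdual_apply \<xi> y"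
  using cdual_apply_simps(5)[of \<xi> "x - y" y] by simp

lemma cdual_apply_sum: "cdual_apply (\<Sum>i\<in>I. \<xi> i) x = (\<Sum>i\<in>I. cdual_apply (\<xi> i) x)"
  by (induction I rule: infinite_finite_induct) simp_all

lemma cdual_apply_sum_right: "cdual_apply \<xi> (\<Sum>i\<in>I. x i) = (\<Sum>i\<in>I. cdual_apply \<xi> (x i))"
  by (induction I rule: infinite_finite_induct) simp_all

lemma cdual_of_function:
  fixes f :: "'a::complex_normed_vector \<Rightarrow> complex"
  assumes add: "\<And>x y. f (x + y) = f x + f y" and scale: "\<And>c x. f (c *\<^sub>C x) = c * f x"
    and bound: "\<And>x. cmod (f x) \<le> C * norm x"
  shows "\<exists>\<xi>. \<forall>x. cdual_apply \<xi> x = f x"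
proof -
  have "f (r *\<^sub>R x) = r *\<^sub>R f x" for r x
    using scale[of "complex_of_real r" x] by (simp add: scaleC_of_real scaleR_conv_of_real)
  then have "bounded_linear f"
    using bound by (intro bounded_linear_intro[of f C] add) (simp_all add: mult.commute)
  then have f: "blinfun_apply (Blinfun f) x = f x" for x by (simp add: bounded_linear_Blinfun_apply)
  then have "Rep_cdual (Abs_cdual (Blinfun f)) = Blinfun f"
    by (intro Abs_cdual_inverse) (simp add: scale)
  with f have "cdual_apply (Abs_cdual (Blinfun f)) x = f x" for x
    by (simp add: cdual_apply.rep_eq)
  then show ?thesis by blast
qed

lemma cembed_add: "cembed (x + y) = cembed x + cembed y"
  and cembed_scaleC: "cembed (c *\<^sub>C x) = c *\<^sub>C cembed x"
  by (rule cdual_eqI; simp)+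

lemma norm_cembed_le: "norm (cembed x) \<le> norm x"
proof (rule norm_cdual_le)
  show "cmod (cdual_apply (cembed x) \<xi>) \<le> norm x * norm \<xi>" for \<xi>
    using norm_cdual_apply_le[of \<xi> x] by (simp add: mult.commute)
qed simp

lemma cmod_sum_mult_le:
  "cmod (\<Sum>i\<in>I. a i * b i) \<le> L2_set (\<lambda>i. cmod (a i)) I * L2_set (\<lambda>i. cmod (b i)) I"
proof -
  have "cmod (\<Sum>i\<in>I. a i * b i) \<le> (\<Sum>i\<in>I. \<bar>cmod (a i)\<bar> * \<bar>cmod (b i)\<bar>)"
    using norm_sum[of "\<lambda>i. a i * b i" I] by (simp add: norm_mult)
  also have "\<dots> \<le> L2_set (\<lambda>i. cmod (a i)) I * L2_set (\<lambda>i. cmod (b i)) I"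
    by (rule L2_set_mult_ineq)
  finally show ?thesis .
qed

lemma sum_mult_cnj_eq: "(\<Sum>i\<in>I. a i * cnj (a i)) = complex_of_real ((L2_set (\<lambda>i. cmod (a i)) I)\<^sup>2)"
  by (simp add: L2_set_def sum_nonneg complex_norm_square[symmetric])

lemma L2_set_cmod_zeroD: "finite I \<Longrightarrow> L2_set (\<lambda>i. cmod (a i)) I = 0 \<Longrightarrow> i \<in> I \<Longrightarrow> a i = 0"
  by (simp add: L2_set_eq_0_iff)

lemma L2_set_cmod_scale:
  "L2_set (\<lambda>i. cmod (c * a i)) I = cmod c * L2_set (\<lambda>i. cmod (a i)) I"
  by (simp add: norm_mult L2_set_right_distrib)

lemma L2_set_product: "L2_set f (I \<times> J) = L2_set (\<lambda>i. L2_set (\<lambda>j. f (i, j)) J) I"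
  by (simp add: L2_set_def sum.cartesian_product' sum_nonneg)

lemma L2_set_swap: "L2_set (\<lambda>i. L2_set (f i) J) I = L2_set (\<lambda>j. L2_set (\<lambda>i. f i j) I) J"
  unfolding L2_set_def by (simp add: sum_nonneg) (rule sum.swap)

text \<open>A matrix and its transpose have the same norm: for \<open>y = c A\<close>, pairing \<open>y\<close> with its own
  conjugate moves \<open>A\<close> to the other side, so \<open>\<parallel>y\<parallel>\<^sup>2 \<le> M \<parallel>c\<parallel> \<parallel>y\<parallel>\<close>.\<close>

lemma L2_set_transpose_le:
  assumes M: "0 \<le> M" and A: "\<And>v :: 'j \<Rightarrow> complex.
      L2_set (\<lambda>i. cmod (\<Sum>j\<in>J. A i j * v j)) I \<le> M * L2_set (\<lambda>j. cmod (v j)) J"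
  shows "L2_set (\<lambda>j. cmod (\<Sum>i\<in>I. c i * A i j)) J \<le> M * L2_set (\<lambda>i. cmod (c i)) I"
proof -
  define y where "y j = (\<Sum>i\<in>I. c i * A i j)" for j
  let ?y = "L2_set (\<lambda>j. cmod (y j)) J" and ?c = "L2_set (\<lambda>i. cmod (c i)) I"
  show ?thesis
  proof (cases "?y = 0")
    case True
    then show ?thesis using M by (simp add: y_def)
  next
    case False
    have "?y\<^sup>2 = cmod (\<Sum>j\<in>J. y j * cnj (y j))"
      unfolding sum_mult_cnj_eq norm_of_real by simp
    also have "(\<Sum>j\<in>J. y j * cnj (y j)) = (\<Sum>j\<in>J. \<Sum>i\<in>I. c i * A i j * cnj (y j))"
      by (simp add: y_def sum_distrib_right)
    also have "\<dots> = (\<Sum>i\<in>I. \<Sum>j\<in>J. c i * A i j * cnj (y j))" by (rule sum.swap)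
    also have "\<dots> = (\<Sum>i\<in>I. c i * (\<Sum>j\<in>J. A i j * cnj (y j)))"
      by (simp add: sum_distrib_left mult.assoc)
    also have "cmod \<dots> \<le> ?c * L2_set (\<lambda>i. cmod (\<Sum>j\<in>J. A i j * cnj (y j))) I"
      by (rule cmod_sum_mult_le)
    also have "\<dots> \<le> ?c * (M * L2_set (\<lambda>j. cmod (cnj (y j))) J)"
      by (intro mult_left_mono A) simp
    finally have "?y * ?y \<le> (M * ?c) * ?y" by (simp add: power2_eq_square mult_ac)
    moreover have "?y > 0" using False L2_set_nonneg[of "\<lambda>j. cmod (y j)" J] by linarith
    ultimately show ?thesis by (simp add: y_def)
  qed
qed

section \<open>Matrix norms\<close>

lemma mat_opnorm_le_one_iff:
  assumes I: "finite I"
  shows "mat_opnorm I A \<le> 1 \<longleftrightarrow>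
    (\<forall>v. L2_set (\<lambda>i. cmod (\<Sum>j\<in>I. A i j * v j)) I \<le> L2_set (\<lambda>j. cmod (v j)) I)"
proof
  assume le: "mat_opnorm I A \<le> 1"
  show "\<forall>v. L2_set (\<lambda>i. cmod (\<Sum>j\<in>I. A i j * v j)) I \<le> L2_set (\<lambda>j. cmod (v j)) I"
  proof
    fix v
    let ?n = "L2_set (\<lambda>j. cmod (v j)) I"
    show "L2_set (\<lambda>i. cmod (\<Sum>j\<in>I. A i j * v j)) I \<le> ?n"
    proof (cases "?n = 0")
      case True
      then have "v j = 0" if "j \<in> I" for j using L2_set_cmod_zeroD[OF I _ that] by blast
      then show ?thesis by (simp add: L2_set_def)
    next
      case False
      then have n: "?n > 0" using L2_set_nonneg[of "\<lambda>j. cmod (v j)" I] by linarith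
      define w where "w j = complex_of_real (1 / ?n) * v j" for j
      have "L2_set (\<lambda>j. cmod (w j)) I = 1"
        unfolding w_def L2_set_cmod_scale using n by (simp only: norm_of_real) simp
      then have "ennreal (L2_set (\<lambda>i. cmod (\<Sum>j\<in>I. A i j * w j)) I) \<le> mat_opnorm I A"
        unfolding mat_opnorm_def by (intro SUP_upper) simp
      with le have "ennreal (L2_set (\<lambda>i. cmod (\<Sum>j\<in>I. A i j * w j)) I) \<le> 1"
        by (rule order_trans[rotated])
      then have "L2_set (\<lambda>i. cmod (\<Sum>j\<in>I. A i j * w j)) I \<le> 1" by (simp only: ennreal_le_1)
      also have "(\<lambda>i. cmod (\<Sum>j\<in>I. A i j * w j)) = (\<lambda>i. cmod (complex_of_real (1 / ?n) * (\<Sum>j\<in>I. A i j * v j)))"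
        by (simp add: w_def sum_divide_distrib mult_ac)
      finally have "(1 / ?n) * L2_set (\<lambda>i. cmod (\<Sum>j\<in>I. A i j * v j)) I \<le> 1"
        unfolding L2_set_cmod_scale norm_of_real using n by simp
      then show ?thesis using n by (simp add: field_simps)
    qed
  qed
next
  assume le: "\<forall>v. L2_set (\<lambda>i. cmod (\<Sum>j\<in>I. A i j * v j)) I \<le> L2_set (\<lambda>j. cmod (v j)) I"
  show "mat_opnorm I A \<le> 1"
    unfolding mat_opnorm_def
  proof (rule SUP_least)
    fix v assume "v \<in> {v. L2_set (\<lambda>j. cmod (v j)) I \<le> 1}"
    then have "L2_set (\<lambda>i. cmod (\<Sum>j\<in>I. A i j * v j)) I \<le> 1"
      using le[rule_format, of v] by simp
    then have "ennreal (L2_set (\<lambda>i. cmod (\<Sum>j\<in>I. A i j * v j)) I) \<le> ennreal 1"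
      by (rule ennreal_leI)
    then show "ennreal (L2_set (\<lambda>i. cmod (\<Sum>j\<in>I. A i j * v j)) I) \<le> 1" by simp
  qed
qed

lemma mat_opnorm_pairing_le:
  assumes v: "L2_set (\<lambda>j. cmod (v j)) I \<le> 1" and w: "L2_set (\<lambda>i. cmod (w i)) I \<le> 1"
  shows "ennreal (cmod (\<Sum>i\<in>I. \<Sum>j\<in>I. w i * A i j * v j)) \<le> mat_opnorm I A"
proof -
  have "cmod (\<Sum>i\<in>I. \<Sum>j\<in>I. w i * A i j * v j) = cmod (\<Sum>i\<in>I. w i * (\<Sum>j\<in>I. A i j * v j))"
    by (simp add: sum_distrib_left mult.assoc)
  also have "\<dots> \<le> L2_set (\<lambda>i. cmod (w i)) I * L2_set (\<lambda>i. cmod (\<Sum>j\<in>I. A i j * v j)) I"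
    by (rule cmod_sum_mult_le)
  also have "\<dots> \<le> 1 * L2_set (\<lambda>i. cmod (\<Sum>j\<in>I. A i j * v j)) I"
    by (intro mult_right_mono w) simp
  finally have "ennreal (cmod (\<Sum>i\<in>I. \<Sum>j\<in>I. w i * A i j * v j))
      \<le> ennreal (L2_set (\<lambda>i. cmod (\<Sum>j\<in>I. A i j * v j)) I)" by (simp add: ennreal_leI)
  also have "\<dots> \<le> mat_opnorm I A" unfolding mat_opnorm_def using v by (intro SUP_upper) simp
  finally show ?thesis .
qed

text \<open>The converse of \<open>mat_opnorm_pairing_le\<close>: the pairing with the conjugate of \<open>A v\<close>, normalized,
  recovers the norm of \<open>A v\<close>.\<close>

lemma mat_opnorm_leI:
  assumes le: "\<And>v w. \<lbrakk>L2_set (\<lambda>j. cmod (v j)) I \<le> 1; L2_set (\<lambda>i. cmod (w i)) I \<le> 1\<rbrakk>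
    \<Longrightarrow> ennreal (cmod (\<Sum>i\<in>I. \<Sum>j\<in>I. w i * A i j * v j)) \<le> M"
  shows "mat_opnorm I A \<le> M"
  unfolding mat_opnorm_def
proof (rule SUP_least)
  fix v assume v: "v \<in> {v. L2_set (\<lambda>j. cmod (v j)) I \<le> 1}"
  define y where "y i = (\<Sum>j\<in>I. A i j * v j)" for i
  let ?n = "L2_set (\<lambda>i. cmod (y i)) I"
  have "ennreal ?n \<le> M"
  proof (cases "?n = 0")
    case False
    then have n: "?n > 0" using L2_set_nonneg[of "\<lambda>i. cmod (y i)" I] by linarith
    define w where "w i = complex_of_real (1 / ?n) * cnj (y i)" for i
    have "L2_set (\<lambda>i. cmod (w i)) I = 1"
      unfolding w_def L2_set_cmod_scale using n by (simp only: norm_of_real complex_mod_cnj) simp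
    then have "ennreal (cmod (\<Sum>i\<in>I. \<Sum>j\<in>I. w i * A i j * v j)) \<le> M" using v by (intro le) simp_all
    also have "(\<Sum>i\<in>I. \<Sum>j\<in>I. w i * A i j * v j) = (\<Sum>i\<in>I. w i * y i)"
      by (simp add: y_def sum_distrib_left mult.assoc)
    also have "\<dots> = complex_of_real (1 / ?n) * (\<Sum>i\<in>I. y i * cnj (y i))"
      unfolding w_def sum_distrib_left by (intro sum.cong refl) (simp only: mult_ac)
    also have "\<dots> = complex_of_real ?n"
      unfolding sum_mult_cnj_eq of_real_mult[symmetric] using n by (simp add: power2_eq_square)
    finally show ?thesis using n by simp
  qed simp
  then show "ennreal (L2_set (\<lambda>i. cmod (\<Sum>j\<in>I. A i j * v j)) I) \<le> M" by (simp add: y_def)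
qed

lemma min_norms_le_one_iff:
  "min_norms n x \<le> 1 \<longleftrightarrow> (\<forall>\<eta> v. L2_set (\<lambda>i. cmod (\<Sum>j<n. cdual_apply \<eta> (x i j) * v j)) {..<n}
    \<le> norm \<eta> * L2_set (\<lambda>j. cmod (v j)) {..<n})"
proof -
  have "min_norms n x \<le> 1 \<longleftrightarrow> (\<forall>\<eta>. norm \<eta> \<le> 1 \<longrightarrow>
    (\<forall>v. L2_set (\<lambda>i. cmod (\<Sum>j<n. cdual_apply \<eta> (x i j) * v j)) {..<n}
    \<le> L2_set (\<lambda>j. cmod (v j)) {..<n}))" (is "_ \<longleftrightarrow> ?R")
    by (auto simp: min_norms_def C_norms_def SUP_le_iff mat_opnorm_le_one_iff)
  also have "\<dots> \<longleftrightarrow> (\<forall>\<eta> v. L2_set (\<lambda>i. cmod (\<Sum>j<n. cdual_apply \<eta> (x i j) * v j)) {..<n}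
    \<le> norm \<eta> * L2_set (\<lambda>j. cmod (v j)) {..<n})"
  proof (intro iffI allI impI)
    fix \<eta> v assume R: ?R
    show "L2_set (\<lambda>i. cmod (\<Sum>j<n. cdual_apply \<eta> (x i j) * v j)) {..<n}
      \<le> norm \<eta> * L2_set (\<lambda>j. cmod (v j)) {..<n}"
    proof (cases "\<eta> = 0")
      case False
      then have n: "norm \<eta> > 0" by simp
      define \<zeta> where "\<zeta> = complex_of_real (1 / norm \<eta>) *\<^sub>C \<eta>"
      have "norm \<zeta> \<le> 1" using n by (simp add: \<zeta>_def norm_scaleC norm_divide)
      with R have "L2_set (\<lambda>i. cmod (\<Sum>j<n. cdual_apply \<zeta> (x i j) * v j)) {..<n}
        \<le> L2_set (\<lambda>j. cmod (v j)) {..<n}" by blast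
      also have "(\<lambda>i. cmod (\<Sum>j<n. cdual_apply \<zeta> (x i j) * v j)) =
          (\<lambda>i. cmod (complex_of_real (1 / norm \<eta>) * (\<Sum>j<n. cdual_apply \<eta> (x i j) * v j)))"
        by (simp add: \<zeta>_def sum_distrib_left mult_ac)
      finally have "(1 / norm \<eta>) * L2_set (\<lambda>i. cmod (\<Sum>j<n. cdual_apply \<eta> (x i j) * v j)) {..<n}
          \<le> L2_set (\<lambda>j. cmod (v j)) {..<n}"
        unfolding L2_set_cmod_scale norm_of_real using n by simp
      then show ?thesis using n by (simp add: field_simps)
    qed (simp add: L2_set_def)
  next
    fix \<eta> :: "'a cdual" and v
    assume R: "\<forall>\<eta> v. L2_set (\<lambda>i. cmod (\<Sum>j<n. cdual_apply \<eta> (x i j) * v j)) {..<n}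
      \<le> norm \<eta> * L2_set (\<lambda>j. cmod (v j)) {..<n}" and "norm \<eta> \<le> 1"
    have "L2_set (\<lambda>i. cmod (\<Sum>j<n. cdual_apply \<eta> (x i j) * v j)) {..<n}
      \<le> norm \<eta> * L2_set (\<lambda>j. cmod (v j)) {..<n}" using R by blast
    also have "\<dots> \<le> 1 * L2_set (\<lambda>j. cmod (v j)) {..<n}"
      by (intro mult_right_mono \<open>norm \<eta> \<le> 1\<close>) simp
    finally show "L2_set (\<lambda>i. cmod (\<Sum>j<n. cdual_apply \<eta> (x i j) * v j)) {..<n}
      \<le> L2_set (\<lambda>j. cmod (v j)) {..<n}" by simp
  qed
  finally show ?thesis .
qed

lemma max_norms_eq:
  "max_norms n x = (SUP m. SUP \<xi>\<in>{\<xi>. min_norms m \<xi> \<le> 1}.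
    mat_opnorm ({..<m} \<times> {..<n}) (\<lambda>(i, p) (j, q). cdual_apply (\<xi> i j) (x p q)))"
  by (simp add: max_norms_def dual_norms_def cb_norm_def amplification_norm_def scalar_matrix_norms_def)

section \<open>Factorization through a finite-dimensional Hilbert space\<close>

text \<open>Vectors vanish outside \<open>I\<close>, so that equality of functions is equality in the space.\<close>

definition ell2 :: "'i set \<Rightarrow> ('i \<Rightarrow> complex) ip_space" where
  "ell2 I = ip_space.make {h. \<forall>i. i \<notin> I \<longrightarrow> h i = 0} (\<lambda>_. 0) (\<lambda>g h i. g i + h i)
    (\<lambda>c h i. c * h i) (\<lambda>g h. \<Sum>i\<in>I. g i * cnj (h i))"

lemma ell2_select [simp]:
  "h \<in> ip_space.carrier (ell2 I) \<longleftrightarrow> (\<forall>i. i \<notin> I \<longrightarrow> h i = 0)" "vzero (ell2 I) = (\<lambda>_. 0)"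
  "vadd (ell2 I) g h = (\<lambda>i. g i + h i)" "vscale (ell2 I) c h = (\<lambda>i. c * h i)"
  "vinner (ell2 I) g h = (\<Sum>i\<in>I. g i * cnj (h i))"
  by (simp_all add: ell2_def ip_space.defs)

lemma ell2_vdiff [simp]: "vdiff (ell2 I) g h = (\<lambda>i. g i - h i)"
  by (simp add: vdiff_def)

lemma ell2_vnorm [simp]: "vnorm (ell2 I) h = L2_set (\<lambda>i. cmod (h i)) I"
  by (simp only: vnorm_def ell2_select sum_mult_cnj_eq) (simp add: L2_set_nonneg)

lemma hilbert_space_ell2:
  assumes I: "finite I"
  shows "hilbert_space (ell2 I)"
proof (unfold_locales, goal_cases)
  case (16 x)
  then have "L2_set (\<lambda>i. cmod (x i)) I = 0"
    by (simp only: ell2_select sum_mult_cnj_eq) simp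
  then have "x i = 0" if "i \<in> I" for i using L2_set_cmod_zeroD[OF I _ that] by blast
  with 16(1) show ?case by (auto simp: fun_eq_iff)
next
  case (17 X)
  have le: "cmod (h i) \<le> L2_set (\<lambda>i. cmod (h i)) I" if "i \<in> I" for h :: "'a \<Rightarrow> complex" and i
    using member_le_L2_set[OF I that, of "\<lambda>i. cmod (h i)"] by simp
  have "\<exists>l. (\<lambda>n. X n i) \<longlonglongrightarrow> l" if i: "i \<in> I" for i
  proof -
    have "Cauchy (\<lambda>n. X n i)"
      unfolding Cauchy_def
    proof (intro allI impI)
      fix e :: real assume "e > 0"
      then obtain N where N: "\<forall>m\<ge>N. \<forall>n\<ge>N. L2_set (\<lambda>i. cmod (X m i - X n i)) I < e"
        using 17(2)[of e] by auto
      have "dist (X m i) (X n i) < e" if "m \<ge> N" "n \<ge> N" for m n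
        using N that le[OF i, of "\<lambda>i. X m i - X n i"] by (fastforce simp: dist_norm)
      then show "\<exists>M. \<forall>m\<ge>M. \<forall>n\<ge>M. dist (X m i) (X n i) < e" by blast
    qed
    then show ?thesis using convergent_eq_Cauchy by blast
  qed
  then obtain l where l: "\<And>i. i \<in> I \<Longrightarrow> (\<lambda>n. X n i) \<longlonglongrightarrow> l i" by metis
  define l' where "l' i = (if i \<in> I then l i else 0)" for i
  have "(\<lambda>n. sqrt (\<Sum>i\<in>I. (cmod (X n i - l' i))\<^sup>2)) \<longlonglongrightarrow> sqrt (\<Sum>i\<in>I. (cmod (l i - l' i))\<^sup>2)"
    by (intro tendsto_intros l)
  then have "(\<lambda>n. sqrt (\<Sum>i\<in>I. (cmod (X n i - l' i))\<^sup>2)) \<longlonglongrightarrow> 0" by (simp add: l'_def)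
  then show ?case by (intro bexI[of _ l']) (simp_all add: L2_set_def l'_def)
qed (auto simp: algebra_simps sum.distrib sum_distrib_left sum_nonneg fun_eq_iff cnj_sum
    simp flip: of_real_power simp: complex_norm_square[symmetric] intro!: sum_nonneg)

lemma linear_functional_iff:
  "Vector_Spaces.linear scaleC (*) f \<longleftrightarrow>
    (\<forall>x y. f (x + y) = f x + f y) \<and> (\<forall>c x. f (c *\<^sub>C x) = c * f x)"
  for f :: "'a::complex_vector \<Rightarrow> complex"
  by (auto simp: Vector_Spaces.linear_iff complex_vector.vector_space_axioms
      intro: vector_space.intro simp: vector_space_def algebra_simps)

text \<open>The data of a factorization \<open>x \<mapsto> (z i x)\<^sub>i \<mapsto> \<Sum>i. z i x *\<^sub>C y i\<close> through \<open>\<ell>\<^sub>2(I)\<close>. The norm of the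
  second map is only controlled through functionals, which is what the norm of the bidual in
  \<^const>\<open>gamma2\<close> sees; this avoids any appeal to the Hahn-Banach theorem.\<close>

locale l2_factorization =
  fixes I :: "'i set" and z :: "'i \<Rightarrow> 'a::cbanach \<Rightarrow> complex" and y :: "'i \<Rightarrow> 'b::cbanach"
    and U V :: real
  assumes I: "finite I" and UV: "0 \<le> U" "0 \<le> V"
    and add: "\<And>i x x'. i \<in> I \<Longrightarrow> z i (x + x') = z i x + z i x'"
    and scale: "\<And>i c x. i \<in> I \<Longrightarrow> z i (c *\<^sub>C x) = c * z i x"
    and z: "\<And>x. L2_set (\<lambda>i. cmod (z i x)) I \<le> V * norm x"
    and y: "\<And>\<eta>. L2_set (\<lambda>i. cmod (cdual_apply \<eta> (y i))) I \<le> U * norm \<eta>"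
begin

definition factored_map :: "'a \<Rightarrow> 'b" where "factored_map x = (\<Sum>i\<in>I. z i x *\<^sub>C y i)"

lemma factored_map_add: "factored_map (x + x') = factored_map x + factored_map x'"
  by (simp add: factored_map_def add scaleC_add_left sum.distrib)

lemma factored_map_scaleC: "factored_map (c *\<^sub>C x) = c *\<^sub>C factored_map x"
  by (simp add: factored_map_def scale complex_vector.scale_sum_right)

lemma bounded_clinear_factored_map: "bounded_clinear factored_map"
  unfolding bounded_clinear_def
proof (intro conjI allI)
  show "bounded_linear factored_map"
  proof (rule bounded_linear_intro)
    show "factored_map (x + x') = factored_map x + factored_map x'" for x x' by (rule factored_map_add)
    show "factored_map (r *\<^sub>R x) = r *\<^sub>R factored_map x" for r x by (metis factored_map_scaleC scaleC_of_real)
    fix x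
    have zi: "cmod (z i x) \<le> V * norm x" if "i \<in> I" for i
      using member_le_L2_set[OF I that, of "\<lambda>i. cmod (z i x)"] z[of x] by simp
    have "norm (factored_map x) \<le> (\<Sum>i\<in>I. cmod (z i x) * norm (y i))"
      unfolding factored_map_def by (rule order_trans[OF norm_sum]) (simp add: norm_scaleC)
    also have "\<dots> \<le> (\<Sum>i\<in>I. V * norm x * norm (y i))"
      by (intro sum_mono mult_right_mono zi) simp_all
    finally show "norm (factored_map x) \<le> norm x * (V * (\<Sum>i\<in>I. norm (y i)))"
      by (simp add: sum_distrib_left mult_ac)
  qed
qed (rule factored_map_scaleC)

lemma finite_rank_factored_map: "finite_rank factored_map"
  unfolding finite_rank_def finite_cdim_def
proof (intro exI conjI)
  show "finite (y ` I)" using I by simp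
  show "range factored_map \<subseteq> complex_vector.span (y ` I)"
    unfolding factored_map_def
    by (intro image_subsetI complex_vector.span_sum complex_vector.span_scale
        complex_vector.span_base imageI)
qed

lemma gamma2_factored_map_le: "gamma2 factored_map \<le> ennreal (U * V)"
proof -
  define v where "v x = (\<lambda>i. if i \<in> I then z i x else 0)" for x
  define u where "u h = cembed (\<Sum>i\<in>I. h i *\<^sub>C y i)" for h
  have vn: "vnorm (ell2 I) (v x) \<le> V * norm x" for x
  proof -
    have "L2_set (\<lambda>i. cmod (v x i)) I = L2_set (\<lambda>i. cmod (z i x)) I"
      by (rule L2_set_cong) (simp_all add: v_def)
    then show ?thesis using z by simp
  qed
  have un: "norm (u h) \<le> U * vnorm (ell2 I) h" for h
  proof (rule norm_cdual_le)
    fix \<eta> :: "'b cdual"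
    have "cmod (cdual_apply (u h) \<eta>) = cmod (\<Sum>i\<in>I. h i * cdual_apply \<eta> (y i))"
      by (simp add: u_def cdual_apply_sum_right)
    also have "\<dots> \<le> L2_set (\<lambda>i. cmod (h i)) I * L2_set (\<lambda>i. cmod (cdual_apply \<eta> (y i))) I"
      by (rule cmod_sum_mult_le)
    also have "\<dots> \<le> L2_set (\<lambda>i. cmod (h i)) I * (U * norm \<eta>)"
      by (intro mult_left_mono y) simp
    finally show "cmod (cdual_apply (u h) \<eta>) \<le> U * vnorm (ell2 I) h * norm \<eta>"
      by (simp add: mult_ac)
  qed (simp add: UV)
  have "hilbert_factorization (\<lambda>x. cembed (factored_map x)) (ell2 I) u v"
    unfolding hilbert_factorization_def
  proof (intro conjI allI)
    show "hilbert_space (ell2 I)" by (rule hilbert_space_ell2[OF I])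
    show "bounded_from (ell2 I) u"
      unfolding bounded_from_def using un
      by (auto simp: u_def scaleC_add_left sum.distrib cembed_add simp flip: cembed_scaleC
          complex_vector.scale_sum_right complex_vector.scale_scale intro!: exI[of _ U])
    show "bounded_into (ell2 I) v"
      unfolding bounded_into_def using vn
      by (auto simp: v_def add scale fun_eq_iff intro!: exI[of _ V])
    show "cembed (factored_map x) = u (v x)" for x by (simp add: factored_map_def u_def v_def)
  qed
  then have "gamma2 factored_map \<le> norm_from (ell2 I) u * norm_into (ell2 I) v" by (rule gamma2_le)
  also have "\<dots> \<le> ennreal U * ennreal V"
  proof (rule mult_mono)
    have "norm (u h) \<le> U" if "vnorm (ell2 I) h \<le> 1" for h
      using un[of h] mult_left_mono[OF that UV(1)] by simp
    then show "norm_from (ell2 I) u \<le> ennreal U"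
      unfolding norm_from_def by (intro SUP_least ennreal_leI) blast
    have "vnorm (ell2 I) (v x) \<le> V" if "norm x \<le> 1" for x
      using vn[of x] mult_left_mono[OF that UV(2)] by simp
    then show "norm_into (ell2 I) v \<le> ennreal V"
      unfolding norm_into_def by (intro SUP_least ennreal_leI) blast
  qed simp_all
  finally show ?thesis using UV by (simp add: ennreal_mult)
qed

lemma trace_le_gamma2_dual:
  assumes T: "bounded_clinear T" and UV1: "U * V \<le> 1"
  shows "ennreal (cmod (\<Sum>i\<in>I. z i (T (y i)))) \<le> gamma2_dual T"
proof -
  interpret T: bounded_linear T using T by (simp add: bounded_clinear_def)
  have "finite_rank_trace (\<lambda>x. factored_map (T x)) = (\<Sum>i\<in>I. z i (T (y i)))"
  proof (rule finite_rank_trace_eq[OF I])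
    show "Vector_Spaces.linear scaleC (*) (\<lambda>x. z i (T x))" if "i \<in> I" for i
      using that T unfolding linear_functional_iff bounded_clinear_def
      by (simp add: T.add add scale)
    show "factored_map (T x) = (\<Sum>i\<in>I. z i (T x) *\<^sub>C y i)" for x by (rule factored_map_def)
  qed
  moreover have "gamma2 factored_map \<le> 1"
    using order_trans[OF gamma2_factored_map_le ennreal_leI[OF UV1]] by simp
  ultimately show ?thesis
    unfolding gamma2_dual_def using bounded_clinear_factored_map finite_rank_factored_map
    by (intro SUP_upper2[of factored_map]) auto
qed

end

section \<open>The upper bound for the cb norm\<close>

lemma L2_set_left_mult_le:
  assumes A: "\<And>v. L2_set (\<lambda>i. cmod (\<Sum>j\<in>J. A i j * v j)) I \<le> M * L2_set (\<lambda>j. cmod (v j)) J"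
    and M: "0 \<le> M"
  shows "L2_set (\<lambda>(i, l). cmod (\<Sum>j\<in>J. A i j * b j l)) (I \<times> L)
    \<le> M * L2_set (\<lambda>(j, l). cmod (b j l)) (J \<times> L)"
proof -
  have "L2_set (\<lambda>(i, l). cmod (\<Sum>j\<in>J. A i j * b j l)) (I \<times> L)
      = L2_set (\<lambda>l. L2_set (\<lambda>i. cmod (\<Sum>j\<in>J. A i j * b j l)) I) L"
    by (simp add: L2_set_product) (rule L2_set_swap)
  also have "\<dots> \<le> L2_set (\<lambda>l. M * L2_set (\<lambda>j. cmod (b j l)) J) L"
    by (intro L2_set_mono A) simp
  also have "\<dots> = M * L2_set (\<lambda>l. L2_set (\<lambda>j. cmod (b j l)) J) L"
    by (rule L2_set_right_distrib[symmetric, OF M])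
  also have "L2_set (\<lambda>l. L2_set (\<lambda>j. cmod (b j l)) J) L = L2_set (\<lambda>(j, l). cmod (b j l)) (J \<times> L)"
    by (simp add: L2_set_product) (rule L2_set_swap)
  finally show ?thesis .
qed

lemma L2_set_right_mult_le:
  assumes A: "\<And>v. L2_set (\<lambda>k. cmod (\<Sum>l\<in>L. A k l * v l)) K \<le> M * L2_set (\<lambda>l. cmod (v l)) L"
    and M: "0 \<le> M"
  shows "L2_set (\<lambda>(i, l). cmod (\<Sum>k\<in>K. a i k * A k l)) (I \<times> L)
    \<le> M * L2_set (\<lambda>(i, k). cmod (a i k)) (I \<times> K)"
proof -
  have "L2_set (\<lambda>(i, l). cmod (\<Sum>k\<in>K. a i k * A k l)) (I \<times> L)
      = L2_set (\<lambda>i. L2_set (\<lambda>l. cmod (\<Sum>k\<in>K. a i k * A k l)) L) I"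
    by (simp add: L2_set_product)
  also have "\<dots> \<le> L2_set (\<lambda>i. M * L2_set (\<lambda>k. cmod (a i k)) K) I"
    by (intro L2_set_mono L2_set_transpose_le A M) simp
  also have "\<dots> = M * L2_set (\<lambda>(i, k). cmod (a i k)) (I \<times> K)"
    by (simp add: L2_set_product L2_set_right_distrib[OF M])
  finally show ?thesis .
qed

text \<open>The expressions whose supremum is the cb norm are traces of \<open>S T\<close>. The map \<open>S\<close> factors through
  the Hilbert space of \<open>m \<times> n\<close> matrices: \<open>e\<close> goes to the product of the matrix \<open>(\<xi> i j e)\<close> with
  \<open>b\<close>, and a matrix \<open>h\<close> goes to \<open>\<Sum>i q. h i q *\<^sub>C y (i, q)\<close>, where \<open>y\<close> is the product of \<open>a\<close> with
  the matrix \<open>x\<close>. Both maps are contractions, because multiplying a Hilbert-Schmidt matrix by a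
  contraction does not increase its Hilbert-Schmidt norm.\<close>

lemma cb_norm_le_gamma2_dual:
  fixes T :: "'f::cbanach \<Rightarrow> 'e::cbanach"
  assumes T: "bounded_clinear T"
  shows "cb_norm min_norms max_norms T \<le> gamma2_dual T"
  unfolding cb_norm_def amplification_norm_def max_norms_eq
proof (intro SUP_least mat_opnorm_leI)
  interpret T: bounded_linear T using T by (simp add: bounded_clinear_def)
  fix n m and x :: "nat \<Rightarrow> nat \<Rightarrow> 'f" and \<xi> :: "nat \<Rightarrow> nat \<Rightarrow> 'e cdual"
    and b a :: "nat \<times> nat \<Rightarrow> complex"
  assume x: "x \<in> {x. min_norms n x \<le> 1}" and \<xi>: "\<xi> \<in> {\<xi>. min_norms m \<xi> \<le> 1}"
    and b: "L2_set (\<lambda>t. cmod (b t)) ({..<m} \<times> {..<n}) \<le> 1"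
    and a: "L2_set (\<lambda>t. cmod (a t)) ({..<m} \<times> {..<n}) \<le> 1"
  let ?I = "{..<m} \<times> {..<n}"
  define z where "z = (\<lambda>(i, q) e. \<Sum>j<m. cdual_apply (\<xi> i j) e * b (j, q))"
  define y where "y = (\<lambda>(i, q). \<Sum>p<n. a (i, p) *\<^sub>C x p q)"
  interpret l2_factorization ?I z y 1 1
  proof
    show "z t (e + e') = z t e + z t e'" for t e e'
      by (simp add: z_def split_beta sum.distrib ring_distribs)
    show "z t (c *\<^sub>C e) = c * z t e" for t c e
      by (simp add: z_def split_beta sum_distrib_left mult.assoc)
    fix e
    have "L2_set (\<lambda>i. cmod (\<Sum>j<m. cdual_apply (\<xi> i j) e * v j)) {..<m}
        \<le> norm e * L2_set (\<lambda>j. cmod (v j)) {..<m}" for v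
    proof -
      have "L2_set (\<lambda>i. cmod (\<Sum>j<m. cdual_apply (\<xi> i j) e * v j)) {..<m}
          \<le> norm (cembed e) * L2_set (\<lambda>j. cmod (v j)) {..<m}"
        using iffD1[OF min_norms_le_one_iff, rule_format, of m \<xi> "cembed e" v] \<xi> by simp
      also have "norm (cembed e) \<le> norm e"
        by (rule norm_cembed_le)
      then have "norm (cembed e) * L2_set (\<lambda>j. cmod (v j)) {..<m} \<le> norm e * L2_set (\<lambda>j. cmod (v j)) {..<m}"
        by (rule mult_right_mono) simp
      finally show ?thesis .
    qed
    then have "L2_set (\<lambda>(i, q). cmod (\<Sum>j<m. cdual_apply (\<xi> i j) e * b (j, q))) ?I
        \<le> norm e * L2_set (\<lambda>(j, q). cmod (b (j, q))) ?I"
      by (rule L2_set_left_mult_le) simp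
    also have "\<dots> \<le> norm e * 1" using b by (intro mult_left_mono) (simp_all add: split_beta')
    finally show "L2_set (\<lambda>t. cmod (z t e)) ?I \<le> 1 * norm e"
      by (simp add: z_def split_beta')
  next
    fix \<eta> :: "'f cdual"
    have "L2_set (\<lambda>(i, q). cmod (\<Sum>p<n. a (i, p) * cdual_apply \<eta> (x p q))) ?I
        \<le> norm \<eta> * L2_set (\<lambda>(i, p). cmod (a (i, p))) ?I"
      using x by (intro L2_set_right_mult_le) (simp_all add: min_norms_le_one_iff)
    also have "\<dots> \<le> norm \<eta> * 1" using a by (intro mult_left_mono) (simp_all add: split_beta')
    finally show "L2_set (\<lambda>t. cmod (cdual_apply \<eta> (y t))) ?I \<le> 1 * norm \<eta>"
      by (simp add: y_def split_beta' cdual_apply_sum_right)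
  qed simp_all
  have T_sum: "T (\<Sum>p\<in>P. c p *\<^sub>C f p) = (\<Sum>p\<in>P. c p *\<^sub>C T (f p))" for P :: "nat set" and c f
    using T by (simp add: T.sum bounded_clinear_def)
  have "(\<Sum>t\<in>?I. \<Sum>s\<in>?I. a t * (case t of (i, p) \<Rightarrow> \<lambda>(j, q). cdual_apply (\<xi> i j) (T (x p q))) s * b s)
      = (\<Sum>i<m. \<Sum>p<n. \<Sum>j<m. \<Sum>q<n. a (i, p) * cdual_apply (\<xi> i j) (T (x p q)) * b (j, q))"
    by (simp add: sum.cartesian_product')
  also have "\<dots> = (\<Sum>i<m. \<Sum>q<n. \<Sum>j<m. \<Sum>p<n. a (i, p) * cdual_apply (\<xi> i j) (T (x p q)) * b (j, q))"
  proof (rule sum.cong[OF refl])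
    fix i
    let ?f = "\<lambda>p q j. a (i, p) * cdual_apply (\<xi> i j) (T (x p q)) * b (j, q)"
    have "(\<Sum>p<n. \<Sum>j<m. \<Sum>q<n. ?f p q j) = (\<Sum>p<n. \<Sum>q<n. \<Sum>j<m. ?f p q j)"
      by (intro sum.cong refl sum.swap)
    also have "\<dots> = (\<Sum>q<n. \<Sum>p<n. \<Sum>j<m. ?f p q j)" by (rule sum.swap)
    also have "\<dots> = (\<Sum>q<n. \<Sum>j<m. \<Sum>p<n. ?f p q j)" by (intro sum.cong refl sum.swap)
    finally show "(\<Sum>p<n. \<Sum>j<m. \<Sum>q<n. ?f p q j) = (\<Sum>q<n. \<Sum>j<m. \<Sum>p<n. ?f p q j)" .
  qed
  also have "\<dots> = (\<Sum>t\<in>?I. z t (T (y t)))"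
    by (simp add: sum.cartesian_product' z_def y_def T_sum cdual_apply_sum_right sum_distrib_left
        sum_distrib_right mult_ac)
  finally have eq: "(\<Sum>t\<in>?I. \<Sum>s\<in>?I. a t * (case t of (i, p) \<Rightarrow> \<lambda>(j, q). cdual_apply (\<xi> i j) (T (x p q))) s * b s)
    = (\<Sum>t\<in>?I. z t (T (y t)))" .
  show "ennreal (cmod (\<Sum>t\<in>?I. \<Sum>s\<in>?I. a t * (case t of (i, p) \<Rightarrow> \<lambda>(j, q). cdual_apply (\<xi> i j) (T (x p q))) s * b s))
    \<le> gamma2_dual T"
    unfolding eq by (rule trace_le_gamma2_dual[OF T]) simp
qed

section \<open>Sign tensors of small norm\<close>

text \<open>The power series of \<open>cosh x\<close> and \<open>exp (x\<^sup>2 / 2)\<close> compare term by term, since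
  \<open>2 ^ n * fact n \<le> fact (2 * n)\<close>.\<close>

lemma exp_add_exp_minus_le: "exp x + exp (- x) \<le> 2 * exp (x\<^sup>2 / 2)" for x :: real
proof -
  have pw: "(2 :: real) ^ n * fact n \<le> fact (2 * n)" for n
  proof (induction n)
    case (Suc n)
    have "(2 :: real) ^ Suc n * fact (Suc n) = (2 ^ n * fact n) * (2 * (real n + 1))"
      by (simp add: algebra_simps)
    also have "\<dots> \<le> fact (2 * n) * ((2 * real n + 2) * (2 * real n + 1))"
      by (intro mult_mono Suc) (auto simp: algebra_simps)
    also have "\<dots> = fact (2 * Suc n)" by (simp add: algebra_simps)
    finally show ?case .
  qed simp
  have c: "(\<lambda>n. x ^ (2 * n) / fact (2 * n)) sums cosh x"
  proof -
    have "(\<lambda>n. if even n then x ^ n /\<^sub>R fact n else 0) sums cosh x" by (rule cosh_converges)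
    then have "(\<lambda>n. (\<lambda>n. if even n then x ^ n /\<^sub>R fact n else 0) (2 * n)) sums cosh x"
      by (subst sums_mono_reindex) (auto simp: strict_mono_def elim: evenE)
    then show ?thesis by (simp add: field_simps)
  qed
  have e: "(\<lambda>n. (x\<^sup>2 / 2) ^ n / fact n) sums exp (x\<^sup>2 / 2)"
    using exp_converges[of "x\<^sup>2 / 2"] by (simp add: field_simps)
  have "cosh x \<le> exp (x\<^sup>2 / 2)"
  proof (rule sums_le[OF _ c e])
    fix n
    have "x ^ (2 * n) / fact (2 * n) \<le> x ^ (2 * n) / (2 ^ n * fact n)"
      using pw[of n] by (intro divide_left_mono) (auto simp: zero_le_even_power)
    then show "x ^ (2 * n) / fact (2 * n) \<le> (x\<^sup>2 / 2) ^ n / fact n"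
      by (simp add: power_mult power_divide)
  qed
  then show ?thesis by (simp add: cosh_def)
qed

lemma sum_signs_exp:
  fixes x :: "'j \<Rightarrow> real"
  assumes J: "finite J"
  shows "(\<Sum>\<epsilon>\<in>PiE J (\<lambda>_. {-1, 1}). exp (\<Sum>j\<in>J. \<epsilon> j * x j))
    \<le> 2 ^ card J * exp ((\<Sum>j\<in>J. (x j)\<^sup>2) / 2)"
proof -
  have "(\<Sum>\<epsilon>\<in>PiE J (\<lambda>_. {-1, 1}). exp (\<Sum>j\<in>J. \<epsilon> j * x j))
      = (\<Sum>\<epsilon>\<in>PiE J (\<lambda>_. {-1, 1}). \<Prod>j\<in>J. exp (\<epsilon> j * x j))"
    by (simp add: exp_sum J)
  also have "\<dots> = (\<Prod>j\<in>J. \<Sum>s\<in>{-1, 1}. exp (s * x j))"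
    by (rule prod_sum_PiE[symmetric]) (use J in auto)
  also have "\<dots> = (\<Prod>j\<in>J. exp (x j) + exp (- x j))"
    by (simp add: add.commute)
  also have "\<dots> \<le> (\<Prod>j\<in>J. 2 * exp ((x j)\<^sup>2 / 2))"
    by (intro prod_mono) (simp add: exp_add_exp_minus_le add_nonneg_nonneg)
  also have "\<dots> = 2 ^ card J * exp ((\<Sum>j\<in>J. (x j)\<^sup>2) / 2)"
    by (simp add: prod.distrib exp_sum J sum_divide_distrib)
  finally show ?thesis .
qed

text \<open>Averaging over all signs bounds the mean of \<open>\<Sum>x\<in>X. exp (l * (\<Sum>j. \<epsilon> j * x j))\<close> by
  \<open>card X * exp (l\<^sup>2 * s / 2)\<close>, so some choice of signs does no worse than the mean. The value
  \<open>l = sqrt (2 L / s)\<close> used below balances the two contributions to the exponent.\<close>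

lemma signs_exist:
  fixes X :: "('j \<Rightarrow> real) set" and L s :: real
  assumes J: "finite J" and X: "finite X" "real (card X) \<le> exp L" and L: "L > 0" and s: "s > 0"
    and sq: "\<And>x. x \<in> X \<Longrightarrow> (\<Sum>j\<in>J. (x j)\<^sup>2) \<le> s"
  obtains \<epsilon> :: "'j \<Rightarrow> real" where "\<And>j. j \<in> J \<Longrightarrow> \<epsilon> j \<in> {-1, 1}"
    and "\<And>x. x \<in> X \<Longrightarrow> (\<Sum>j\<in>J. \<epsilon> j * x j) \<le> sqrt (2 * s * L)"
proof -
  define l where "l = sqrt (2 * L / s)"
  have l: "l > 0" "l\<^sup>2 = 2 * L / s" using L s by (auto simp: l_def)
  define P where "P = PiE J (\<lambda>_. {-1, 1 :: real})"
  define f where "f \<epsilon> = (\<Sum>x\<in>X. exp (\<Sum>j\<in>J. \<epsilon> j * (l * x j)))" for \<epsilon> :: "'j \<Rightarrow> real"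
  have P: "finite P" "card P = 2 ^ card J" using J by (auto simp: P_def finite_PiE card_PiE numeral_2_eq_2)
  have "(\<Sum>\<epsilon>\<in>P. f \<epsilon>) = (\<Sum>x\<in>X. \<Sum>\<epsilon>\<in>P. exp (\<Sum>j\<in>J. \<epsilon> j * (l * x j)))"
    unfolding f_def by (rule sum.swap)
  also have "\<dots> \<le> (\<Sum>x\<in>X. 2 ^ card J * exp L)"
  proof (rule sum_mono)
    fix x assume x: "x \<in> X"
    have "(\<Sum>j\<in>J. (l * x j)\<^sup>2) / 2 = l\<^sup>2 * (\<Sum>j\<in>J. (x j)\<^sup>2) / 2"
      by (simp add: power_mult_distrib sum_distrib_left)
    also have "\<dots> \<le> l\<^sup>2 * s / 2"
      using sq[OF x] by (intro divide_right_mono mult_left_mono) auto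
    also have "\<dots> = L" using l s by simp
    finally have "exp ((\<Sum>j\<in>J. (l * x j)\<^sup>2) / 2) \<le> exp L" by simp
    then have "2 ^ card J * exp ((\<Sum>j\<in>J. (l * x j)\<^sup>2) / 2) \<le> 2 ^ card J * exp L" by simp
    then show "(\<Sum>\<epsilon>\<in>P. exp (\<Sum>j\<in>J. \<epsilon> j * (l * x j))) \<le> 2 ^ card J * exp L"
      unfolding P_def using sum_signs_exp[OF J, of "\<lambda>j. l * x j"] by linarith
  qed
  also have "\<dots> \<le> exp L * (2 ^ card J * exp L)"
    using X(2) by (simp add: mult_right_mono)
  also have "\<dots> = (\<Sum>\<epsilon>\<in>P. exp (2 * L))"
    by (simp add: P exp_double power2_eq_square)
  finally have le: "(\<Sum>\<epsilon>\<in>P. f \<epsilon>) \<le> (\<Sum>\<epsilon>\<in>P. exp (2 * L))" .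
  have "\<exists>\<epsilon>\<in>P. f \<epsilon> \<le> exp (2 * L)"
  proof (rule ccontr)
    assume "\<not> ?thesis"
    then have "(\<Sum>\<epsilon>\<in>P. f \<epsilon>) > (\<Sum>\<epsilon>\<in>P. exp (2 * L))"
      using P by (intro sum_strict_mono) (auto simp: card_gt_0_iff not_le)
    with le show False by simp
  qed
  then obtain \<epsilon> where e: "\<epsilon> \<in> P" "f \<epsilon> \<le> exp (2 * L)" by blast
  show thesis
  proof
    show "\<epsilon> j \<in> {-1, 1}" if "j \<in> J" for j using e(1) that by (auto simp: P_def PiE_def)
    fix x assume x: "x \<in> X"
    have "exp (\<Sum>j\<in>J. \<epsilon> j * (l * x j)) \<le> f \<epsilon>"
      unfolding f_def by (rule member_le_sum[OF x]) (use X in auto)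
    with e have "(\<Sum>j\<in>J. \<epsilon> j * (l * x j)) \<le> 2 * L" by (metis exp_le_cancel_iff order_trans)
    also have "(\<Sum>j\<in>J. \<epsilon> j * (l * x j)) = l * (\<Sum>j\<in>J. \<epsilon> j * x j)"
      by (simp add: sum_distrib_left algebra_simps)
    finally have 1: "(\<Sum>j\<in>J. \<epsilon> j * x j) \<le> 2 * L / l" using l by (simp add: field_simps)
    have "2 * L / l = sqrt (2 * s * L)"
    proof (rule real_sqrt_unique[symmetric])
      show "(2 * L / l)\<^sup>2 = 2 * s * L"
        using l L s by (simp add: power_divide field_simps power2_eq_square)
    qed (use l L in auto)
    with 1 show "(\<Sum>j\<in>J. \<epsilon> j * x j) \<le> sqrt (2 * s * L)" by simp
  qed
qed

text \<open>Up to the factor \<open>1 / (10 * sqrt n)\<close> these are the lattice points in the ball of radius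
  \<open>11 / 10\<close>. The box makes the set visibly finite.\<close>

definition lattice_net :: "nat \<Rightarrow> (nat \<Rightarrow> int) set" where
  "lattice_net n = {z \<in> PiE {..<n} (\<lambda>_. {-int (11 * n)..int (11 * n)}).
     (\<Sum>i<n. (real_of_int (z i))\<^sup>2) \<le> 121 * real n}"

lemma finite_lattice_net: "finite (lattice_net n)"
  by (simp add: lattice_net_def finite_PiE)

lemma abs_sum_le_of_square_sum:
  fixes f :: "nat \<Rightarrow> real"
  assumes "(\<Sum>i<n. (f i)\<^sup>2) \<le> 121 * real n"
  shows "(\<Sum>i<n. \<bar>f i\<bar>) \<le> 11 * real n"
proof -
  have "(\<Sum>i<n. \<bar>f i\<bar> * 1) \<le> L2_set f {..<n} * L2_set (\<lambda>_. 1) {..<n}"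
    using L2_set_mult_ineq[of f "\<lambda>_. 1" "{..<n}"] by simp
  also have "\<dots> \<le> sqrt (121 * real n) * sqrt (real n)"
    unfolding L2_set_def using assms by (intro mult_mono) auto
  also have "\<dots> = 11 * real n"
    by (simp add: real_sqrt_mult)
  finally show ?thesis by simp
qed

lemma sum_geometric_symmetric:
  "(\<Sum>z\<in>{-int m..int m}. (9 / 10 :: real) ^ nat \<bar>z\<bar>) \<le> 20"
proof -
  have split: "{-int m..int m} \<subseteq> int ` {..m} \<union> (\<lambda>k. - int k) ` {..m}"
  proof
    fix z assume z: "z \<in> {-int m..int m}"
    then have "nat \<bar>z\<bar> \<le> m" by auto
    moreover have "z = int (nat \<bar>z\<bar>) \<or> z = - int (nat \<bar>z\<bar>)" by auto
    ultimately show "z \<in> int ` {..m} \<union> (\<lambda>k. - int k) ` {..m}" by blast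
  qed
  have g: "(\<Sum>k\<le>m. (9 / 10 :: real) ^ k) \<le> 10"
    by (subst sum_gp0) (auto simp: field_simps)
  have "(\<Sum>z\<in>{-int m..int m}. (9 / 10 :: real) ^ nat \<bar>z\<bar>)
      \<le> (\<Sum>z\<in>int ` {..m} \<union> (\<lambda>k. - int k) ` {..m}. (9 / 10 :: real) ^ nat \<bar>z\<bar>)"
    by (rule sum_mono2) (use split in auto)
  also have "\<dots> \<le> (\<Sum>z\<in>int ` {..m}. (9 / 10 :: real) ^ nat \<bar>z\<bar>) + (\<Sum>z\<in>(\<lambda>k. - int k) ` {..m}. (9 / 10 :: real) ^ nat \<bar>z\<bar>)"
    by (subst sum_Un) (auto intro: sum_nonneg)
  also have "\<dots> = 2 * (\<Sum>k\<le>m. (9 / 10 :: real) ^ k)"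
    by (subst (1 2) sum.reindex) (auto simp: inj_on_def o_def)
  finally show ?thesis using g by linarith
qed

text \<open>By Cauchy-Schwarz \<open>\<Sum>i. \<bar>z i\<bar> \<le> 11 n\<close> on the net, so the weight
  \<open>(10/9) ^ (11 n) * (9/10) ^ (\<Sum>i. \<bar>z i\<bar>)\<close> is at least \<open>1\<close> there. Its sum over all lattice points
  is a product of \<open>n\<close> geometric series.\<close>

lemma card_lattice_net: "real (card (lattice_net n)) \<le> exp (5 * real n)"
proof -
  let ?P = "PiE {..<n} (\<lambda>_. {-int (11 * n)..int (11 * n)})"
  let ?w = "\<lambda>z. (10 / 9) ^ (11 * n) * (\<Prod>i<n. (9 / 10 :: real) ^ nat \<bar>z i\<bar>)"
  have w: "1 \<le> ?w z" if "z \<in> lattice_net n" for z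
  proof -
    have "(\<Sum>i<n. \<bar>real_of_int (z i)\<bar>) \<le> 11 * real n"
      using that by (intro abs_sum_le_of_square_sum) (auto simp: lattice_net_def)
    then have "real (\<Sum>i<n. nat \<bar>z i\<bar>) \<le> real (11 * n)" by simp
    then have "(\<Sum>i<n. nat \<bar>z i\<bar>) \<le> 11 * n" by (simp only: of_nat_le_iff)
    then have "(9 / 10 :: real) ^ (11 * n) \<le> (9 / 10) ^ (\<Sum>i<n. nat \<bar>z i\<bar>)"
      by (intro power_decreasing) auto
    then have "(10 / 9) ^ (11 * n) * (9 / 10 :: real) ^ (11 * n)
        \<le> (10 / 9) ^ (11 * n) * (9 / 10) ^ (\<Sum>i<n. nat \<bar>z i\<bar>)" 
      by (intro mult_left_mono) auto
    then show ?thesis by (simp add: power_sum flip: power_mult_distrib)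
  qed
  have "real (card (lattice_net n)) = (\<Sum>z\<in>lattice_net n. 1)" by simp
  also have "\<dots> \<le> (\<Sum>z\<in>lattice_net n. ?w z)" by (rule sum_mono) (rule w)
  also have "\<dots> \<le> (\<Sum>z\<in>?P. ?w z)"
  proof (rule sum_mono2)
    show "finite ?P" by (simp add: finite_PiE)
    show "lattice_net n \<subseteq> ?P" unfolding lattice_net_def by blast
    show "0 \<le> ?w z" for z by (intro mult_nonneg_nonneg prod_nonneg ballI zero_le_power) simp_all
  qed
  also have "\<dots> = (10 / 9) ^ (11 * n) * (\<Prod>i<n. \<Sum>z\<in>{-int (11 * n)..int (11 * n)}. (9 / 10) ^ nat \<bar>z\<bar>)"
    by (subst prod_sum_PiE) (simp_all only: sum_distrib_left finite_lessThan finite_atLeastAtMost_int)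
  also have "\<dots> \<le> (10 / 9) ^ (11 * n) * (\<Prod>i<n. 20)"
    by (intro mult_left_mono prod_mono conjI sum_geometric_symmetric sum_nonneg) simp_all
  also have "\<dots> = ((10 / 9) ^ 11 * 20) ^ n" by (simp add: power_mult power_mult_distrib)
  also have "\<dots> \<le> exp 5 ^ n"
  proof (rule power_mono)
    have "(5 / 2 :: real) ^ 5 \<le> exp 1 ^ 5"
      using exp_lower_Taylor_quadratic[of 1] by (intro power_mono) auto
    then have "(5 / 2 :: real) ^ 5 \<le> exp 5"
      using exp_of_nat_mult[of 5 "1 :: real"] by simp
    then show "(10 / 9) ^ 11 * 20 \<le> exp (5 :: real)" by (simp add: power_divide)
  qed simp
  also have "\<dots> = exp (5 * real n)" by (simp add: exp_of_nat_mult mult.commute)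
  finally show ?thesis .
qed

text \<open>Rounding every coordinate in the direction that favours the linear form \<open>c\<close> can only increase
  its value, and it enlarges the rescaled vector by at most \<open>sqrt n\<close>. Thus suprema over the unit
  ball are bounded by maxima over the net, without an approximation error.\<close>

lemma linear_le_lattice_net:
  fixes a c :: "nat \<Rightarrow> real"
  assumes a: "(\<Sum>i<n. (a i)\<^sup>2) \<le> 1"
  obtains z where "z \<in> lattice_net n"
    "10 * sqrt (real n) * (\<Sum>i<n. c i * a i) \<le> (\<Sum>i<n. c i * real_of_int (z i))"
proof -
  define b where "b i = 10 * sqrt (real n) * a i" for i
  define z where "z = (\<lambda>i\<in>{..<n}. if c i \<ge> 0 then \<lceil>b i\<rceil> else \<lfloor>b i\<rfloor>)"
  have zb: "\<bar>real_of_int (z i) - b i\<bar> \<le> 1" if "i < n" for i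
    using that ceiling_correct[of "b i"] floor_correct[of "b i"]
    by (simp add: z_def abs_le_iff) linarith
  have "L2_set (\<lambda>i. real_of_int (z i)) {..<n}
      = L2_set (\<lambda>i. b i + (real_of_int (z i) - b i)) {..<n}" by simp
  also have "\<dots> \<le> L2_set b {..<n} + L2_set (\<lambda>i. real_of_int (z i) - b i) {..<n}"
    by (rule L2_set_triangle_ineq)
  also have "L2_set b {..<n} \<le> 10 * sqrt (real n)"
  proof -
    have "L2_set b {..<n} = 10 * sqrt (real n) * L2_set a {..<n}"
      unfolding b_def by (subst L2_set_right_distrib) auto
    also have "\<dots> \<le> 10 * sqrt (real n) * 1"
      using a by (intro mult_left_mono) (auto simp: L2_set_def)
    finally show ?thesis by simp
  qed
  also have "L2_set (\<lambda>i. real_of_int (z i) - b i) {..<n} \<le> sqrt (real n)"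
  proof -
    have "(\<Sum>i<n. (real_of_int (z i) - b i)\<^sup>2) \<le> (\<Sum>i<n. 1)"
      using zb by (intro sum_mono) (auto simp: abs_square_le_1)
    then show ?thesis by (simp add: L2_set_def)
  qed
  finally have "L2_set (\<lambda>i. real_of_int (z i)) {..<n} \<le> 11 * sqrt (real n)" by simp
  then have "(L2_set (\<lambda>i. real_of_int (z i)) {..<n})\<^sup>2 \<le> (11 * sqrt (real n))\<^sup>2"
    by (intro power_mono) auto
  then have sq: "(\<Sum>i<n. (real_of_int (z i))\<^sup>2) \<le> 121 * real n"
    by (simp add: L2_set_def sum_nonneg power_mult_distrib)
  have "z i \<in> {-int (11 * n)..int (11 * n)}" if "i < n" for i
  proof -
    have "\<bar>real_of_int (z i)\<bar> \<le> (\<Sum>i<n. \<bar>real_of_int (z i)\<bar>)"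
      using that by (intro member_le_sum) auto
    also have "\<dots> \<le> 11 * real n" by (rule abs_sum_le_of_square_sum[OF sq])
    finally have "real_of_int \<bar>z i\<bar> \<le> real_of_int (int (11 * n))" by simp
    then show ?thesis unfolding of_int_le_iff by auto
  qed
  then have "z \<in> lattice_net n" using sq by (auto simp: lattice_net_def z_def)
  moreover have "10 * sqrt (real n) * (\<Sum>i<n. c i * a i) \<le> (\<Sum>i<n. c i * real_of_int (z i))"
  proof -
    have "10 * sqrt (real n) * (\<Sum>i<n. c i * a i) = (\<Sum>i<n. c i * b i)"
      by (simp add: b_def sum_distrib_left algebra_simps)
    also have "\<dots> \<le> (\<Sum>i<n. c i * real_of_int (z i))"
    proof (rule sum_mono)
      fix i assume "i \<in> {..<n}"
      then show "c i * b i \<le> c i * real_of_int (z i)"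
        by (cases "c i \<ge> 0") (auto simp: z_def intro: mult_left_mono mult_left_mono_neg)
    qed
    finally show ?thesis .
  qed
  ultimately show thesis by (rule that)
qed

text \<open>The union bound over the triples of net points, at most \<open>exp (15 n)\<close> of them, each a tensor of
  square norm at most \<open>(121 n) ^ 3\<close>. Undoing the rescaling divides the resulting bound by
  \<open>(10 * sqrt n) ^ 3\<close>; the constant is \<open>1.331\<^sup>2 * 30 < 54\<close>.\<close>

lemma sign_tensor_real:
  assumes n: "n > 0"
  obtains \<epsilon> :: "nat \<Rightarrow> nat \<Rightarrow> nat \<Rightarrow> real" where
    "\<And>i j k. \<lbrakk>i < n; j < n; k < n\<rbrakk> \<Longrightarrow> \<epsilon> i j k \<in> {-1, 1 :: real}"
    "\<And>a b c. \<lbrakk>(\<Sum>i<n. (a i)\<^sup>2) \<le> 1; (\<Sum>j<n. (b j)\<^sup>2) \<le> 1; (\<Sum>k<n. (c k)\<^sup>2) \<le> 1\<rbrakk>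
      \<Longrightarrow> (\<Sum>i<n. \<Sum>j<n. \<Sum>k<n. \<epsilon> i j k * a i * b j * c k) \<le> sqrt (54 * real n)"
proof -
  let ?N = "lattice_net n" and ?I = "{..<n} \<times> {..<n} \<times> {..<n}"
  define x where "x = (\<lambda>(u :: nat \<Rightarrow> int, v :: nat \<Rightarrow> int, w :: nat \<Rightarrow> int) (i, j, k).
    real_of_int (u i) * real_of_int (v j) * real_of_int (w k))"
  have card: "real (card (x ` (?N \<times> ?N \<times> ?N))) \<le> exp (15 * real n)"
  proof -
    have "card (x ` (?N \<times> ?N \<times> ?N)) \<le> card (?N \<times> ?N \<times> ?N)"
      by (rule card_image_le) (simp add: finite_lattice_net)
    also have "\<dots> = card ?N ^ 3" by (simp add: card_cartesian_product power3_eq_cube)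
    finally have "real (card (x ` (?N \<times> ?N \<times> ?N))) \<le> real (card ?N) ^ 3"
      by (simp flip: of_nat_power)
    also have "\<dots> \<le> exp (5 * real n) ^ 3"
      by (intro power_mono card_lattice_net) simp
    also have "\<dots> = exp (15 * real n)" by (simp flip: exp_of_nat_mult)
    finally show ?thesis .
  qed
  have sq: "(\<Sum>t\<in>?I. (y t)\<^sup>2) \<le> (121 * real n) ^ 3" if "y \<in> x ` (?N \<times> ?N \<times> ?N)" for y
  proof -
    obtain u v w where uvw: "u \<in> ?N" "v \<in> ?N" "w \<in> ?N" and y: "y = x (u, v, w)"
      using \<open>y \<in> x ` (?N \<times> ?N \<times> ?N)\<close> by auto
    let ?q = "\<lambda>u :: nat \<Rightarrow> int. \<Sum>i<n. (real_of_int (u i))\<^sup>2"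
    have "(\<Sum>t\<in>?I. (y t)\<^sup>2) = ?q u * (?q v * ?q w)"
      by (simp add: y x_def sum.cartesian_product' power_mult_distrib mult.assoc
          flip: sum_distrib_left sum_distrib_right)
    also have "\<dots> \<le> (121 * real n) * ((121 * real n) * (121 * real n))"
      using uvw unfolding lattice_net_def
      by (intro mult_mono mult_nonneg_nonneg sum_nonneg) auto
    finally show ?thesis by (simp add: power3_eq_cube mult.assoc)
  qed
  obtain e :: "nat \<times> nat \<times> nat \<Rightarrow> real" where e: "\<And>t. t \<in> ?I \<Longrightarrow> e t \<in> {-1, 1 :: real}"
    "\<And>y. y \<in> x ` (?N \<times> ?N \<times> ?N) \<Longrightarrow>
      (\<Sum>t\<in>?I. e t * y t) \<le> sqrt (2 * (121 * real n) ^ 3 * (15 * real n))"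
    by (rule signs_exist[of ?I "x ` (?N \<times> ?N \<times> ?N)" "15 * real n" "(121 * real n) ^ 3"])
      (use card sq n in \<open>auto simp: finite_lattice_net\<close>)
  define \<epsilon> where "\<epsilon> i j k = e (i, j, k)" for i j k
  have net: "(\<Sum>i<n. \<Sum>j<n. \<Sum>k<n. \<epsilon> i j k * u i * v j * w k) \<le> 1331 * (real n)\<^sup>2 * sqrt 30"
    if "u \<in> ?N" "v \<in> ?N" "w \<in> ?N" for u v w
  proof -
    have "(\<Sum>i<n. \<Sum>j<n. \<Sum>k<n. \<epsilon> i j k * u i * v j * w k) = (\<Sum>t\<in>?I. e t * x (u, v, w) t)"
      by (simp add: x_def \<epsilon>_def sum.cartesian_product' mult.assoc)
    also have "\<dots> \<le> sqrt (2 * (121 * real n) ^ 3 * (15 * real n))"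
      using that by (intro e) auto
    also have "\<dots> = 1331 * (real n)\<^sup>2 * sqrt 30"
      by (rule real_sqrt_unique) (simp_all add: power_mult_distrib power2_eq_square power3_eq_cube)
    finally show ?thesis .
  qed
  show thesis
  proof (rule that[of \<epsilon>])
    show "\<epsilon> i j k \<in> {-1, 1 :: real}" if "i < n" "j < n" "k < n" for i j k
      unfolding \<epsilon>_def using that by (intro e) auto
    fix a b c :: "nat \<Rightarrow> real"
    assume a: "(\<Sum>i<n. (a i)\<^sup>2) \<le> 1" and b: "(\<Sum>j<n. (b j)\<^sup>2) \<le> 1" and c: "(\<Sum>k<n. (c k)\<^sup>2) \<le> 1"
    let ?r = "10 * sqrt (real n)"
    let ?A = "\<lambda>a b c. \<Sum>i<n. \<Sum>j<n. \<Sum>k<n. \<epsilon> i j k * a i * b j * c k"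
    have r: "0 \<le> ?r" by simp
    have A1: "?A a b c = (\<Sum>i<n. (\<Sum>j<n. \<Sum>k<n. \<epsilon> i j k * b j * c k) * a i)" for a b c
      by (simp add: sum_distrib_left sum_distrib_right mult_ac)
    have A2: "?A a b c = (\<Sum>j<n. (\<Sum>i<n. \<Sum>k<n. \<epsilon> i j k * a i * c k) * b j)" for a b c
      by (subst sum.swap) (simp add: sum_distrib_left sum_distrib_right mult_ac)
    have A3: "?A a b c = (\<Sum>k<n. (\<Sum>i<n. \<Sum>j<n. \<epsilon> i j k * a i * b j) * c k)" for a b c
    proof -
      have "?A a b c = (\<Sum>i<n. \<Sum>k<n. \<Sum>j<n. \<epsilon> i j k * a i * b j * c k)"
        by (intro sum.cong refl sum.swap)
      also have "\<dots> = (\<Sum>k<n. \<Sum>i<n. \<Sum>j<n. \<epsilon> i j k * a i * b j * c k)" by (rule sum.swap)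
      finally show ?thesis by (simp add: sum_distrib_left sum_distrib_right mult_ac)
    qed
    obtain u where u: "u \<in> ?N" and "?r * (\<Sum>i<n. (\<Sum>j<n. \<Sum>k<n. \<epsilon> i j k * b j * c k) * a i)
        \<le> (\<Sum>i<n. (\<Sum>j<n. \<Sum>k<n. \<epsilon> i j k * b j * c k) * real_of_int (u i))"
      by (rule linear_le_lattice_net[OF a])
    then have ru: "?r * ?A a b c \<le> ?A u b c"
      by (simp only: A1[of a b c] A1[of u b c])
    obtain v where v: "v \<in> ?N" and "?r * (\<Sum>j<n. (\<Sum>i<n. \<Sum>k<n. \<epsilon> i j k * u i * c k) * b j)
        \<le> (\<Sum>j<n. (\<Sum>i<n. \<Sum>k<n. \<epsilon> i j k * u i * c k) * real_of_int (v j))"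
      by (rule linear_le_lattice_net[OF b])
    then have rv: "?r * ?A u b c \<le> ?A u v c"
      by (simp only: A2[of u b c] A2[of u v c])
    obtain w where w: "w \<in> ?N" and "?r * (\<Sum>k<n. (\<Sum>i<n. \<Sum>j<n. \<epsilon> i j k * u i * v j) * c k)
        \<le> (\<Sum>k<n. (\<Sum>i<n. \<Sum>j<n. \<epsilon> i j k * u i * v j) * real_of_int (w k))"
      by (rule linear_le_lattice_net[OF c])
    then have rw: "?r * ?A u v c \<le> ?A u v w"
      by (simp only: A3[of u v c] A3[of u v w])
    have "?r * (?r * (?r * ?A a b c)) \<le> ?r * (?r * ?A u b c)"
      by (intro mult_left_mono ru r)
    also have "\<dots> \<le> ?r * ?A u v c" by (intro mult_left_mono rv r)
    also have "\<dots> \<le> ?A u v w" by (rule rw)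
    also have "\<dots> \<le> 1331 * (real n)\<^sup>2 * sqrt 30" using u v w by (intro net) auto
    also have "?r * (?r * (?r * x)) = 1000 * (real n * sqrt (real n)) * x" for x
    proof -
      have "?r * (?r * (?r * x)) = 1000 * ((sqrt (real n) * sqrt (real n)) * sqrt (real n)) * x"
        by (simp only: mult_ac)
      then show ?thesis by simp
    qed
    finally have "1000 * (real n * sqrt (real n)) * ?A a b c \<le> 1331 * (real n)\<^sup>2 * sqrt 30" .
    also have "(real n)\<^sup>2 = (real n * sqrt (real n)) * sqrt (real n)"
      by (simp add: power2_eq_square)
    finally have "(real n * sqrt (real n)) * (1000 * ?A a b c) \<le>
        (real n * sqrt (real n)) * (1331 * sqrt (real n) * sqrt 30)"
      by (simp only: mult_ac)
    then have "1000 * ?A a b c \<le> 1331 * sqrt (real n) * sqrt 30"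
      by (rule mult_left_le_imp_le) (use n in simp)
    then have "?A a b c \<le> 1331 / 1000 * sqrt 30 * sqrt (real n)"
      by (simp only: mult_ac)
    also have "1331 / 1000 * sqrt 30 \<le> sqrt 54"
      by (rule real_le_rsqrt) (simp add: power_mult_distrib power_divide)
    then have "1331 / 1000 * sqrt 30 * sqrt (real n) \<le> sqrt 54 * sqrt (real n)"
      by (rule mult_right_mono) simp
    finally show "?A a b c \<le> sqrt (54 * real n)" by (simp add: real_sqrt_mult)
  qed
qed

lemma L2_set_bilinear_le:
  fixes \<epsilon> :: "nat \<Rightarrow> nat \<Rightarrow> nat \<Rightarrow> real"
  assumes M: "0 \<le> M" and bd: "\<And>a b c. \<lbrakk>(\<Sum>i<n. (a i)\<^sup>2) \<le> 1; (\<Sum>j<n. (b j)\<^sup>2) \<le> 1; (\<Sum>k<n. (c k)\<^sup>2) \<le> 1\<rbrakk>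
      \<Longrightarrow> (\<Sum>i<n. \<Sum>j<n. \<Sum>k<n. \<epsilon> i j k * a i * b j * c k) \<le> M"
  shows "L2_set (\<lambda>k. \<Sum>i<n. \<Sum>j<n. \<epsilon> i j k * a i * b j) {..<n} \<le> M * L2_set a {..<n} * L2_set b {..<n}"
    (is "L2_set ?y _ \<le> M * ?\<alpha> * ?\<beta>")
proof -
  let ?\<gamma> = "L2_set ?y {..<n}"
  have unit: "(\<Sum>i<n. (f i / L2_set f {..<n})\<^sup>2) \<le> 1" for f :: "nat \<Rightarrow> real"
  proof -
    have "(\<Sum>i<n. (f i / L2_set f {..<n})\<^sup>2) = (L2_set f {..<n})\<^sup>2 / (L2_set f {..<n})\<^sup>2"
      by (simp add: power_divide flip: sum_divide_distrib) (simp add: L2_set_def sum_nonneg)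
    then show ?thesis by simp
  qed
  have nn: "0 \<le> ?\<alpha>" "0 \<le> ?\<beta>" "0 \<le> ?\<gamma>" by simp_all
  consider "?\<alpha> = 0" | "?\<beta> = 0" | "?\<gamma> = 0" | "?\<alpha> > 0" "?\<beta> > 0" "?\<gamma> > 0" using nn by linarith
  then show ?thesis
  proof cases
    case 1
    then have "a i = 0" if "i < n" for i using that by (simp add: L2_set_eq_0_iff)
    then have "?y = (\<lambda>k. 0)" by (intro ext) simp
    then show ?thesis using 1 by (simp add: L2_set_def)
  next
    case 2
    then have "b i = 0" if "i < n" for i using that by (simp add: L2_set_eq_0_iff)
    then have "?y = (\<lambda>k. 0)" by (intro ext) simp
    then show ?thesis using 2 by (simp add: L2_set_def)
  next
    case 3
    then show ?thesis using M nn by simp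
  next
    case 4
    have "(\<Sum>i<n. \<Sum>j<n. \<Sum>k<n. \<epsilon> i j k * (a i / ?\<alpha>) * (b j / ?\<beta>) * (?y k / ?\<gamma>))
        = (\<Sum>i<n. \<Sum>k<n. \<Sum>j<n. \<epsilon> i j k * (a i / ?\<alpha>) * (b j / ?\<beta>) * (?y k / ?\<gamma>))"
      by (intro sum.cong refl sum.swap)
    also have "\<dots> = (\<Sum>k<n. \<Sum>i<n. \<Sum>j<n. \<epsilon> i j k * (a i / ?\<alpha>) * (b j / ?\<beta>) * (?y k / ?\<gamma>))"
      by (rule sum.swap)
    also have "\<dots> = (\<Sum>k<n. ?y k * ?y k / (?\<alpha> * ?\<beta> * ?\<gamma>))"
    proof (rule sum.cong[OF refl])
      fix k
      have "(\<Sum>i<n. \<Sum>j<n. \<epsilon> i j k * (a i / ?\<alpha>) * (b j / ?\<beta>) * (z / ?\<gamma>))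
        = ?y k * z / (?\<alpha> * ?\<beta> * ?\<gamma>)" for z
        by (simp add: sum_distrib_right sum_divide_distrib)
      then show "(\<Sum>i<n. \<Sum>j<n. \<epsilon> i j k * (a i / ?\<alpha>) * (b j / ?\<beta>) * (?y k / ?\<gamma>))
        = ?y k * ?y k / (?\<alpha> * ?\<beta> * ?\<gamma>)" .
    qed
    also have "\<dots> = ?\<gamma>\<^sup>2 / (?\<alpha> * ?\<beta> * ?\<gamma>)"
      by (simp add: L2_set_def sum_nonneg power2_eq_square sum_divide_distrib)
    finally have "?\<gamma>\<^sup>2 / (?\<alpha> * ?\<beta> * ?\<gamma>) \<le> M"
      using bd[OF unit[of a] unit[of b] unit[of ?y]] by simp
    then show ?thesis using 4 by (simp add: field_simps power2_eq_square)
  qed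
qed

text \<open>Passing from real to complex scalars costs a factor \<open>2\<close>: with \<open>p, q\<close> and \<open>r, s\<close> the norms of the
  real and imaginary parts of \<open>a\<close> and \<open>b\<close>, the real part of the value has norm at most a multiple
  of \<open>p r + q s\<close>, the imaginary part of \<open>p s + q r\<close>, and
  \<open>(p r + q s)\<^sup>2 + (p s + q r)\<^sup>2 \<le> 2 (p\<^sup>2 + q\<^sup>2) (r\<^sup>2 + s\<^sup>2)\<close>.\<close>

lemma sign_tensor:
  assumes n: "n > 0"
  obtains \<epsilon> :: "nat \<Rightarrow> nat \<Rightarrow> nat \<Rightarrow> real" where
    "\<And>i j k. \<lbrakk>i < n; j < n; k < n\<rbrakk> \<Longrightarrow> \<epsilon> i j k \<in> {-1, 1 :: real}"
    "\<And>(a :: nat \<Rightarrow> complex) (b :: nat \<Rightarrow> complex). (\<Sum>k<n. (cmod (\<Sum>i<n. \<Sum>j<n. complex_of_real (\<epsilon> i j k) * a i * b j))\<^sup>2)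
      \<le> 108 * real n * (\<Sum>i<n. (cmod (a i))\<^sup>2) * (\<Sum>j<n. (cmod (b j))\<^sup>2)"
proof -
  obtain \<epsilon> :: "nat \<Rightarrow> nat \<Rightarrow> nat \<Rightarrow> real" where
    e: "\<And>i j k. \<lbrakk>i < n; j < n; k < n\<rbrakk> \<Longrightarrow> \<epsilon> i j k \<in> {-1, 1 :: real}"
    and bd: "\<And>a b c. \<lbrakk>(\<Sum>i<n. (a i)\<^sup>2) \<le> 1; (\<Sum>j<n. (b j)\<^sup>2) \<le> 1; (\<Sum>k<n. (c k)\<^sup>2) \<le> 1\<rbrakk>
      \<Longrightarrow> (\<Sum>i<n. \<Sum>j<n. \<Sum>k<n. \<epsilon> i j k * a i * b j * c k) \<le> sqrt (54 * real n)"
    by (rule sign_tensor_real[OF n]) (rule that, assumption+)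
  let ?M = "sqrt (54 * real n)"
  let ?N = "\<lambda>f. L2_set f {..<n}"
  define B where "B a b k = (\<Sum>i<n. \<Sum>j<n. \<epsilon> i j k * a i * b j)" for a b :: "nat \<Rightarrow> real" and k
  have B: "?N (B a b) \<le> ?M * (?N a * ?N b)" for a b
    unfolding B_def using L2_set_bilinear_le[of ?M n \<epsilon> a b] bd by (simp add: mult.assoc)
  show thesis
  proof (rule that[of \<epsilon>])
    show "\<epsilon> i j k \<in> {-1, 1 :: real}" if "i < n" "j < n" "k < n" for i j k using that by (rule e)
    fix a b :: "nat \<Rightarrow> complex"
    let ?a1 = "\<lambda>i. Re (a i)" and ?a2 = "\<lambda>i. Im (a i)" and ?b1 = "\<lambda>i. Re (b i)" and ?b2 = "\<lambda>i. Im (b i)"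
    let ?y = "\<lambda>k. \<Sum>i<n. \<Sum>j<n. complex_of_real (\<epsilon> i j k) * a i * b j"
    have re: "Re (?y k) = B ?a1 ?b1 k + - B ?a2 ?b2 k" for k
      by (simp add: B_def sum_subtractf algebra_simps)
    have im: "Im (?y k) = B ?a1 ?b2 k + B ?a2 ?b1 k" for k
      by (simp add: B_def sum.distrib algebra_simps)
    have "(\<Sum>k<n. (cmod (?y k))\<^sup>2) = (?N (\<lambda>k. Re (?y k)))\<^sup>2 + (?N (\<lambda>k. Im (?y k)))\<^sup>2"
      unfolding L2_set_def cmod_power2 by (simp add: sum_nonneg sum.distrib)
    also have "\<dots> \<le> (?M * (?N ?a1 * ?N ?b1 + ?N ?a2 * ?N ?b2))\<^sup>2
        + (?M * (?N ?a1 * ?N ?b2 + ?N ?a2 * ?N ?b1))\<^sup>2"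
    proof (intro add_mono power_mono L2_set_nonneg)
      have "?N (\<lambda>k. Re (?y k)) \<le> ?N (B ?a1 ?b1) + ?N (\<lambda>k. - B ?a2 ?b2 k)"
        unfolding re by (rule L2_set_triangle_ineq)
      also have "?N (\<lambda>k. - B ?a2 ?b2 k) = ?N (B ?a2 ?b2)" by (simp add: L2_set_def)
      finally show "?N (\<lambda>k. Re (?y k)) \<le> ?M * (?N ?a1 * ?N ?b1 + ?N ?a2 * ?N ?b2)"
        using B[of ?a1 ?b1] B[of ?a2 ?b2] by (simp add: distrib_left)
      have "?N (\<lambda>k. Im (?y k)) \<le> ?N (B ?a1 ?b2) + ?N (B ?a2 ?b1)"
        unfolding im by (rule L2_set_triangle_ineq)
      then show "?N (\<lambda>k. Im (?y k)) \<le> ?M * (?N ?a1 * ?N ?b2 + ?N ?a2 * ?N ?b1)"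
        using B[of ?a1 ?b2] B[of ?a2 ?b1] by (simp add: distrib_left)
    qed
    also have "\<dots> = 54 * real n * ((?N ?a1 * ?N ?b1 + ?N ?a2 * ?N ?b2)\<^sup>2
        + (?N ?a1 * ?N ?b2 + ?N ?a2 * ?N ?b1)\<^sup>2)"
    proof -
      have "(?M * p)\<^sup>2 + (?M * q)\<^sup>2 = 54 * real n * (p\<^sup>2 + q\<^sup>2)" for p q
        by (simp add: power_mult_distrib distrib_left)
      then show ?thesis .
    qed
    also have "\<dots> \<le> 54 * real n * (2 * (((?N ?a1)\<^sup>2 + (?N ?a2)\<^sup>2) * ((?N ?b1)\<^sup>2 + (?N ?b2)\<^sup>2)))"
    proof (intro mult_left_mono)
      have "2 * ((p\<^sup>2 + q\<^sup>2) * (r\<^sup>2 + s\<^sup>2)) - ((p * r + q * s)\<^sup>2 + (p * s + q * r)\<^sup>2)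
          = (p * r - q * s)\<^sup>2 + (p * s - q * r)\<^sup>2" for p q r s :: real
        by (simp add: power2_eq_square algebra_simps)
      then show "(?N ?a1 * ?N ?b1 + ?N ?a2 * ?N ?b2)\<^sup>2 + (?N ?a1 * ?N ?b2 + ?N ?a2 * ?N ?b1)\<^sup>2
          \<le> 2 * (((?N ?a1)\<^sup>2 + (?N ?a2)\<^sup>2) * ((?N ?b1)\<^sup>2 + (?N ?b2)\<^sup>2))"
        by (metis diff_ge_0_iff_ge sum_power2_ge_zero)
    qed simp
    also have "\<dots> = 108 * real n * (\<Sum>i<n. (cmod (a i))\<^sup>2) * (\<Sum>j<n. (cmod (b j))\<^sup>2)"
      unfolding L2_set_def cmod_power2 by (simp add: sum_nonneg sum.distrib mult.assoc)
    finally show "(\<Sum>k<n. (cmod (\<Sum>i<n. \<Sum>j<n. complex_of_real (\<epsilon> i j k) * a i * b j))\<^sup>2)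
      \<le> 108 * real n * (\<Sum>i<n. (cmod (a i))\<^sup>2) * (\<Sum>j<n. (cmod (b j))\<^sup>2)" .
  qed
qed

text \<open>The signs are chosen one at a time: with \<open>w\<close> the part of the sum that does not involve the new
  sign \<open>s\<close>, including the new diagonal entry, the new value is \<open>w + s g\<close>, and one of \<open>w + g\<close>,
  \<open>w - g\<close> is at least as large as \<open>w\<close>. The offset \<open>z\<close> in the induction collects the diagonal
  entries of later steps.\<close>

lemma slice_signs:
  fixes c :: "nat \<Rightarrow> nat \<Rightarrow> complex"
  obtains \<delta> :: "nat \<Rightarrow> real" where "\<And>i. \<delta> i \<in> {-1, 1 :: real}"
    "cmod (\<Sum>i<n. c i i) \<le> cmod (\<Sum>i<n. \<Sum>j<n. complex_of_real (\<delta> i) * complex_of_real (\<delta> j) * c i j)"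
proof -
  have "\<exists>\<delta> :: nat \<Rightarrow> real. (\<forall>i. \<delta> i \<in> {-1, 1 :: real}) \<and>
    cmod (z + (\<Sum>i<n. c i i)) \<le> cmod (z + (\<Sum>i<n. \<Sum>j<n. complex_of_real (\<delta> i) * complex_of_real (\<delta> j) * c i j))" for z
  proof (induction n arbitrary: z)
    case 0
    show ?case by (rule exI[of _ "\<lambda>_. 1"]) simp
  next
    case (Suc n)
    obtain \<delta> :: "nat \<Rightarrow> real" where d: "\<forall>i. \<delta> i \<in> {-1, 1 :: real}"
      "cmod (z + c n n + (\<Sum>i<n. c i i)) \<le> cmod (z + c n n + (\<Sum>i<n. \<Sum>j<n. complex_of_real (\<delta> i) * complex_of_real (\<delta> j) * c i j))"
      (is "_ \<le> cmod ?w")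
      using Suc.IH[of "z + c n n"] by (elim exE conjE)
    let ?g = "\<Sum>i<n. \<delta> i * (c i n + c n i)"
    have expand: "z + (\<Sum>i<Suc n. \<Sum>j<Suc n. complex_of_real ((\<delta>(n := s)) i) * complex_of_real ((\<delta>(n := s)) j) * c i j)
        = ?w + s * ?g" if "s \<in> {-1, 1 :: real}" for s
    proof -
      have "s * s = 1" using that by auto
      then have ss: "complex_of_real s * complex_of_real s = 1" by (metis of_real_1 of_real_mult)
      have "(\<Sum>i<n. \<Sum>j<Suc n. complex_of_real ((\<delta>(n := s)) i) * complex_of_real ((\<delta>(n := s)) j) * c i j)
          = (\<Sum>i<n. \<Sum>j<n. complex_of_real (\<delta> i) * complex_of_real (\<delta> j) * c i j) + s * (\<Sum>i<n. \<delta> i * c i n)"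
        by (simp add: sum.distrib sum_distrib_left mult_ac)
      moreover have "(\<Sum>j<Suc n. complex_of_real ((\<delta>(n := s)) n) * complex_of_real ((\<delta>(n := s)) j) * c n j)
          = s * (\<Sum>i<n. \<delta> i * c n i) + c n n"
        using ss by (simp add: sum_distrib_left mult_ac)
      ultimately show ?thesis by (simp add: sum.distrib algebra_simps)
    qed
    have "cmod ?w \<le> cmod (?w + 1 * ?g) \<or> cmod ?w \<le> cmod (?w + (-1) * ?g)"
    proof (rule ccontr)
      assume "\<not> ?thesis"
      moreover have "2 * cmod w = cmod ((w + 1 * g) + (w + (-1) * g))" for w g
        using norm_mult[of 2 w] by (simp add: algebra_simps)
      then have "2 * cmod ?w = cmod ((?w + 1 * ?g) + (?w + (-1) * ?g))" .
      moreover have "cmod ((?w + 1 * ?g) + (?w + (-1) * ?g)) \<le> cmod (?w + 1 * ?g) + cmod (?w + (-1) * ?g)"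
        by (rule norm_triangle_ineq)
      ultimately show False by linarith
    qed
    then obtain s :: real where s: "s \<in> {-1, 1 :: real}" "cmod ?w \<le> cmod (?w + s * ?g)"
      
    proof (elim disjE)
      assume "cmod ?w \<le> cmod (?w + 1 * ?g)"
      then show thesis by (intro that[of 1]) simp_all
    next
      assume "cmod ?w \<le> cmod (?w + (-1) * ?g)"
      then show thesis by (intro that[of "-1"]) simp_all
    qed
    show ?case
    proof (intro exI conjI)
      show "\<forall>i. (\<delta>(n := s)) i \<in> {-1, 1 :: real}" using d(1) s(1) by auto
      show "cmod (z + (\<Sum>i<Suc n. c i i)) \<le>
          cmod (z + (\<Sum>i<Suc n. \<Sum>j<Suc n. complex_of_real ((\<delta>(n := s)) i) * complex_of_real ((\<delta>(n := s)) j) * c i j))"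
      proof -
        have "z + (\<Sum>i<Suc n. c i i) = z + c n n + (\<Sum>i<n. c i i)" by simp
        then show ?thesis unfolding expand[OF s(1)] using d(2) s(2) by (simp only:)
      qed
    qed
  qed
  from this[of 0] obtain \<delta> :: "nat \<Rightarrow> real" where "\<forall>i. \<delta> i \<in> {-1, 1 :: real}"
    "cmod (\<Sum>i<n. c i i) \<le> cmod (\<Sum>i<n. \<Sum>j<n. complex_of_real (\<delta> i) * complex_of_real (\<delta> j) * c i j)"
    unfolding add_0 by (elim exE conjE)
  then show thesis by (intro that[of \<delta>]) simp_all
qed

section \<open>Coordinates in finite-dimensional spaces\<close>

text \<open>In the induction step the new vector \<open>b\<close> has positive distance \<open>d\<close> from the span of the others:
  the coefficients of a sequence in the span that converges to \<open>b\<close> form Cauchy sequences by the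
  induction hypothesis, so their limits would represent \<open>b\<close>. The coefficient of \<open>b\<close> is then bounded
  by \<open>1 / d\<close>, the remaining ones by applying the hypothesis to the rest of the sum.\<close>

lemma bounded_coefficients:
  fixes B :: "'a::complex_normed_vector set"
  assumes "finite B" "complex_vector.independent B"
  shows "\<exists>C\<ge>0. \<forall>a. \<forall>b\<in>B. cmod (a b) \<le> C * norm (\<Sum>b\<in>B. a b *\<^sub>C b)"
  using assms
proof (induction B rule: finite_induct)
  case empty
  show ?case by (intro exI[of _ 0]) simp
next
  case (insert b B)
  have indep: "complex_vector.independent B" and b: "b \<notin> complex_vector.span B"
    using insert by (auto simp: complex_vector.independent_insert)
  obtain C where C: "0 \<le> C" "\<And>a c. c \<in> B \<Longrightarrow> cmod (a c) \<le> C * norm (\<Sum>c\<in>B. a c *\<^sub>C c)"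
    using insert.IH[OF indep] by blast
  have "\<exists>d>0. \<forall>a. d \<le> norm (b - (\<Sum>c\<in>B. a c *\<^sub>C c))"
  proof (rule ccontr)
    assume "\<not> ?thesis"
    then have "\<exists>a. norm (b - (\<Sum>c\<in>B. a c *\<^sub>C c)) < inverse (real (Suc k))" for k
      by (metis inverse_positive_iff_positive not_le of_nat_0_less_iff zero_less_Suc)
    then obtain a where a: "\<And>k. norm (b - (\<Sum>c\<in>B. a k c *\<^sub>C c)) < inverse (real (Suc k))" by metis
    define s where "s k = (\<Sum>c\<in>B. a k c *\<^sub>C c)" for k
    have s: "s \<longlonglongrightarrow> b"
    proof -
      have "(\<lambda>k. norm (s k - b)) \<longlonglongrightarrow> 0"
        by (rule tendsto_sandwich[OF _ _ tendsto_const LIMSEQ_inverse_real_of_nat])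
          (use a in \<open>auto simp: s_def norm_minus_commute intro!: always_eventually less_imp_le\<close>)
      then show ?thesis by (simp add: tendsto_norm_zero_iff LIM_zero_iff)
    qed
    have "\<exists>l. (\<lambda>k. a k c) \<longlonglongrightarrow> l" if c: "c \<in> B" for c
    proof -
      have le: "cmod (a k c - a j c) \<le> C * norm (s k - s j)" for k j
        using C(2)[OF c, of "\<lambda>c. a k c - a j c"]
        by (simp add: s_def complex_vector.scale_left_diff_distrib sum_subtractf)
      have "Cauchy (\<lambda>k. a k c)"
      proof (rule metric_CauchyI)
        fix e :: real assume e: "e > 0"
        have "Cauchy s" using s by (rule LIMSEQ_imp_Cauchy)
        then obtain M where M: "\<And>k j. k \<ge> M \<Longrightarrow> j \<ge> M \<Longrightarrow> dist (s k) (s j) < e / (C + 1)"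
          using metric_CauchyD[of s "e / (C + 1)"] e C(1) by auto
        have "dist (a k c) (a j c) < e" if "k \<ge> M" "j \<ge> M" for k j
        proof -
          have "cmod (a k c - a j c) \<le> (C + 1) * norm (s k - s j)"
            using le[of k j] by (simp add: distrib_right add_increasing2)
          also have "\<dots> < (C + 1) * (e / (C + 1))"
            using M[OF that] C(1) by (intro mult_strict_left_mono) (auto simp: dist_norm)
          also have "\<dots> = e" using C(1) by simp
          finally show ?thesis by (simp add: dist_norm)
        qed
        then show "\<exists>M. \<forall>m\<ge>M. \<forall>n\<ge>M. dist (a m c) (a n c) < e" by blast
      qed
      then show ?thesis using convergent_eq_Cauchy by blast
    qed
    then obtain l where l: "\<And>c. c \<in> B \<Longrightarrow> (\<lambda>k. a k c) \<longlonglongrightarrow> l c" by metis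
    have "s \<longlonglongrightarrow> (\<Sum>c\<in>B. l c *\<^sub>C c)"
      unfolding s_def
    proof (rule tendsto_sum)
      fix c assume c: "c \<in> B"
      have "(\<lambda>k. cmod (a k c - l c) * norm c) \<longlonglongrightarrow> cmod (l c - l c) * norm c"
        by (intro tendsto_intros l c)
      then have "(\<lambda>k. norm (a k c *\<^sub>C c - l c *\<^sub>C c)) \<longlonglongrightarrow> 0"
        by (simp add: norm_scaleC flip: complex_vector.scale_left_diff_distrib)
      then show "(\<lambda>k. a k c *\<^sub>C c) \<longlonglongrightarrow> l c *\<^sub>C c"
        by (simp add: tendsto_norm_zero_iff LIM_zero_iff)
    qed
    then have "b = (\<Sum>c\<in>B. l c *\<^sub>C c)" using s LIMSEQ_unique by blast
    also have "\<dots> \<in> complex_vector.span B"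
      by (intro complex_vector.span_sum complex_vector.span_scale complex_vector.span_base)
    finally show False using b by contradiction
  qed
  then obtain d where d: "d > 0" "\<And>a. d \<le> norm (b - (\<Sum>c\<in>B. a c *\<^sub>C c))" by blast
  have b_bound: "cmod (a b) \<le> (1 / d) * norm (\<Sum>c\<in>insert b B. a c *\<^sub>C c)" for a
  proof (cases "a b = 0")
    case False
    have "d \<le> norm (b - (\<Sum>c\<in>B. (- a c / a b) *\<^sub>C c))" by (rule d)
    then have "cmod (a b) * d \<le> cmod (a b) * norm (b - (\<Sum>c\<in>B. (- a c / a b) *\<^sub>C c))"
      by (intro mult_left_mono) auto
    also have "\<dots> = norm (a b *\<^sub>C (b - (\<Sum>c\<in>B. (- a c / a b) *\<^sub>C c)))"
      by (simp add: norm_scaleC)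
    also have "a b *\<^sub>C (b - (\<Sum>c\<in>B. (- a c / a b) *\<^sub>C c)) = (\<Sum>c\<in>insert b B. a c *\<^sub>C c)"
      using False insert.hyps
      by (simp add: scaleC_add_right complex_vector.scale_right_diff_distrib
          complex_vector.scale_sum_right sum_negf)
    finally show ?thesis using d(1) by (simp add: field_simps)
  qed (use d in simp)
  define K where "K = max (1 / d) (C * (1 + norm b / d))"
  show ?case
  proof (intro exI[of _ K] conjI allI ballI)
    show "0 \<le> K" using d(1) by (simp add: K_def le_max_iff_disj)
    fix a c assume c: "c \<in> insert b B"
    let ?x = "\<Sum>c\<in>insert b B. a c *\<^sub>C c"
    show "cmod (a c) \<le> K * norm ?x"
    proof (cases "c = b")
      case True
      have "cmod (a b) \<le> (1 / d) * norm ?x" by (rule b_bound)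
      also have "\<dots> \<le> K * norm ?x" by (intro mult_right_mono) (simp_all add: K_def)
      finally show ?thesis using True by simp
    next
      case False
      then have "cmod (a c) \<le> C * norm (\<Sum>c\<in>B. a c *\<^sub>C c)" using c by (intro C) auto
      also have "(\<Sum>c\<in>B. a c *\<^sub>C c) = ?x - a b *\<^sub>C b" using insert.hyps by simp
      also have "norm \<dots> \<le> norm ?x + cmod (a b) * norm b"
        using norm_triangle_ineq4[of ?x "a b *\<^sub>C b"] by (simp only: norm_scaleC)
      also have "\<dots> \<le> norm ?x + ((1 / d) * norm ?x) * norm b"
        by (intro add_left_mono mult_right_mono b_bound) simp
      also have "\<dots> = (1 + norm b / d) * norm ?x" by (simp add: algebra_simps)
      finally have "cmod (a c) \<le> (C * (1 + norm b / d)) * norm ?x"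
        using C(1) by (simp add: mult_left_mono mult.assoc)
      also have "\<dots> \<le> K * norm ?x" by (intro mult_right_mono) (simp_all add: K_def)
      finally show ?thesis .
    qed
  qed
qed

lemma bounded_representation:
  fixes B :: "'a::complex_normed_vector set"
  assumes B: "finite B" "complex_vector.independent B"
  obtains C where "0 \<le> C" "\<And>x b. x \<in> complex_vector.span B \<Longrightarrow>
    cmod (complex_vector.representation B x b) \<le> C * norm x"
proof -
  obtain C where C: "0 \<le> C" "\<And>a b. b \<in> B \<Longrightarrow> cmod (a b) \<le> C * norm (\<Sum>b\<in>B. a b *\<^sub>C b)"
    using bounded_coefficients[OF B] by blast
  show thesis
  proof (rule that[OF C(1)])
    fix x b assume x: "x \<in> complex_vector.span B"
    show "cmod (complex_vector.representation B x b) \<le> C * norm x"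
    proof (cases "b \<in> B")
      case True
      then show ?thesis
        using C(2)[of b "complex_vector.representation B x"]
          complex_vector.sum_representation_eq[OF B(2) x B(1) order_refl] by simp
    next
      case False
      then have "complex_vector.representation B x b = 0"
        using complex_vector.representation_ne_zero by blast
      then show ?thesis using C(1) by simp
    qed
  qed
qed

section \<open>Orthonormalization for a semi-inner product\<close>

text \<open>An operator \<open>v\<close> from \<open>E\<close> to a Hilbert space enters the argument only through the form
  \<open>\<langle>v x, v y\<rangle>\<close> on \<open>E\<close>, which may be degenerate.\<close>

locale semi_inner =
  fixes q :: "'a::complex_vector \<Rightarrow> 'a \<Rightarrow> complex"
  assumes add: "q (x + y) z = q x z + q y z"
    and scale: "q (c *\<^sub>C x) z = c * q x z"
    and conj: "q x y = cnj (q y x)"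
    and nonneg: "0 \<le> Re (q x x)"
begin

lemma add_right: "q z (x + y) = q z x + q z y"
  using conj[of z "x + y"] conj[of z x] conj[of z y] by (simp add: add)

lemma scale_right: "q z (c *\<^sub>C x) = cnj c * q z x"
  using conj[of z "c *\<^sub>C x"] conj[of z x] by (simp add: scale)

lemma zero_left [simp]: "q 0 z = 0" using scale[of 0 0 z] by simp

lemma zero_right [simp]: "q z 0 = 0" using scale_right[of z 0 0] by simp

lemma diff: "q (x - y) z = q x z - q y z"
  using add[of "x - y" y z] by simp

lemma diff_right: "q z (x - y) = q z x - q z y"
  using add_right[of z "x - y" y] by simp

lemma sum: "q (\<Sum>i\<in>I. f i) z = (\<Sum>i\<in>I. q (f i) z)"
  by (induction I rule: infinite_finite_induct) (simp_all add: add)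

lemma sum_right: "q z (\<Sum>i\<in>I. f i) = (\<Sum>i\<in>I. q z (f i))"
  by (induction I rule: infinite_finite_induct) (simp_all add: add_right)

lemma real: "q x x = complex_of_real (Re (q x x))"
  using conj[of x x] by (simp add: complex_eq_iff)

text \<open>Degenerate case of the Cauchy-Schwarz inequality: otherwise \<open>q (y - c x) (y - c x)\<close> would be
  negative for a suitable multiple \<open>c\<close> of \<open>cnj (q x y)\<close>.\<close>

lemma null_left:
  assumes "q x x = 0"
  shows "q x y = 0"
proof (rule ccontr)
  assume ne: "q x y \<noteq> 0"
  define t where "t = (Re (q y y) + 1) / (cmod (q x y))\<^sup>2"
  define c where "c = complex_of_real t * cnj (q x y)"
  have p: "(cmod (q x y))\<^sup>2 > 0" using ne by simp
  have "q (y - c *\<^sub>C x) (y - c *\<^sub>C x) = q y y - c * q x y - cnj (c * q x y)"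
    using assms conj[of y x] by (simp add: diff diff_right scale scale_right)
  also have "c * q x y = complex_of_real (t * (cmod (q x y))\<^sup>2)"
    by (simp only: c_def of_real_mult complex_norm_square mult_ac)
  also have "t * (cmod (q x y))\<^sup>2 = Re (q y y) + 1" using p by (simp add: t_def)
  finally have "Re (q (y - c *\<^sub>C x) (y - c *\<^sub>C x)) = - Re (q y y) - 2" by simp
  then show False using nonneg[of "y - c *\<^sub>C x"] nonneg[of y] by simp
qed

definition residual :: "(nat \<Rightarrow> 'a) \<Rightarrow> nat \<Rightarrow> 'a \<Rightarrow> 'a" where
  "residual h r x = x - (\<Sum>j<r. q x (h j) *\<^sub>C h j)"

definition orthonormal :: "(nat \<Rightarrow> 'a) \<Rightarrow> nat \<Rightarrow> bool" where
  "orthonormal h r \<longleftrightarrow> (\<forall>i<r. \<forall>j<r. q (h i) (h j) = (if i = j then 1 else 0))"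

lemma residual_orthogonal:
  assumes "orthonormal h r" "i < r"
  shows "q (residual h r x) (h i) = 0"
proof -
  have "q (residual h r x) (h i) = q x (h i) - (\<Sum>j<r. q x (h j) * q (h j) (h i))"
    by (simp add: residual_def diff sum scale)
  also have "(\<Sum>j<r. q x (h j) * q (h j) (h i)) = (\<Sum>j<r. if j = i then q x (h i) else 0)"
    using assms by (intro sum.cong) (auto simp: orthonormal_def)
  finally show ?thesis using assms by simp
qed

lemma bessel:
  assumes "orthonormal h r"
  shows "(\<Sum>j<r. (cmod (q x (h j)))\<^sup>2) \<le> Re (q x x)"
proof -
  let ?w = "residual h r x"
  have "q ?w ?w = q ?w x - (\<Sum>j<r. cnj (q x (h j)) * q ?w (h j))"
    by (subst (2) residual_def) (simp add: diff_right sum_right scale_right)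
  also have "\<dots> = q ?w x" using residual_orthogonal[OF assms] by simp
  also have "\<dots> = q x x - (\<Sum>j<r. q x (h j) * cnj (q x (h j)))"
    by (simp add: residual_def diff sum scale conj[of "h _" x])
  also have "(\<Sum>j<r. q x (h j) * cnj (q x (h j))) = complex_of_real (\<Sum>j<r. (cmod (q x (h j)))\<^sup>2)"
    by (simp add: complex_norm_square[symmetric])
  finally show ?thesis using nonneg[of ?w] by simp
qed

text \<open>A new vector \<open>b\<close> is used only if its residual is not null. Extending the system does not spoil the
  residuals of the earlier vectors, since those are null and hence orthogonal to everything.\<close>

lemma gram_schmidt:
  assumes "finite B"
  obtains h r where "r \<le> card B" "orthonormal h r"
    "\<And>b. b \<in> B \<Longrightarrow> q (residual h r b) (residual h r b) = 0"
proof -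
  have "\<exists>h r. r \<le> card B \<and> orthonormal h r \<and> (\<forall>b\<in>B. q (residual h r b) (residual h r b) = 0)"
    using assms
  proof (induction B rule: finite_induct)
    case empty
    show ?case by (intro exI[of _ 0] exI[of _ "\<lambda>_. 0"]) (simp add: orthonormal_def)
  next
    case (insert b B)
    then obtain h r where hr: "r \<le> card B" "orthonormal h r"
      and B: "\<And>b. b \<in> B \<Longrightarrow> q (residual h r b) (residual h r b) = 0" by blast
    let ?w = "residual h r b"
    show ?case
    proof (cases "q ?w ?w = 0")
      case True
      then show ?thesis
        using hr B insert.hyps by (intro exI[of _ h] exI[of _ r]) auto
    next
      case False
      define s where "s = sqrt (Re (q ?w ?w))"
      have "Re (q ?w ?w) \<noteq> 0" using False real[of ?w] by (metis of_real_0)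
      then have s: "s > 0" "s\<^sup>2 = Re (q ?w ?w)" using nonneg[of ?w] by (simp_all add: s_def)
      have qw: "q ?w ?w = complex_of_real s * complex_of_real s"
        using real[of ?w] s(2) by (simp add: power2_eq_square flip: of_real_mult)
      define e where "e = complex_of_real (1 / s) *\<^sub>C ?w"
      have qe: "q e e = 1" using s(1) by (simp add: e_def scale scale_right qw)
      have eh: "q e (h i) = 0" "q (h i) e = 0" if "i < r" for i
        using residual_orthogonal[OF hr(2) that, of b] conj[of "h i" e] by (simp_all add: e_def scale)
      define g where "g = h(r := e)"
      have g: "orthonormal g (Suc r)"
        using hr(2) qe eh by (auto simp: orthonormal_def g_def less_Suc_eq)
      have res: "residual g (Suc r) x = residual h r x - q x e *\<^sub>C e" for x
        by (simp add: residual_def g_def diff_diff_eq)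
      have qxe: "q x e = q (residual h r x) e" for x
        using eh by (simp add: residual_def diff sum scale)
      have "q (residual g (Suc r) b') (residual g (Suc r) b') = 0" if "b' \<in> insert b B" for b'
      proof (cases "b' \<in> B")
        case True
        have "q b' e = 0" unfolding qxe[of b'] by (rule null_left[OF B[OF True]])
        then show ?thesis unfolding res using B[OF True] by simp
      next
        case False
        then have [simp]: "b' = b" using that by simp
        have "q b e = complex_of_real s"
          unfolding qxe[of b] using s(1) qw by (subst e_def) (simp add: scale_right)
        then have "residual g (Suc r) b' = 0"
          unfolding res using s(1) by (simp add: e_def)
        then show ?thesis by simp
      qed
      then show ?thesis
        using g hr(1) insert.hyps by (intro exI[of _ g] exI[of _ "Suc r"]) auto
    qed
  qed
  then show thesis using that by blast
qed

end

section \<open>The lower bound for the amplification\<close>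

text \<open>Duality in \<open>\<ell>\<^sub>2\<close>: the coefficients \<open>c j = cnj (\<phi> (y j))\<close> turn the left-hand side into the square
  of the norm that is to be estimated.\<close>

lemma L2_set_functional_le:
  assumes le: "\<And>c. cmod (cdual_apply \<phi> (\<Sum>j\<in>J. c j *\<^sub>C y j)) \<le> M * L2_set (\<lambda>j. cmod (c j)) J"
    and M: "0 \<le> M"
  shows "L2_set (\<lambda>j. cmod (cdual_apply \<phi> (y j))) J \<le> M"
proof -
  let ?s = "L2_set (\<lambda>j. cmod (cdual_apply \<phi> (y j))) J"
  have "?s * ?s = cmod (\<Sum>j\<in>J. cdual_apply \<phi> (y j) * cnj (cdual_apply \<phi> (y j)))"
    unfolding sum_mult_cnj_eq norm_of_real by (simp add: power2_eq_square)
  also have "(\<Sum>j\<in>J. cdual_apply \<phi> (y j) * cnj (cdual_apply \<phi> (y j)))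
      = cdual_apply \<phi> (\<Sum>j\<in>J. cnj (cdual_apply \<phi> (y j)) *\<^sub>C y j)"
    by (simp add: cdual_apply_sum_right mult.commute)
  also have "cmod \<dots> \<le> M * ?s" using le[of "\<lambda>j. cnj (cdual_apply \<phi> (y j))"] by simp
  finally show ?thesis
    using M L2_set_nonneg[of "\<lambda>j. cmod (cdual_apply \<phi> (y j))" J]
    by (cases "?s = 0") (auto simp: mult_le_cancel_right)
qed

text \<open>The norm of the scalar matrix \<open>\<Sum>j. \<eta> (y j) G\<^sub>j\<close>, with \<open>G\<^sub>j = (\<delta> j * \<epsilon> j q p)\<^sub>p\<^sub>q\<close>, is at most
  \<open>sqrt (108 n)\<close> times the \<open>\<ell>\<^sub>2\<close> norm of \<open>(\<eta> (y j))\<^sub>j\<close>.\<close>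

lemma min_norms_sign_tensor_le_one:
  fixes \<epsilon> :: "nat \<Rightarrow> nat \<Rightarrow> nat \<Rightarrow> real" and \<delta> :: "nat \<Rightarrow> real" and y :: "nat \<Rightarrow> 'a::cbanach"
  assumes n: "n > 0" and W: "W > 0"
    and \<epsilon>: "\<And>(a :: nat \<Rightarrow> complex) (b :: nat \<Rightarrow> complex).
      (\<Sum>k<n. (cmod (\<Sum>i<n. \<Sum>j<n. \<epsilon> i j k * a i * b j))\<^sup>2)
      \<le> 108 * real n * (\<Sum>i<n. (cmod (a i))\<^sup>2) * (\<Sum>j<n. (cmod (b j))\<^sup>2)"
    and \<delta>: "\<And>i. \<delta> i \<in> {-1, 1}"
    and y: "\<And>\<eta>. L2_set (\<lambda>j. cmod (cdual_apply \<eta> (y j))) {..<n} \<le> W * norm \<eta>"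
  shows "min_norms n (\<lambda>p q. \<Sum>j<n. complex_of_real (1 / (sqrt (108 * real n) * W) * (\<delta> j * \<epsilon> j q p)) *\<^sub>C y j) \<le> 1"
    (is "min_norms n ?X \<le> 1")
  unfolding min_norms_le_one_iff
proof (intro allI)
  fix \<eta> v
  let ?k = "1 / (sqrt (108 * real n) * W)"
  define a where "a j = complex_of_real (\<delta> j) * cdual_apply \<eta> (y j)" for j
  have k: "?k \<ge> 0" using W by simp
  have "cmod (complex_of_real (\<delta> j)) = 1" for j using \<delta>[of j] by auto
  then have a: "cmod (a j) = cmod (cdual_apply \<eta> (y j))" for j by (simp add: a_def norm_mult)
  have "(\<Sum>q<n. cdual_apply \<eta> (?X p q) * v q)
      = complex_of_real ?k * (\<Sum>j<n. \<Sum>q<n. \<epsilon> j q p * a j * v q)" for p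
  proof -
    have "(\<Sum>q<n. cdual_apply \<eta> (?X p q) * v q)
        = (\<Sum>q<n. \<Sum>j<n. complex_of_real ?k * (\<epsilon> j q p * a j * v q))"
      unfolding cdual_apply_sum_right sum_distrib_right
      by (intro sum.cong refl) (simp only: cdual_apply_simps a_def of_real_mult mult_ac)
    also have "\<dots> = (\<Sum>j<n. \<Sum>q<n. complex_of_real ?k * (\<epsilon> j q p * a j * v q))" by (rule sum.swap)
    finally show ?thesis by (simp only: sum_distrib_left)
  qed
  then have "L2_set (\<lambda>p. cmod (\<Sum>q<n. cdual_apply \<eta> (?X p q) * v q)) {..<n}
      = ?k * L2_set (\<lambda>p. cmod (\<Sum>j<n. \<Sum>q<n. \<epsilon> j q p * a j * v q)) {..<n}"
    using k by (simp only: L2_set_cmod_scale norm_of_real abs_of_nonneg)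
  also have "\<dots> \<le> ?k * (sqrt (108 * real n) * L2_set (\<lambda>j. cmod (a j)) {..<n} * L2_set (\<lambda>q. cmod (v q)) {..<n})"
  proof (rule mult_left_mono[OF _ k])
    show "L2_set (\<lambda>p. cmod (\<Sum>j<n. \<Sum>q<n. \<epsilon> j q p * a j * v q)) {..<n}
        \<le> sqrt (108 * real n) * L2_set (\<lambda>j. cmod (a j)) {..<n} * L2_set (\<lambda>q. cmod (v q)) {..<n}"
      unfolding L2_set_def real_sqrt_mult[symmetric] by (intro real_sqrt_le_mono \<epsilon>)
  qed
  also have "\<dots> = (1 / W) * L2_set (\<lambda>j. cmod (cdual_apply \<eta> (y j))) {..<n} * L2_set (\<lambda>q. cmod (v q)) {..<n}"
    using n W by (simp add: a)
  also have "\<dots> \<le> (1 / W) * (W * norm \<eta>) * L2_set (\<lambda>q. cmod (v q)) {..<n}"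
    using W by (intro mult_right_mono mult_left_mono y) auto
  also have "\<dots> = norm \<eta> * L2_set (\<lambda>q. cmod (v q)) {..<n}" using W by simp
  finally show "L2_set (\<lambda>p. cmod (\<Sum>q<n. cdual_apply \<eta> (?X p q) * v q)) {..<n}
      \<le> norm \<eta> * L2_set (\<lambda>q. cmod (v q)) {..<n}" .
qed

text \<open>Evaluation of the matrix \<open>(\<xi> i j (x p q))\<close> at the unit vector \<open>n powr (-1/2) \<Sum>i. e\<^sub>i \<otimes> e\<^sub>i\<close>.\<close>

lemma diagonal_pairing_le_max_norms:
  assumes n: "n > 0" and \<xi>: "min_norms n \<xi> \<le> 1"
  shows "ennreal (cmod (\<Sum>i<n. \<Sum>j<n. cdual_apply (\<xi> i j) (x i j)) / real n) \<le> max_norms n x"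
proof -
  let ?I = "{..<n} \<times> {..<n}"
  let ?A = "\<lambda>(i, p) (j, q). cdual_apply (\<xi> i j) (x p q)"
  define v where "v = (\<lambda>(i :: nat, p :: nat). if p = i then complex_of_real (1 / sqrt (real n)) else 0)"
  have v: "L2_set (\<lambda>t. cmod (v t)) ?I \<le> 1"
  proof -
    have "(\<Sum>t\<in>?I. (cmod (v t))\<^sup>2) = (\<Sum>i<n. \<Sum>p<n. if p = i then 1 / real n else 0)"
      unfolding sum.cartesian_product' by (intro sum.cong refl) (simp add: v_def power_divide norm_divide)
    then show ?thesis using n by (simp add: L2_set_def)
  qed
  have "(\<Sum>s\<in>?I. \<Sum>t\<in>?I. v s * ?A s t * v t)
      = (\<Sum>i<n. \<Sum>p<n. \<Sum>j<n. \<Sum>q<n. if q = j then (if p = i then cdual_apply (\<xi> i j) (x i j) / real n else 0) else 0)"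
    unfolding sum.cartesian_product'
    by (intro sum.cong refl) (simp add: v_def flip: of_real_mult)
  also have "\<dots> = (\<Sum>i<n. \<Sum>p<n. if p = i then \<Sum>j<n. cdual_apply (\<xi> i j) (x i j) / real n else 0)"
    by (intro sum.cong refl) (simp add: sum.neutral)
  also have "\<dots> = (\<Sum>i<n. \<Sum>j<n. cdual_apply (\<xi> i j) (x i j)) / real n"
    by (simp add: sum_divide_distrib)
  finally have eq: "cmod (\<Sum>s\<in>?I. \<Sum>t\<in>?I. v s * ?A s t * v t)
      = cmod (\<Sum>i<n. \<Sum>j<n. cdual_apply (\<xi> i j) (x i j)) / real n" by (simp add: norm_divide)
  have "ennreal (cmod (\<Sum>s\<in>?I. \<Sum>t\<in>?I. v s * ?A s t * v t)) \<le> mat_opnorm ?I ?A"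
    by (rule mat_opnorm_pairing_le[OF v v])
  also have "\<dots> \<le> max_norms n x"
    unfolding max_norms_eq using \<xi> by (intro SUP_upper2[of n] SUP_upper) simp_all
  finally show ?thesis unfolding eq .
qed

text \<open>Test \<open>T\<close> on \<open>X = \<Sum>j. G\<^sub>j \<otimes> x j\<close> and pair the result with \<open>Z = \<Sum>i. G\<^sub>i \<otimes> \<xi> i\<close>. Their pairing is
  \<open>\<Sum>i j. \<langle>G\<^sub>i, G\<^sub>j\<rangle> (\<xi> i) (T (x j))\<close>, in which \<open>\<langle>G\<^sub>i, G\<^sub>i\<rangle> = n\<^sup>2\<close>. The off-diagonal terms do not have to
  vanish: changing the sign of some of the \<open>G\<^sub>i\<close> does not affect the norms, and some choice of
  signs makes the whole sum at least as large as its diagonal part.\<close>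

lemma trace_le_amplification_norm:
  fixes T :: "'f::cbanach \<Rightarrow> 'e::cbanach" and x :: "nat \<Rightarrow> 'f" and \<xi> :: "nat \<Rightarrow> 'e cdual"
  assumes T: "bounded_clinear T" and UV: "U > 0" "V > 0" 
    and x: "\<And>\<eta>. L2_set (\<lambda>j. cmod (cdual_apply \<eta> (x j))) {..<n} \<le> U * norm \<eta>"
    and \<xi>: "\<And>\<eta>. L2_set (\<lambda>j. cmod (cdual_apply \<eta> (\<xi> j))) {..<n} \<le> V * norm \<eta>"
  shows "ennreal (cmod (\<Sum>j<n. cdual_apply (\<xi> j) (T (x j))))
    \<le> ennreal (108 * U * V) * amplification_norm min_norms max_norms n T"
proof (cases "n = 0")
  case False
  then have n: "n > 0" by simp
  interpret T: bounded_linear T using T by (simp add: bounded_clinear_def)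
  have T_sum: "T (\<Sum>p\<in>P. c p *\<^sub>C f p) = (\<Sum>p\<in>P. c p *\<^sub>C T (f p))" for P :: "nat set" and c f
    using T by (simp add: T.sum bounded_clinear_def)
  obtain \<epsilon> :: "nat \<Rightarrow> nat \<Rightarrow> nat \<Rightarrow> real" where
    \<epsilon>1: "\<And>i j k. \<lbrakk>i < n; j < n; k < n\<rbrakk> \<Longrightarrow> \<epsilon> i j k \<in> {-1, 1}" and
    \<epsilon>2: "\<And>(a :: nat \<Rightarrow> complex) (b :: nat \<Rightarrow> complex).
      (\<Sum>k<n. (cmod (\<Sum>i<n. \<Sum>j<n. \<epsilon> i j k * a i * b j))\<^sup>2)
      \<le> 108 * real n * (\<Sum>i<n. (cmod (a i))\<^sup>2) * (\<Sum>j<n. (cmod (b j))\<^sup>2)"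
    by (rule sign_tensor[OF n]) (rule that, assumption+)
  define t where "t i j = cdual_apply (\<xi> i) (T (x j))" for i j
  define g where "g i j = (\<Sum>p<n. \<Sum>q<n. \<epsilon> i q p * \<epsilon> j q p)" for i j
  have g: "g i i = (real n)\<^sup>2" if "i < n" for i
  proof -
    have "g i i = (\<Sum>p<n. \<Sum>q<n. 1)"
      unfolding g_def
    proof (intro sum.cong refl)
      fix p q assume "p \<in> {..<n}" "q \<in> {..<n}"
      then show "\<epsilon> i q p * \<epsilon> i q p = 1" using \<epsilon>1[of i q p] that by auto
    qed
    then show ?thesis by (simp add: power2_eq_square)
  qed
  obtain \<delta> :: "nat \<Rightarrow> real" where \<delta>: "\<And>i. \<delta> i \<in> {-1, 1}"
    "cmod (\<Sum>i<n. t i i * g i i) \<le> cmod (\<Sum>i<n. \<Sum>j<n. complex_of_real (\<delta> i) * complex_of_real (\<delta> j) * (t i j * g i j))"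
    by (rule slice_signs[where c = "\<lambda>i j. t i j * g i j"]) (rule that, assumption+)
  let ?k = "\<lambda>W. 1 / (sqrt (108 * real n) * W)"
  define X where "X p q = (\<Sum>j<n. complex_of_real (?k U * (\<delta> j * \<epsilon> j q p)) *\<^sub>C x j)" for p q
  define Z where "Z p q = (\<Sum>i<n. complex_of_real (?k V * (\<delta> i * \<epsilon> i q p)) *\<^sub>C \<xi> i)" for p q
  have X: "min_norms n X \<le> 1"
    unfolding X_def by (rule min_norms_sign_tensor_le_one[OF n UV(1) \<epsilon>2 \<delta>(1) x])
  have Z: "min_norms n Z \<le> 1"
    unfolding Z_def by (rule min_norms_sign_tensor_le_one[OF n UV(2) \<epsilon>2 \<delta>(1) \<xi>])
  let ?s = "\<Sum>i<n. \<Sum>j<n. complex_of_real (\<delta> i) * complex_of_real (\<delta> j) * (t i j * g i j)"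
  have kk: "?k U * ?k V = 1 / (108 * real n * (U * V))"
    by (simp add: field_simps)
  let ?f = "\<lambda>i j p q. complex_of_real (?k U * ?k V) *
    (complex_of_real (\<delta> i) * complex_of_real (\<delta> j) * (t i j * complex_of_real (\<epsilon> i q p * \<epsilon> j q p)))"
  have "(\<Sum>p<n. \<Sum>q<n. cdual_apply (Z p q) (T (X p q)))
      = (\<Sum>p<n. \<Sum>q<n. \<Sum>j<n. \<Sum>i<n. ?f i j p q)"
    unfolding X_def Z_def T_sum cdual_apply_sum cdual_apply_sum_right cdual_apply_simps sum_distrib_left t_def
    by (intro sum.cong refl) (simp only: of_real_mult mult_ac)
  also have "\<dots> = (\<Sum>p<n. \<Sum>j<n. \<Sum>q<n. \<Sum>i<n. ?f i j p q)"
    by (rule sum.cong[OF refl], rule sum.swap)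
  also have "\<dots> = (\<Sum>p<n. \<Sum>j<n. \<Sum>i<n. \<Sum>q<n. ?f i j p q)"
    by (rule sum.cong[OF refl], rule sum.cong[OF refl], rule sum.swap)
  also have "\<dots> = (\<Sum>p<n. \<Sum>i<n. \<Sum>j<n. \<Sum>q<n. ?f i j p q)"
    by (rule sum.cong[OF refl], rule sum.swap)
  also have "\<dots> = (\<Sum>i<n. \<Sum>p<n. \<Sum>j<n. \<Sum>q<n. ?f i j p q)"
    by (rule sum.swap)
  also have "\<dots> = (\<Sum>i<n. \<Sum>j<n. \<Sum>p<n. \<Sum>q<n. ?f i j p q)"
    by (rule sum.cong[OF refl], rule sum.swap)
  also have "\<dots> = complex_of_real (?k U * ?k V) * ?s"
    by (simp only: g_def of_real_sum sum_distrib_left)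
  finally have pair: "(\<Sum>p<n. \<Sum>q<n. cdual_apply (Z p q) (T (X p q))) = complex_of_real (?k U * ?k V) * ?s" .
  have "(\<Sum>i<n. t i i * g i i) = complex_of_real ((real n)\<^sup>2) * (\<Sum>i<n. t i i)"
    unfolding sum_distrib_left by (intro sum.cong refl) (simp add: g)
  then have "(real n)\<^sup>2 * cmod (\<Sum>i<n. t i i) \<le> cmod ?s"
    using \<delta>(2) by (simp only: norm_mult norm_of_real) simp
  then have "cmod (\<Sum>i<n. t i i) \<le> 108 * U * V * (?k U * ?k V * cmod ?s / real n)"
    using n UV unfolding kk by (simp add: field_simps power2_eq_square)
  then have "ennreal (cmod (\<Sum>i<n. t i i)) \<le> ennreal (108 * U * V * (?k U * ?k V * cmod ?s / real n))"
    by (rule ennreal_leI)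
  also have "\<dots> = ennreal (108 * U * V) * ennreal (cmod (\<Sum>p<n. \<Sum>q<n. cdual_apply (Z p q) (T (X p q))) / real n)"
    unfolding pair norm_mult norm_of_real using UV by (subst ennreal_mult[symmetric]) simp_all
  also have "\<dots> \<le> ennreal (108 * U * V) * max_norms n (\<lambda>p q. T (X p q))"
    by (intro mult_left_mono diagonal_pairing_le_max_norms n Z) simp
  also have "\<dots> \<le> ennreal (108 * U * V) * amplification_norm min_norms max_norms n T"
    unfolding amplification_norm_def using X by (intro mult_left_mono SUP_upper) simp_all
  finally show ?thesis by (simp add: t_def)
qed simp

text \<open>On a basis \<open>B\<close> of the range of \<open>T\<close> a vector and its projection to the orthonormal system \<open>h\<close> differ
  by a null vector, which \<open>S\<close> sends to a vector that all functionals annihilate. Hence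
  \<open>tr (S T) = \<Sum>j. q (T (S (h j))) (h j)\<close>, a sum of at most \<open>n\<close> terms. As the \<open>h j\<close> are taken in
  the domain of \<open>S\<close> and not in an abstract Hilbert space, the vectors \<open>S (h j)\<close> lie in the space
  itself and not just in its bidual. Both sequences are extended by zero to length \<open>n\<close>.\<close>

lemma trace_semi_inner_le:
  fixes T :: "'f::cbanach \<Rightarrow> 'e::cbanach" and S :: "'e \<Rightarrow> 'f"
  assumes T: "bounded_clinear T" "finite_rank T" "rank_of T \<le> n" and S: "bounded_clinear S"
    and q: "semi_inner q" and UV: "U > 0" "V > 0"
    and qV: "\<And>x. sqrt (Re (q x x)) \<le> V * norm x"
    and SU: "\<And>x. norm (cembed (S x)) \<le> U * sqrt (Re (q x x))"
  shows "ennreal (cmod (finite_rank_trace (\<lambda>y. S (T y))))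
    \<le> ennreal (108 * U * V) * amplification_norm min_norms max_norms n T"
proof -
  interpret q: semi_inner q by (rule q)
  interpret T: bounded_linear T using T(1) by (simp add: bounded_clinear_def)
  interpret S: bounded_linear S using S by (simp add: bounded_clinear_def)
  have Tc: "T (c *\<^sub>C x) = c *\<^sub>C T x" for c x using T(1) by (simp add: bounded_clinear_def)
  have Sc: "S (c *\<^sub>C x) = c *\<^sub>C S x" for c x using S by (simp add: bounded_clinear_def)
  obtain B where B: "B \<subseteq> range T" "complex_vector.independent B" "range T \<subseteq> complex_vector.span B"
    "card B = complex_vector.dim (range T)"
    by (rule complex_vector.basis_exists)
  have span: "T y \<in> complex_vector.span B" for y using B(3) by blast
  have fin: "finite B"
  proof -
    obtain C where "finite C" "range T \<subseteq> complex_vector.span C"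
      using T(2) by (auto simp: finite_rank_def finite_cdim_def)
    then show ?thesis using complex_vector.independent_span_bound[of C B] B by blast
  qed
  have card: "card B \<le> n" using T(3) B(4) by (simp add: rank_of_def)
  let ?rep = "complex_vector.representation B"
  obtain C where C: "0 \<le> C" "\<And>x b. x \<in> complex_vector.span B \<Longrightarrow> cmod (?rep x b) \<le> C * norm x"
    using bounded_representation[OF fin B(2)] by blast
  have "\<exists>\<phi>. \<forall>y. cdual_apply \<phi> y = ?rep (T y) b" for b
  proof -
    obtain K where K: "\<And>y. norm (T y) \<le> norm y * K" using T.bounded by blast
    have "cmod (?rep (T y) b) \<le> (C * K) * norm y" for y
      using order_trans[OF C(2)[OF span] mult_left_mono[OF K C(1)]] by (simp add: mult_ac)
    then show ?thesis
      by (intro cdual_of_function)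
        (simp_all add: T.add Tc complex_vector.representation_add[OF B(2)]
          complex_vector.representation_scale[OF B(2)] span)
  qed
  then obtain \<phi> where \<phi>: "\<And>b y. cdual_apply (\<phi> b) y = ?rep (T y) b" by metis
  have T_eq: "T y = (\<Sum>b\<in>B. cdual_apply (\<phi> b) y *\<^sub>C b)" for y
    unfolding \<phi> by (rule complex_vector.sum_representation_eq[OF B(2) span fin order_refl, symmetric])
  have S_sum: "S (\<Sum>b\<in>J. c b *\<^sub>C f b) = (\<Sum>b\<in>J. c b *\<^sub>C S (f b))" for J :: "'j set" and c f
    by (simp add: S.sum Sc)
  have trace: "finite_rank_trace (\<lambda>y. S (T y)) = (\<Sum>b\<in>B. cdual_apply (\<phi> b) (S b))"
  proof (rule finite_rank_trace_eq[OF fin])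
    show "Vector_Spaces.linear scaleC (*) (cdual_apply (\<phi> b))" for b
      by (simp add: linear_functional_iff)
    show "S (T x) = (\<Sum>b\<in>B. cdual_apply (\<phi> b) x *\<^sub>C S b)" for x
      by (subst T_eq) (simp add: S.sum Sc)
  qed
  obtain h r where r: "r \<le> card B" and h: "q.orthonormal h r"
    and res: "\<And>b. b \<in> B \<Longrightarrow> q (q.residual h r b) (q.residual h r b) = 0"
    by (rule q.gram_schmidt[OF fin]) (rule that, assumption+)
  have rn: "r \<le> n" using r card by simp
  have fun_le: "cmod (cdual_apply \<eta> (S w)) \<le> U * sqrt (Re (q w w)) * norm \<eta>" for \<eta> w
  proof -
    have "cmod (cdual_apply \<eta> (S w)) \<le> norm (cembed (S w)) * norm \<eta>"
      using norm_cdual_apply_le[of "cembed (S w)" \<eta>] by simp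
    also have "\<dots> \<le> U * sqrt (Re (q w w)) * norm \<eta>" by (intro mult_right_mono SU) simp
    finally show ?thesis .
  qed
  have expand: "cdual_apply \<eta> (S b) = (\<Sum>j<r. q b (h j) * cdual_apply \<eta> (S (h j)))" if "b \<in> B" for \<eta> b
  proof -
    have "cdual_apply \<eta> (S (q.residual h r b)) = 0"
      using fun_le[of \<eta> "q.residual h r b"] res[OF that] by simp
    then show ?thesis
      by (simp add: q.residual_def S.diff S.sum Sc cdual_apply_sum_right)
  qed
  have bessel: "L2_set (\<lambda>j. cmod (q e (h j))) {..<r} \<le> V * norm e" for e
    using order_trans[OF real_sqrt_le_mono[OF q.bessel[OF h, of e]] qV[of e]] by (simp add: L2_set_def)
  have "\<exists>\<xi>. \<forall>e. cdual_apply \<xi> e = q e (h j)" if "j < r" for j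
  proof -
    have "cmod (q e (h j)) \<le> V * norm e" for e
      using member_le_L2_set[of "{..<r}" j "\<lambda>j. cmod (q e (h j))"] that bessel[of e] by simp
    then show ?thesis by (intro cdual_of_function) (simp_all add: q.add q.scale)
  qed
  then obtain \<xi>' where \<xi>': "\<And>j e. j < r \<Longrightarrow> cdual_apply (\<xi>' j) e = q e (h j)" by metis
  define \<xi> where "\<xi> j = (if j < r then \<xi>' j else 0)" for j
  define x where "x j = (if j < r then S (h j) else 0)" for j
  have to_r: "(\<Sum>j<n. if j < r then f j else 0) = (\<Sum>j<r. f j)" for f :: "nat \<Rightarrow> 'z::comm_monoid_add"
    using rn by (subst sum.inter_filter[symmetric]) (auto intro!: sum.cong)
  have "(\<Sum>b\<in>B. cdual_apply (\<phi> b) (S b)) = (\<Sum>b\<in>B. \<Sum>j<r. q b (h j) * cdual_apply (\<phi> b) (S (h j)))"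
    by (intro sum.cong refl expand)
  also have "\<dots> = (\<Sum>j<r. \<Sum>b\<in>B. cdual_apply (\<phi> b) (S (h j)) * q b (h j))"
    by (subst sum.swap) (simp only: mult.commute)
  also have "\<dots> = (\<Sum>j<r. q (T (S (h j))) (h j))"
    by (simp only: q.sum q.scale T_eq[of "S (h _)"])
  also have "\<dots> = (\<Sum>j<n. if j < r then q (T (S (h j))) (h j) else 0)" by (rule to_r[symmetric])
  also have "\<dots> = (\<Sum>j<n. cdual_apply (\<xi> j) (T (x j)))"
    by (intro sum.cong refl) (simp add: \<xi>_def x_def \<xi>')
  finally have trace': "finite_rank_trace (\<lambda>y. S (T y)) = (\<Sum>j<n. cdual_apply (\<xi> j) (T (x j)))"
    unfolding trace .
  show ?thesis
    unfolding trace'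
  proof (rule trace_le_amplification_norm[OF T(1) UV])
    fix \<eta> :: "'f cdual"
    show "L2_set (\<lambda>j. cmod (cdual_apply \<eta> (x j))) {..<n} \<le> U * norm \<eta>"
    proof (rule L2_set_functional_le)
      fix c :: "nat \<Rightarrow> complex"
      let ?w = "\<Sum>j<r. c j *\<^sub>C h j"
      have "(\<Sum>j<n. c j *\<^sub>C x j) = (\<Sum>j<n. if j < r then c j *\<^sub>C S (h j) else 0)"
        by (intro sum.cong refl) (simp add: x_def)
      also have "\<dots> = S ?w" unfolding to_r by (simp add: S.sum Sc)
      finally have "cmod (cdual_apply \<eta> (\<Sum>j<n. c j *\<^sub>C x j)) \<le> U * sqrt (Re (q ?w ?w)) * norm \<eta>"
        using fun_le[of \<eta> ?w] by simp
      also have "sqrt (Re (q ?w ?w)) \<le> L2_set (\<lambda>j. cmod (c j)) {..<n}"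
      proof -
        have "q ?w ?w = (\<Sum>j<r. \<Sum>i<r. cnj (c j) * (c i * q (h i) (h j)))"
          by (simp add: q.sum q.sum_right q.scale q.scale_right sum_distrib_left)
        also have "\<dots> = (\<Sum>j<r. \<Sum>i<r. if i = j then c i * cnj (c i) else 0)"
          using h by (intro sum.cong refl) (auto simp: q.orthonormal_def)
        also have "\<dots> = (\<Sum>i<r. c i * cnj (c i))" by simp
        also have "\<dots> = complex_of_real ((L2_set (\<lambda>j. cmod (c j)) {..<r})\<^sup>2)"
          by (rule sum_mult_cnj_eq)
        finally have "sqrt (Re (q ?w ?w)) = L2_set (\<lambda>j. cmod (c j)) {..<r}"
          by simp
        also have "\<dots> \<le> L2_set (\<lambda>j. cmod (c j)) {..<n}"
          unfolding L2_set_def using rn by (intro real_sqrt_le_mono sum_mono2) auto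
        finally show ?thesis .
      qed
      then have "U * sqrt (Re (q ?w ?w)) * norm \<eta> \<le> U * L2_set (\<lambda>j. cmod (c j)) {..<n} * norm \<eta>"
        using UV by (intro mult_right_mono mult_left_mono) auto
      finally show "cmod (cdual_apply \<eta> (\<Sum>j<n. c j *\<^sub>C x j))
          \<le> U * norm \<eta> * L2_set (\<lambda>j. cmod (c j)) {..<n}" by (simp add: mult_ac)
    qed (use UV in simp)
  next
    fix \<eta> :: "'e cdual cdual"
    show "L2_set (\<lambda>j. cmod (cdual_apply \<eta> (\<xi> j))) {..<n} \<le> V * norm \<eta>"
    proof (rule L2_set_functional_le)
      fix c :: "nat \<Rightarrow> complex"
      have "norm (\<Sum>j<n. c j *\<^sub>C \<xi> j) \<le> V * L2_set (\<lambda>j. cmod (c j)) {..<n}"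
      proof (rule norm_cdual_le)
        fix e
        have "cmod (cdual_apply (\<Sum>j<n. c j *\<^sub>C \<xi> j) e) = cmod (\<Sum>j<n. c j * cdual_apply (\<xi> j) e)"
          by (simp add: cdual_apply_sum)
        also have "\<dots> \<le> L2_set (\<lambda>j. cmod (c j)) {..<n} * L2_set (\<lambda>j. cmod (cdual_apply (\<xi> j) e)) {..<n}"
          by (rule cmod_sum_mult_le)
        also have "L2_set (\<lambda>j. cmod (cdual_apply (\<xi> j) e)) {..<n} = L2_set (\<lambda>j. cmod (q e (h j))) {..<r}"
        proof -
          have "(\<Sum>j<n. (cmod (cdual_apply (\<xi> j) e))\<^sup>2) = (\<Sum>j<n. if j < r then (cmod (q e (h j)))\<^sup>2 else 0)"
            by (intro sum.cong refl) (simp add: \<xi>_def \<xi>')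
          then show ?thesis unfolding L2_set_def to_r by simp
        qed
        also have "L2_set (\<lambda>j. cmod (c j)) {..<n} * L2_set (\<lambda>j. cmod (q e (h j))) {..<r}
            \<le> L2_set (\<lambda>j. cmod (c j)) {..<n} * (V * norm e)"
          by (intro mult_left_mono bessel) simp
        finally show "cmod (cdual_apply (\<Sum>j<n. c j *\<^sub>C \<xi> j) e) \<le> V * L2_set (\<lambda>j. cmod (c j)) {..<n} * norm e"
          by (simp add: mult_ac)
      qed (use UV in simp)
      then have "norm \<eta> * norm (\<Sum>j<n. c j *\<^sub>C \<xi> j) \<le> norm \<eta> * (V * L2_set (\<lambda>j. cmod (c j)) {..<n})"
        by (rule mult_left_mono) simp
      then show "cmod (cdual_apply \<eta> (\<Sum>j<n. c j *\<^sub>C \<xi> j)) \<le> V * norm \<eta> * L2_set (\<lambda>j. cmod (c j)) {..<n}"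
        using norm_cdual_apply_le[of \<eta> "\<Sum>j<n. c j *\<^sub>C \<xi> j"] by (simp add: mult_ac)
    qed (use UV in simp)
  qed
qed

text \<open>The bounds \<open>U\<close> and \<open>V\<close> are taken slightly larger than the norms of the two factors, so that they
  are positive also when one of the factors vanishes.\<close>

lemma hilbert_factorization_semi_inner:
  fixes R :: "'a::cbanach \<Rightarrow> 'b::cbanach"
  assumes fac: "hilbert_factorization R H u v" and fin: "norm_from H u * norm_into H v < ennreal W"
  obtains q U V where "semi_inner q" "U > 0" "V > 0" "U * V < W"
    "\<And>x. sqrt (Re (q x x)) \<le> V * norm x" "\<And>x. norm (R x) \<le> U * sqrt (Re (q x x))"
proof -
  interpret hilbert_space H using fac by (simp add: hilbert_factorization_def)
  have u: "bounded_from H u" and v: "bounded_into H v" and R: "\<And>x. R x = u (v x)"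
    using fac by (simp_all add: hilbert_factorization_def)
  have vc: "v x \<in> ip_space.carrier H" for x using v by (simp add: bounded_into_def)
  have v_add: "v (x + y) = vadd H (v x) (v y)" and v_scale: "v (c *\<^sub>C x) = vscale H c (v x)" for x y c
    using v by (simp_all add: bounded_into_def)
  have u_scale: "u (vscale H c (v x)) = c *\<^sub>C u (v x)" for c x
    using u vc by (simp add: bounded_from_def)
  define q where "q x y = vinner H (v x) (v y)" for x y
  interpret q: semi_inner q
  proof
    show "q (x + y) z = q x z + q y z" for x y z by (simp add: q_def v_add inner_add_left vc)
    show "q (c *\<^sub>C x) z = c * q x z" for c x z by (simp add: q_def v_scale inner_scale_left vc)
    show "q x y = cnj (q y x)" for x y unfolding q_def by (rule inner_cnj[OF vc vc])
    show "0 \<le> Re (q x x)" for x unfolding q_def by (rule inner_nonneg[OF vc])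
  qed
  define s where "s x = sqrt (Re (q x x))" for x
  have vn: "vnorm H (v x) = s x" for x by (simp add: vnorm_def q_def s_def)
  have s0: "0 \<le> s x" for x using q.nonneg by (simp add: s_def)
  have s_scale: "s (c *\<^sub>C x) = cmod c * s x" for c x
  proof -
    have "q (c *\<^sub>C x) (c *\<^sub>C x) = complex_of_real ((cmod c)\<^sup>2) * q x x"
      unfolding complex_norm_square by (simp add: q.scale q.scale_right mult_ac)
    then have "Re (q (c *\<^sub>C x) (c *\<^sub>C x)) = (cmod c)\<^sup>2 * Re (q x x)" by simp
    then show ?thesis by (simp add: s_def real_sqrt_mult)
  qed
  obtain Cu Cv where Cu: "\<And>h. h \<in> ip_space.carrier H \<Longrightarrow> norm (u h) \<le> Cu * vnorm H h"
    and Cv: "\<And>x. vnorm H (v x) \<le> Cv * norm x"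
    using u v unfolding bounded_from_def bounded_into_def by blast
  have "norm_from H u \<le> ennreal \<bar>Cu\<bar>"
    unfolding norm_from_def
  proof (intro SUP_least ennreal_leI)
    fix h assume h: "h \<in> {h \<in> ip_space.carrier H. vnorm H h \<le> 1}"
    have "norm (u h) \<le> Cu * vnorm H h" using h by (intro Cu) simp
    also have "\<dots> \<le> \<bar>Cu\<bar> * 1"
      using h vnorm_nonneg[of h] by (intro mult_mono) auto
    finally show "norm (u h) \<le> \<bar>Cu\<bar>" by simp
  qed
  then have U_fin: "norm_from H u < Orderings.top" by (rule le_less_trans) simp
  have "norm_into H v \<le> ennreal \<bar>Cv\<bar>"
    unfolding norm_into_def
  proof (intro SUP_least ennreal_leI)
    fix x :: 'a assume x: "x \<in> {x. norm x \<le> 1}"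
    have "vnorm H (v x) \<le> Cv * norm x" by (rule Cv)
    also have "\<dots> \<le> \<bar>Cv\<bar> * 1" using x by (intro mult_mono) auto
    finally show "vnorm H (v x) \<le> \<bar>Cv\<bar>" by simp
  qed
  then have V_fin: "norm_into H v < Orderings.top" by (rule le_less_trans) simp
  define U0 where "U0 = enn2real (norm_from H u)"
  define V0 where "V0 = enn2real (norm_into H v)"
  have U0: "norm_from H u = ennreal U0" "0 \<le> U0" using U_fin by (simp_all add: U0_def)
  have V0: "norm_into H v = ennreal V0" "0 \<le> V0" using V_fin by (simp_all add: V0_def)
  have W: "U0 * V0 < W"
    using fin U0(2) V0(2) by (simp add: U0(1) V0(1) ennreal_less_iff flip: ennreal_mult)
  have bound_v: "s x \<le> V0 * norm x" for x
  proof (cases "x = 0")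
    case True
    then show ?thesis by (simp add: s_def)
  next
    case False
    let ?c = "complex_of_real (1 / norm x)"
    have "norm (?c *\<^sub>C x) \<le> 1" using False by (simp add: norm_scaleC norm_divide)
    then have "ennreal (vnorm H (v (?c *\<^sub>C x))) \<le> norm_into H v"
      unfolding norm_into_def by (intro SUP_upper) simp
    then have "s (?c *\<^sub>C x) \<le> V0" using V0 by (simp add: vn)
    then show ?thesis using False unfolding s_scale by (simp add: norm_divide field_simps)
  qed
  have bound_u: "norm (R x) \<le> U0 * s x" for x
  proof (cases "s x = 0")
    case True
    then show ?thesis using Cu[OF vc[of x]] by (simp add: R vn)
  next
    case False
    then have sx: "s x > 0" using s0[of x] by simp
    let ?c = "complex_of_real (1 / s x)"
    have "s (?c *\<^sub>C x) = 1" unfolding s_scale using sx by (simp add: norm_divide)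
    then have "ennreal (norm (u (v (?c *\<^sub>C x)))) \<le> norm_from H u"
      unfolding norm_from_def by (intro SUP_upper) (simp add: vn vc)
    then have "norm (u (v (?c *\<^sub>C x))) \<le> U0" using U0 by simp
    then have "norm (?c *\<^sub>C R x) \<le> U0" by (simp add: v_scale u_scale R)
    then show ?thesis using sx by (simp add: norm_scaleC norm_divide field_simps)
  qed
  define \<tau> where "\<tau> = min 1 ((W - U0 * V0) / (2 * (U0 + V0 + 1)))"
  have \<tau>: "\<tau> > 0" "\<tau> \<le> 1" using W U0(2) V0(2) by (simp_all add: \<tau>_def)
  have "\<tau> * (U0 + V0 + 1) \<le> (W - U0 * V0) / (2 * (U0 + V0 + 1)) * (U0 + V0 + 1)"
    using U0(2) V0(2) by (intro mult_right_mono) (simp_all add: \<tau>_def)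
  also have "\<dots> = (W - U0 * V0) / 2" using U0(2) V0(2) by (simp add: field_simps)
  also have "\<dots> < W - U0 * V0" using W by simp
  finally have "\<tau> * (U0 + V0 + 1) < W - U0 * V0" .
  moreover have "(U0 + \<tau>) * (V0 + \<tau>) \<le> U0 * V0 + \<tau> * (U0 + V0 + 1)"
    using mult_left_mono[OF \<tau>(2), of \<tau>] \<tau>(1) by (simp add: algebra_simps)
  ultimately have UVW: "(U0 + \<tau>) * (V0 + \<tau>) < W" by simp
  show thesis
  proof (rule that[of q "U0 + \<tau>" "V0 + \<tau>"])
    show "semi_inner q" by (rule q.semi_inner_axioms)
    show "U0 + \<tau> > 0" "V0 + \<tau> > 0" using U0(2) V0(2) \<tau>(1) by simp_all
    show "(U0 + \<tau>) * (V0 + \<tau>) < W" by (rule UVW)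
    show "sqrt (Re (q x x)) \<le> (V0 + \<tau>) * norm x" for x
      using bound_v[of x] \<tau>(1) by (simp add: s_def distrib_right add_increasing2)
    show "norm (R x) \<le> (U0 + \<tau>) * sqrt (Re (q x x))" for x
      using bound_u[of x] \<tau>(1) s0[of x] by (simp add: s_def distrib_right add_increasing2)
  qed
qed

text \<open>An admissible \<open>S\<close> has \<open>\<gamma>\<^sub>2(S) \<le> 1 < 10/9\<close>, so it factors with \<open>U * V < 10/9\<close>, and
  \<open>108 * 10/9 = 120\<close>.\<close>

lemma gamma2_dual_le_amplification_norm:
  fixes T :: "'f::cbanach \<Rightarrow> 'e::cbanach"
  assumes T: "bounded_clinear T" "finite_rank T" "rank_of T \<le> n"
  shows "gamma2_dual T \<le> ennreal 120 * amplification_norm min_norms max_norms n T"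
  unfolding gamma2_dual_def
proof (rule SUP_least)
  fix S :: "'e \<Rightarrow> 'f" assume "S \<in> {S. bounded_clinear S \<and> finite_rank S \<and> gamma2 S \<le> 1}"
  then have S: "bounded_clinear S" "gamma2 S \<le> 1" by simp_all
  have "(1 :: ennreal) < ennreal (10 / 9)" by (subst ennreal_1[symmetric], subst ennreal_less_iff) auto
  with S(2) have "gamma2 S < ennreal (10 / 9)" by (rule le_less_trans)
  then obtain H :: "(nat \<Rightarrow> 'e) ip_space" and u v where
    "hilbert_factorization (\<lambda>x. cembed (S x)) H u v" "norm_from H u * norm_into H v < ennreal (10 / 9)"
    unfolding gamma2_def INF_less_iff by auto
  then obtain q U V where q: "semi_inner q" "U > 0" "V > 0" "U * V < 10 / 9"
    "\<And>x. sqrt (Re (q x x)) \<le> V * norm x" "\<And>x. norm (cembed (S x)) \<le> U * sqrt (Re (q x x))"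
    by (rule hilbert_factorization_semi_inner) (rule that, assumption+)
  have "ennreal (cmod (finite_rank_trace (\<lambda>y. S (T y))))
    \<le> ennreal (108 * U * V) * amplification_norm min_norms max_norms n T"
    by (rule trace_semi_inner_le[OF T S(1) q(1-3) q(5-6)])
  also have "\<dots> \<le> ennreal 120 * amplification_norm min_norms max_norms n T"
    using q(4) by (intro mult_right_mono ennreal_leI) simp_all
  finally show "ennreal (cmod (finite_rank_trace (\<lambda>y. S (T y))))
    \<le> ennreal 120 * amplification_norm min_norms max_norms n T" .
qed

section \<open>Determinants of rank-one perturbations\<close>

definition fun_det :: "nat \<Rightarrow> (nat \<Rightarrow> nat \<Rightarrow> complex) \<Rightarrow> complex" where
  "fun_det n M = Determinant.det (mat n n (\<lambda>(i, j). M i j))"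

lemma fun_det_cong: "(\<And>i j. \<lbrakk>i < n; j < n\<rbrakk> \<Longrightarrow> M i j = M' i j) \<Longrightarrow> fun_det n M = fun_det n M'"
  unfolding fun_det_def by (intro arg_cong[of _ _ Determinant.det] eq_matI) auto

lemma fun_det_scalar: "fun_det n (\<lambda>i j. if i = j then c else 0) = c ^ n"
proof -
  have "mat n n (\<lambda>(i, j). if i = j then c else 0) = c \<cdot>\<^sub>m 1\<^sub>m n"
    by (intro eq_matI) auto
  then show ?thesis by (simp add: fun_det_def)
qed

lemma cmod_fun_det_le:
  assumes "\<And>i j. \<lbrakk>i < n; j < n\<rbrakk> \<Longrightarrow> cmod (M i j) \<le> R"
  shows "cmod (fun_det n M) \<le> fact n * R ^ n"
proof -
  have perm: "p i < n" if "p permutes {0..<n}" "i < n" for p i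
    using permutes_in_image[OF that(1), of i] that(2) by simp
  have "cmod (fun_det n M) = cmod (\<Sum>p | p permutes {0..<n}. signof p * (\<Prod>i = 0..<n. M i (p i)))"
    unfolding fun_det_def
    by (subst det_def'[of _ n], simp)
      (intro arg_cong[of _ _ cmod] sum.cong refl arg_cong2[of _ _ _ _ "(*)"] prod.cong, auto simp: perm)
  also have "\<dots> \<le> (\<Sum>p | p permutes {0..<n}. R ^ n)"
  proof (rule order_trans[OF norm_sum], rule sum_mono)
    fix p assume p: "p \<in> {p. p permutes {0..<n}}"
    have "cmod (signof p * (\<Prod>i = 0..<n. M i (p i))) = (\<Prod>i = 0..<n. cmod (M i (p i)))"
      by (simp add: norm_mult prod_norm sign_def)
    also have "\<dots> \<le> (\<Prod>i = 0..<n. R)"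
      using p perm by (intro prod_mono) (auto intro!: assms)
    finally show "cmod (signof p * (\<Prod>i = 0..<n. M i (p i))) \<le> R ^ n" by simp
  qed
  also have "\<dots> = fact n * R ^ n" by (simp add: card_permutations)
  finally show ?thesis .
qed

lemma fun_det_inverse:
  assumes "fun_det n M \<noteq> 0"
  obtains N where "\<And>i j. \<lbrakk>i < n; j < n\<rbrakk> \<Longrightarrow> (\<Sum>k<n. M i k * N k j) = (if i = j then 1 else 0)"
proof -
  let ?M = "mat n n (\<lambda>(i, j). M i j)"
  have M: "?M \<in> carrier_mat n n" by simp
  have "?M \<in> Units (ring_mat TYPE(complex) n ())"
    using det_non_zero_imp_unit[OF M] assms by (simp add: fun_det_def)
  then obtain B where B: "B \<in> carrier_mat n n" "?M * B = 1\<^sub>m n"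
    by (auto simp: Units_def ring_mat_simps)
  show thesis
  proof (rule that[of "\<lambda>i j. B $$ (i, j)"])
    fix i j assume ij: "i < n" "j < n"
    have "(\<Sum>k<n. M i k * B $$ (k, j)) = (?M * B) $$ (i, j)"
      using B(1) ij by (simp add: scalar_prod_def lessThan_atLeast0)
    then show "(\<Sum>k<n. M i k * B $$ (k, j)) = (if i = j then 1 else 0)"
      unfolding B(2) using ij by simp
  qed
qed

text \<open>Sylvester's identity: the two determinants are those of the products, in either order, of the
  same two block matrices.\<close>

lemma sylvester_det:
  fixes X Y :: "'a::idom mat"
  assumes X: "X \<in> carrier_mat n m" and Y: "Y \<in> carrier_mat m n"
  shows "Determinant.det (1\<^sub>m n + X * Y) = Determinant.det (1\<^sub>m m + Y * X)"
proof -
  let ?L = "four_block_mat (1\<^sub>m n) (- X) Y (1\<^sub>m m)"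
  let ?R = "four_block_mat (1\<^sub>m n) X (0\<^sub>m m n) (1\<^sub>m m)"
  have L: "?L \<in> carrier_mat (n + m) (n + m)" and R: "?R \<in> carrier_mat (n + m) (n + m)"
    by simp_all
  have "?L * ?R = four_block_mat (1\<^sub>m n * 1\<^sub>m n + (- X) * 0\<^sub>m m n) (1\<^sub>m n * X + (- X) * 1\<^sub>m m)
      (Y * 1\<^sub>m n + 1\<^sub>m m * 0\<^sub>m m n) (Y * X + 1\<^sub>m m * 1\<^sub>m m)"
    using X Y by (intro mult_four_block_mat) auto
  also have "\<dots> = four_block_mat (1\<^sub>m n) (0\<^sub>m n m) Y (1\<^sub>m m + Y * X)"
    using X Y by (intro arg_cong4[where f = four_block_mat]) (auto intro!: eq_matI)
  finally have 1: "Determinant.det (?L * ?R) = Determinant.det (1\<^sub>m m + Y * X)"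
    using X Y by (simp add: det_four_block_mat_upper_right_zero[of _ n _ m])
  have "?R * ?L = four_block_mat (1\<^sub>m n * 1\<^sub>m n + X * Y) (1\<^sub>m n * (- X) + X * 1\<^sub>m m)
      (0\<^sub>m m n * 1\<^sub>m n + 1\<^sub>m m * Y) (0\<^sub>m m n * (- X) + 1\<^sub>m m * 1\<^sub>m m)"
    using X Y by (intro mult_four_block_mat) auto
  also have "\<dots> = four_block_mat (1\<^sub>m n + X * Y) (0\<^sub>m n m) Y (1\<^sub>m m)"
    using X Y by (intro arg_cong4[where f = four_block_mat]) (auto intro!: eq_matI)
  finally have 2: "Determinant.det (?R * ?L) = Determinant.det (1\<^sub>m n + X * Y)"
    using X Y by (simp add: det_four_block_mat_upper_right_zero[of _ n _ m])
  show ?thesis using 1 2 det_mult[OF L R] det_mult[OF R L] by (simp add: mult.commute)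
qed

text \<open>The matrix determinant lemma, from \<open>M + x y\<^sup>T = M (1 + N x y\<^sup>T)\<close> with \<open>N\<close> inverse to \<open>M\<close>.\<close>

lemma fun_det_rank_one_update:
  assumes N: "\<And>i j. \<lbrakk>i < n; j < n\<rbrakk> \<Longrightarrow> (\<Sum>k<n. M i k * N k j) = (if i = j then 1 else 0)"
  shows "fun_det n (\<lambda>i j. M i j + x i * y j)
    = fun_det n M * (1 + (\<Sum>k<n. y k * (\<Sum>l<n. N k l * x l)))"
proof -
  let ?M = "mat n n (\<lambda>(i, j). M i j)"
  let ?X = "mat n 1 (\<lambda>(i, j). \<Sum>l<n. N i l * x l)"
  let ?Y = "mat 1 n (\<lambda>(i, j). y j)"
  have Nx: "(\<Sum>k<n. M i k * (\<Sum>l<n. N k l * x l)) = x i" if i: "i < n" for i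
  proof -
    have "(\<Sum>k<n. M i k * (\<Sum>l<n. N k l * x l)) = (\<Sum>l<n. (\<Sum>k<n. M i k * N k l) * x l)"
      unfolding sum_distrib_left sum_distrib_right by (subst sum.swap) (simp add: mult.assoc)
    also have "\<dots> = (\<Sum>l<n. if i = l then x l else 0)"
      using i by (intro sum.cong) (simp_all add: N)
    finally show ?thesis using i by simp
  qed
  have eq: "mat n n (\<lambda>(i, j). M i j + x i * y j) = ?M * (1\<^sub>m n + ?X * ?Y)"
  proof (rule eq_matI)
    fix i j assume ij: "i < dim_row (?M * (1\<^sub>m n + ?X * ?Y))" "j < dim_col (?M * (1\<^sub>m n + ?X * ?Y))"
    then have i: "i < n" and j: "j < n" by simp_all
    have "(?M * (1\<^sub>m n + ?X * ?Y)) $$ (i, j)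
        = (\<Sum>k<n. M i k * ((if k = j then 1 else 0) + (\<Sum>l<n. N k l * x l) * y j))"
      using i j by (simp add: scalar_prod_def lessThan_atLeast0)
    also have "\<dots> = (\<Sum>k<n. (if k = j then M i k else 0) + M i k * (\<Sum>l<n. N k l * x l) * y j)"
      by (intro sum.cong refl) (simp add: distrib_left mult.assoc)
    also have "\<dots> = (\<Sum>k<n. if k = j then M i k else 0) + (\<Sum>k<n. M i k * (\<Sum>l<n. N k l * x l)) * y j"
      by (simp only: sum.distrib sum_distrib_right)
    also have "\<dots> = M i j + x i * y j" using i j by (simp add: Nx)
    finally show "mat n n (\<lambda>(i, j). M i j + x i * y j) $$ (i, j) = (?M * (1\<^sub>m n + ?X * ?Y)) $$ (i, j)"
      using i j by simp
  qed simp_all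
  have "fun_det n (\<lambda>i j. M i j + x i * y j) = fun_det n M * Determinant.det (1\<^sub>m n + ?X * ?Y)"
    unfolding fun_det_def eq by (rule det_mult) auto
  also have "Determinant.det (1\<^sub>m n + ?X * ?Y) = Determinant.det (1\<^sub>m 1 + ?Y * ?X)"
    by (rule sylvester_det) auto
  also have "\<dots> = 1 + (\<Sum>k<n. y k * (\<Sum>l<n. N k l * x l))"
  proof (subst det_single)
    show "1\<^sub>m 1 + ?Y * ?X \<in> carrier_mat 1 1" by (intro carrier_matI) simp_all
  qed (simp add: scalar_prod_def lessThan_atLeast0)
  finally show ?thesis .
qed

lemma fun_det_scale: "fun_det n (\<lambda>i j. a * M i j) = a ^ n * fun_det n M"
proof -
  have "mat n n (\<lambda>(i, j). a * M i j) = a \<cdot>\<^sub>m mat n n (\<lambda>(i, j). M i j)" by (intro eq_matI) auto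
  then show ?thesis by (simp add: fun_det_def)
qed

section \<open>Euclidean factorization of the identity\<close>

text \<open>A version of John's theorem, up to the factor \<open>sqrt 2\<close> that comes from using an almost maximal family.
  Among all finite families \<open>b\<close> with \<open>\<Sum>j. \<bar>\<eta> (b j)\<bar>\<^sup>2 \<le> \<parallel>\<eta>\<parallel>\<^sup>2\<close> for all \<open>\<eta>\<close>, take one for which the
  determinant of \<open>M = \<Sum>j. b j (b j)\<^sup>*\<close>, in coordinates, is almost maximal. The functions \<open>z j\<close>
  are the entries of \<open>(b\<^sub>j\<^sup>* M\<^sup>-\<^sup>1)\<^sub>j\<close>, so that \<open>\<Sum>j. z j x b j = M M\<^sup>-\<^sup>1 x\<close> and
  \<open>\<Sum>j. \<bar>z j x\<bar>\<^sup>2 = x\<^sup>* M\<^sup>-\<^sup>1 x\<close>. For \<open>\<parallel>x\<parallel> \<le> 1\<close> the family obtained from \<open>b\<close> by scaling it with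
  \<open>sqrt (1 - e)\<close> and adding \<open>sqrt e *\<^sub>R x\<close> is again admissible, and its determinant is that of \<open>M\<close>
  times \<open>(1 - e) ^ n + e (1 - e) ^ (n - 1) x\<^sup>* M\<^sup>-\<^sup>1 x\<close>. Almost maximality bounds this factor, and
  \<open>e = 1 / (3 n)\<close> yields \<open>x\<^sup>* M\<^sup>-\<^sup>1 x \<le> 2 n\<close>. The families may have any length; this is what makes
  the perturbation a mere extension by one vector.\<close>

lemma john_position:
  assumes fin: "finite_cdim (UNIV :: 'g::cbanach set)" and n: "complex_vector.dim (UNIV :: 'g::cbanach set) = n" "n > 0"
  obtains N :: nat and b :: "nat \<Rightarrow> 'g::cbanach" and z :: "nat \<Rightarrow> 'g::cbanach \<Rightarrow> complex" where
    "\<And>x. (\<Sum>j<N. z j x *\<^sub>C b j) = x"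
    "\<And>j x y. z j (x + y) = z j x + z j y" "\<And>j c x. z j (c *\<^sub>C x) = c * z j x"
    "\<And>x. L2_set (\<lambda>j. cmod (z j x)) {..<N} \<le> sqrt (2 * real n) * norm x"
    "\<And>\<eta>. L2_set (\<lambda>j. cmod (cdual_apply \<eta> (b j))) {..<N} \<le> norm \<eta>"
proof -
  obtain B :: "'g set" where B: "complex_vector.independent B" "UNIV \<subseteq> complex_vector.span B"
    "card B = complex_vector.dim (UNIV :: 'g set)"
    by (rule complex_vector.basis_exists)
  have finB: "finite B" using n B(3) by (metis card.infinite less_irrefl)
  have span: "x \<in> complex_vector.span B" for x :: 'g using B(2) by blast
  obtain \<beta> where \<beta>: "bij_betw \<beta> {..<n} B"
    using ex_bij_betw_nat_finite[OF finB] B(3) n(1) by (auto simp: lessThan_atLeast0)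
  obtain C where C: "0 \<le> C" "\<And>x b. cmod (complex_vector.representation B x b) \<le> C * norm x"
    using bounded_representation[OF finB B(1)] span by metis
  define co where "co x i = complex_vector.representation B x (\<beta> i)" for x i
  have co_add: "co (x + y) i = co x i + co y i" and co_scale: "co (c *\<^sub>C x) i = c * co x i" for x y i c
    by (simp_all add: co_def complex_vector.representation_add[OF B(1) span span]
        complex_vector.representation_scale[OF B(1) span])
  have co_sum: "co (\<Sum>j\<in>J. f j) i = (\<Sum>j\<in>J. co (f j) i)" for J :: "nat set" and f i
    by (induction J rule: infinite_finite_induct)
      (use co_scale[of 0 0] in \<open>simp_all add: co_add\<close>)
  have co_eq: "(\<Sum>i<n. co x i *\<^sub>C \<beta> i) = x" for x
  proof -
    have "(\<Sum>i<n. co x i *\<^sub>C \<beta> i) = (\<Sum>b\<in>B. complex_vector.representation B x b *\<^sub>C b)"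
      unfolding co_def by (rule sum.reindex_bij_betw[OF \<beta>])
    also have "\<dots> = x" by (rule complex_vector.sum_representation_eq[OF B(1) span finB order_refl])
    finally show ?thesis .
  qed
  have co_\<beta>: "co (\<beta> i) j = (if i = j then 1 else 0)" if "i < n" "j < n" for i j
  proof -
    have "\<beta> i \<in> B" "\<beta> j = \<beta> i \<longleftrightarrow> i = j"
      using \<beta> that by (auto simp: bij_betw_def inj_on_def)
    then show ?thesis by (simp add: co_def complex_vector.representation_basis[OF B(1)])
  qed
  have "\<exists>\<phi>. \<forall>x. cdual_apply \<phi> x = co x i" for i
    by (intro cdual_of_function[where C = C] co_add co_scale) (simp add: co_def C)
  then obtain \<phi> where \<phi>: "\<And>i x. cdual_apply (\<phi> i) x = co x i" by metis
  have n\<phi>: "norm (\<phi> i) \<le> C" for i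
    by (rule norm_cdual_le) (simp_all add: \<phi> co_def C)
  \<comment> \<open>Admissible families: \<open>\<ell>\<^sub>2(N) \<rightarrow> E\<close> has norm at most \<open>1\<close>.\<close>
  define adm where "adm N b \<longleftrightarrow>
    (\<forall>\<eta>. L2_set (\<lambda>j. cmod (cdual_apply \<eta> (b j))) {..<N} \<le> norm \<eta>)" for N and b :: "nat \<Rightarrow> 'g"
  define M where "M N b k l = (\<Sum>j<N. co (b j) k * cnj (co (b j) l))" for N :: nat and b k l
  define D where "D N b = cmod (fun_det n (M N b))" for N b
  have D_le: "D N b \<le> fact n * (C * C) ^ n" if "adm N b" for N b
    unfolding D_def
  proof (rule cmod_fun_det_le)
    fix k l
    have L: "L2_set (\<lambda>j. cmod (co (b j) i)) {..<N} \<le> C" for i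
      using that n\<phi>[of i] unfolding adm_def by (metis (no_types, lifting) \<phi> L2_set_cong order_trans)
    have "cmod (M N b k l) \<le> L2_set (\<lambda>j. cmod (co (b j) k)) {..<N} * L2_set (\<lambda>j. cmod (cnj (co (b j) l))) {..<N}"
      unfolding M_def by (rule cmod_sum_mult_le)
    also have "\<dots> \<le> C * C" using C(1) by (intro mult_mono) (simp_all add: L)
    finally show "cmod (M N b k l) \<le> C * C" .
  qed
  define s where "s = Sup {D N b |N b. adm N b}"
  have bdd: "bdd_above {D N b |N b. adm N b}" using D_le by (intro bdd_aboveI) blast
  have D_s: "D N b \<le> s" if "adm N b" for N b
    unfolding s_def using that by (intro cSup_upper bdd) blast
  \<comment> \<open>A small multiple of the basis is admissible, so the supremum is positive.\<close>
  obtain b0 where b0: "adm n b0" "D n b0 > 0"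
  proof
    define r where "r = 1 / (1 + (\<Sum>j<n. norm (\<beta> j)))"
    have r: "r > 0" "r * (\<Sum>j<n. norm (\<beta> j)) \<le> 1"
    proof -
      have "0 \<le> (\<Sum>j<n. norm (\<beta> j))" by (intro sum_nonneg) simp
      then show "r > 0" "r * (\<Sum>j<n. norm (\<beta> j)) \<le> 1" by (simp_all add: r_def)
    qed
    let ?b = "\<lambda>j. complex_of_real r *\<^sub>C \<beta> j"
    show "adm n ?b"
      unfolding adm_def
    proof
      fix \<eta> :: "'g cdual"
      have "L2_set (\<lambda>j. cmod (cdual_apply \<eta> (?b j))) {..<n} \<le> (\<Sum>j<n. cmod (cdual_apply \<eta> (?b j)))"
        by (rule L2_set_le_sum) simp
      also have "\<dots> \<le> (\<Sum>j<n. r * (norm \<eta> * norm (\<beta> j)))"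
        using r(1) by (intro sum_mono) (simp add: norm_mult norm_cdual_apply_le)
      also have "\<dots> = norm \<eta> * (r * (\<Sum>j<n. norm (\<beta> j)))" by (simp add: sum_distrib_left mult_ac)
      also have "\<dots> \<le> norm \<eta> * 1" by (intro mult_left_mono r(2)) simp
      finally show "L2_set (\<lambda>j. cmod (cdual_apply \<eta> (?b j))) {..<n} \<le> norm \<eta>" by simp
    qed
    have "fun_det n (M n ?b) = fun_det n (\<lambda>i j. if i = j then complex_of_real (r\<^sup>2) else 0)"
    proof (rule fun_det_cong)
      fix k l assume kl: "k < n" "l < n"
      have "M n ?b k l = (\<Sum>j<n. if j = k then (if k = l then complex_of_real (r\<^sup>2) else 0) else 0)"
        unfolding M_def using kl by (intro sum.cong) (auto simp: co_scale co_\<beta> power2_eq_square)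
      then show "M n ?b k l = (if k = l then complex_of_real (r\<^sup>2) else 0)" using kl by simp
    qed
    then show "D n ?b > 0" using r(1) by (simp add: D_def fun_det_scalar)
  qed
  have s: "s > 0" using D_s[OF b0(1)] b0(2) by linarith
  \<comment> \<open>The supremum need not be attained; a family that reaches \<open>9/10\<close> of it is good enough.\<close>
  have "\<exists>d\<in>{D N b |N b. adm N b}. 9 / 10 * s < d"
  proof (rule less_cSupD)
    show "{D N b |N b. adm N b} \<noteq> {}" using b0(1) by blast
    show "9 / 10 * s < Sup {D N b |N b. adm N b}" using s by (simp add: s_def)
  qed
  then obtain N b where adm: "adm N b" and Db: "9 / 10 * s < D N b" by blast
  have "fun_det n (M N b) \<noteq> 0" using Db s by (auto simp: D_def)
  then obtain R where R: "\<And>i j. \<lbrakk>i < n; j < n\<rbrakk> \<Longrightarrow> (\<Sum>k<n. M N b i k * R k j) = (if i = j then 1 else 0)"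
    by (rule fun_det_inverse) blast
  define w where "w x k = (\<Sum>l<n. R k l * co x l)" for x k
  define z where "z j x = (\<Sum>k<n. cnj (co (b j) k) * w x k)" for j x
  have z_add: "z j (x + y) = z j x + z j y" and z_scale: "z j (c *\<^sub>C x) = c * z j x" for j x y c
    by (simp_all add: z_def w_def co_add co_scale ring_distribs sum.distrib sum_distrib_left mult_ac)
  have MR: "(\<Sum>k<n. M N b i k * w x k) = co x i" if i: "i < n" for i x
  proof -
    have "(\<Sum>k<n. M N b i k * w x k) = (\<Sum>l<n. (\<Sum>k<n. M N b i k * R k l) * co x l)"
      unfolding sum_distrib_left sum_distrib_right w_def by (subst sum.swap) (simp add: mult.assoc)
    also have "\<dots> = (\<Sum>l<n. if i = l then co x l else 0)"
      using i by (intro sum.cong) (simp_all add: R)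
    finally show ?thesis using i by simp
  qed
  have zco: "(\<Sum>j<N. z j x * co (b j) i) = co x i" if i: "i < n" for i x
  proof -
    have "(\<Sum>j<N. z j x * co (b j) i) = (\<Sum>k<n. M N b i k * w x k)"
      unfolding z_def M_def sum_distrib_right by (subst sum.swap) (simp add: mult_ac)
    then show ?thesis by (simp add: MR i)
  qed
  have z_eq: "(\<Sum>j<N. z j x *\<^sub>C b j) = x" for x
  proof -
    have "co (\<Sum>j<N. z j x *\<^sub>C b j) i = co x i" if "i < n" for i
      by (simp add: co_sum co_scale zco that)
    then have "(\<Sum>i<n. co (\<Sum>j<N. z j x *\<^sub>C b j) i *\<^sub>C \<beta> i) = (\<Sum>i<n. co x i *\<^sub>C \<beta> i)"
      by (intro sum.cong) auto
    then show ?thesis by (simp only: co_eq)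
  qed
  define c where "c x = (L2_set (\<lambda>j. cmod (z j x)) {..<N})\<^sup>2" for x
  have c_eq: "complex_of_real (c x) = (\<Sum>k<n. cnj (co x k) * w x k)" for x
  proof -
    have "complex_of_real (c x) = (\<Sum>j<N. z j x * cnj (z j x))"
      unfolding c_def by (rule sum_mult_cnj_eq[symmetric])
    also have "\<dots> = (\<Sum>j<N. \<Sum>k<n. cnj (w x k) * (z j x * co (b j) k))"
      by (subst (2) z_def) (simp add: sum_distrib_left mult_ac)
    also have "\<dots> = (\<Sum>k<n. cnj (w x k) * (\<Sum>j<N. z j x * co (b j) k))"
      by (subst sum.swap) (simp add: sum_distrib_left)
    also have "\<dots> = (\<Sum>k<n. cnj (w x k) * co x k)" by (simp add: zco)
    finally have "cnj (complex_of_real (c x)) = cnj (\<Sum>k<n. cnj (w x k) * co x k)" by (rule arg_cong)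
    then show ?thesis by (simp add: mult.commute)
  qed
  have c0: "0 \<le> c x" for x by (simp add: c_def)
  have c_le: "c x \<le> 2 * real n" if x: "norm x \<le> 1" for x
  proof -
    define e where "e = 1 / (3 * real n)"
    have e: "0 < e" "e < 1" "real n * e = 1 / 3" using n(2) by (simp_all add: e_def)
    define b' where "b' j = (if j < N then complex_of_real (sqrt (1 - e)) *\<^sub>C b j
      else complex_of_real (sqrt e) *\<^sub>C x)" for j
    have "adm (Suc N) b'"
      unfolding adm_def
    proof
      fix \<eta> :: "'g cdual"
      have "(\<Sum>j<N. (cmod (cdual_apply \<eta> (b j)))\<^sup>2) \<le> (norm \<eta>)\<^sup>2"
        using adm power_mono[of "L2_set (\<lambda>j. cmod (cdual_apply \<eta> (b j))) {..<N}" "norm \<eta>" 2]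
        by (simp add: adm_def L2_set_def sum_nonneg)
      then have 1: "(1 - e) * (\<Sum>j<N. (cmod (cdual_apply \<eta> (b j)))\<^sup>2) \<le> (1 - e) * (norm \<eta>)\<^sup>2"
        using e by (intro mult_left_mono) auto
      have "cmod (cdual_apply \<eta> x) \<le> norm \<eta> * 1"
        using order_trans[OF norm_cdual_apply_le[of \<eta> x] mult_left_mono[OF x]] by simp
      then have 2: "e * (cmod (cdual_apply \<eta> x))\<^sup>2 \<le> e * (norm \<eta>)\<^sup>2"
        using e by (intro mult_left_mono power_mono) auto
      have "(\<Sum>j<Suc N. (cmod (cdual_apply \<eta> (b' j)))\<^sup>2)
          = (1 - e) * (\<Sum>j<N. (cmod (cdual_apply \<eta> (b j)))\<^sup>2) + e * (cmod (cdual_apply \<eta> x))\<^sup>2"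
        using e by (simp add: b'_def norm_mult power_mult_distrib sum_distrib_left)
      also have "\<dots> \<le> (norm \<eta>)\<^sup>2" using 1 2 by (simp add: algebra_simps)
      finally show "L2_set (\<lambda>j. cmod (cdual_apply \<eta> (b' j))) {..<Suc N} \<le> norm \<eta>"
        unfolding L2_set_def by (rule real_le_lsqrt[OF norm_ge_zero])
    qed
    then have "D (Suc N) b' \<le> s" by (rule D_s)
    also have "\<dots> < 10 / 9 * D N b" using Db by simp
    finally have less: "D (Suc N) b' < 10 / 9 * D N b" .
    define t where "t = e / (1 - e)"
    have t: "0 < t" "(1 - e) * t = e" using e by (simp_all add: t_def)
    have M': "M (Suc N) b' k l = complex_of_real (1 - e) * (M N b k l + (complex_of_real t * co x k) * cnj (co x l))" for k l
    proof -
      have se: "complex_of_real (sqrt (1 - e)) * complex_of_real (sqrt (1 - e)) = complex_of_real (1 - e)"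
        "complex_of_real (sqrt e) * complex_of_real (sqrt e) = complex_of_real e"
        using e by (simp_all flip: of_real_mult)
      have "M (Suc N) b' k l = (\<Sum>j<N. (complex_of_real (sqrt (1 - e)) * complex_of_real (sqrt (1 - e))) * (co (b j) k * cnj (co (b j) l)))
          + (complex_of_real (sqrt e) * complex_of_real (sqrt e)) * (co x k * cnj (co x l))"
        by (simp add: M_def b'_def co_scale mult_ac)
      also have "\<dots> = complex_of_real (1 - e) * M N b k l + complex_of_real ((1 - e) * t) * (co x k * cnj (co x l))"
        unfolding se t(2) by (simp only: M_def sum_distrib_left)
      finally show ?thesis by (simp only: of_real_mult distrib_left mult.assoc)
    qed
    have "fun_det n (M (Suc N) b') = complex_of_real (1 - e) ^ n * fun_det n (\<lambda>k l. M N b k l + (complex_of_real t * co x k) * cnj (co x l))"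
      unfolding fun_det_scale[symmetric] by (intro fun_det_cong M')
    also have "fun_det n (\<lambda>k l. M N b k l + (complex_of_real t * co x k) * cnj (co x l))
        = fun_det n (M N b) * (1 + (\<Sum>k<n. cnj (co x k) * (\<Sum>l<n. R k l * (complex_of_real t * co x l))))"
      by (rule fun_det_rank_one_update[OF R])
    also have "(\<Sum>k<n. cnj (co x k) * (\<Sum>l<n. R k l * (complex_of_real t * co x l))) = complex_of_real t * complex_of_real (c x)"
      unfolding c_eq by (simp add: w_def sum_distrib_left mult_ac)
    finally have "D (Suc N) b' = cmod (complex_of_real (1 - e) ^ n * (fun_det n (M N b) * (1 + complex_of_real t * complex_of_real (c x))))"
      by (simp add: D_def)
    also have "\<dots> = cmod (complex_of_real ((1 - e) ^ n * (1 + t * c x)) * fun_det n (M N b))"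
      by (simp only: of_real_mult of_real_power of_real_add of_real_1 mult_ac)
    also have "\<dots> = ((1 - e) ^ n * (1 + t * c x)) * D N b"
      unfolding norm_mult norm_of_real D_def using e t c0[of x] by (simp add: abs_mult)
    finally have "((1 - e) ^ n * (1 + t * c x)) * D N b < 10 / 9 * D N b" using less by simp
    moreover have "D N b > 0" using Db s by linarith
    ultimately have lt: "(1 - e) ^ n * (1 + t * c x) < 10 / 9"
      by (simp only: mult_less_cancel_right_pos)
    have "2 / 3 \<le> (1 - e) ^ n"
      using Bernoulli_inequality[of "- e" n] e by simp
    then have "2 / 3 * (1 + t * c x) \<le> (1 - e) ^ n * (1 + t * c x)"
      using t c0[of x] by (intro mult_right_mono) auto
    with lt have "t * c x < 2 / 3" by simp
    then have "(1 - e) * (t * c x) \<le> 1 * (2 / 3)"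
      using e t c0[of x] by (intro mult_mono) auto
    then have "e * c x \<le> 2 / 3" by (simp only: t(2) mult_1 flip: mult.assoc)
    also have "2 / 3 = e * (2 * real n)" using e(3) by (simp add: mult_ac)
    finally show ?thesis using e(1) by simp
  qed
  show thesis
  proof (rule that[of z b N])
    show "(\<Sum>j<N. z j x *\<^sub>C b j) = x" for x by (rule z_eq)
    show "z j (x + y) = z j x + z j y" for j x y by (rule z_add)
    show "z j (c *\<^sub>C x) = c * z j x" for j c x by (rule z_scale)
    show "L2_set (\<lambda>j. cmod (cdual_apply \<eta> (b j))) {..<N} \<le> norm \<eta>" for \<eta>
      using adm by (simp add: adm_def)
    show "L2_set (\<lambda>j. cmod (z j x)) {..<N} \<le> sqrt (2 * real n) * norm x" for x
    proof (cases "x = 0")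
      case True
      have "z j 0 = 0" for j using z_scale[of j 0 0] by simp
      then show ?thesis using True by (simp add: L2_set_def)
    next
      case False
      let ?a = "complex_of_real (1 / norm x)"
      have "c (?a *\<^sub>C x) \<le> 2 * real n"
        using False by (intro c_le) (simp add: norm_scaleC norm_divide)
      then have "L2_set (\<lambda>j. cmod (z j (?a *\<^sub>C x))) {..<N} \<le> sqrt (2 * real n)"
        unfolding c_def by (rule real_le_rsqrt)
      then have "(1 / norm x) * L2_set (\<lambda>j. cmod (z j x)) {..<N} \<le> sqrt (2 * real n)"
        unfolding z_scale L2_set_cmod_scale norm_of_real by simp
      then show ?thesis using False by (simp add: field_simps)
    qed
  qed
qed

section \<open>Comparison of the norms\<close>

text \<open>The identity factors with constant \<open>sqrt (2 n)\<close> and has trace \<open>n\<close>.\<close>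

lemma gamma2_dual_id_ge:
  assumes fin: "finite_cdim (UNIV :: 'g::cbanach set)"
    and n: "complex_vector.dim (UNIV :: 'g::cbanach set) = n" "n > 0"
  shows "ennreal (sqrt (real n) / sqrt 2) \<le> gamma2_dual (id :: 'g \<Rightarrow> 'g)"
proof -
  obtain N :: nat and b :: "nat \<Rightarrow> 'g" and z :: "nat \<Rightarrow> 'g \<Rightarrow> complex" where
    zb: "\<And>x. (\<Sum>j<N. z j x *\<^sub>C b j) = x"
    and z_add: "\<And>j x y. z j (x + y) = z j x + z j y"
    and z_scale: "\<And>j c x. z j (c *\<^sub>C x) = c * z j x"
    and z: "\<And>x. L2_set (\<lambda>j. cmod (z j x)) {..<N} \<le> sqrt (2 * real n) * norm x"
    and b: "\<And>\<eta>. L2_set (\<lambda>j. cmod (cdual_apply \<eta> (b j))) {..<N} \<le> norm \<eta>"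
    by (rule john_position[OF fin n]) (rule that, assumption+)
  define r where "r = 1 / sqrt (2 * real n)"
  have r: "r > 0" "r * sqrt (2 * real n) = 1" using n(2) by (simp_all add: r_def)
  interpret l2_factorization "{..<N}" "\<lambda>j x. complex_of_real r * z j x" b 1 1
  proof
    fix x
    have "L2_set (\<lambda>j. cmod (complex_of_real r * z j x)) {..<N} = r * L2_set (\<lambda>j. cmod (z j x)) {..<N}"
      unfolding L2_set_cmod_scale using r(1) by simp
    also have "\<dots> \<le> r * (sqrt (2 * real n) * norm x)"
      using r(1) by (intro mult_left_mono z) simp
    also have "\<dots> = 1 * norm x" by (simp only: r(2) flip: mult.assoc)
    finally show "L2_set (\<lambda>j. cmod (complex_of_real r * z j x)) {..<N} \<le> 1 * norm x" .
  qed (simp_all add: b z_add z_scale algebra_simps)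
  have "(\<Sum>j<N. z j (b j)) = of_nat n"
  proof -
    obtain B :: "'g set" where B: "complex_vector.independent B" "UNIV \<subseteq> complex_vector.span B"
      "card B = complex_vector.dim (UNIV :: 'g::cbanach set)"
      by (rule complex_vector.basis_exists)
    have finB: "finite B" using n B(3) by (metis card.infinite less_irrefl)
    have span: "x \<in> complex_vector.span B" for x :: 'g using B(2) by blast
    have "finite_rank_trace (\<lambda>x :: 'g. x) = (\<Sum>j<N. z j (b j))"
      by (rule finite_rank_trace_eq[where f = z and y = b]) (simp_all add: linear_functional_iff z_add z_scale zb)
    moreover have "finite_rank_trace (\<lambda>x :: 'g. x) = (\<Sum>c\<in>B. complex_vector.representation B c c)"
    proof (rule finite_rank_trace_eq[OF finB,
          where f = "\<lambda>c x. complex_vector.representation B x c" and y = "\<lambda>c. c"])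
      show "Vector_Spaces.linear scaleC (*) (\<lambda>x. complex_vector.representation B x c)" for c
        by (simp add: linear_functional_iff complex_vector.representation_add[OF B(1) span span]
            complex_vector.representation_scale[OF B(1) span])
      show "x = (\<Sum>c\<in>B. complex_vector.representation B x c *\<^sub>C c)" for x
        by (rule complex_vector.sum_representation_eq[OF B(1) span finB order_refl, symmetric])
    qed
    moreover have "(\<Sum>c\<in>B. complex_vector.representation B c c) = (\<Sum>c\<in>B. 1)"
      by (intro sum.cong refl) (simp add: complex_vector.representation_basis[OF B(1)])
    ultimately show ?thesis using B(3) n(1) by simp
  qed
  then have "(\<Sum>j<N. complex_of_real r * z j (id (b j))) = complex_of_real (r * real n)"
    by (simp flip: sum_distrib_left)
  moreover have "r * real n = sqrt (real n) / sqrt 2"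
    using n(2) by (simp add: r_def real_sqrt_mult field_simps)
  moreover have "bounded_clinear (id :: 'g \<Rightarrow> 'g)"
    by (simp add: bounded_clinear_def id_def bounded_linear_ident)
  ultimately show ?thesis
    using trace_le_gamma2_dual[of "id :: 'g \<Rightarrow> 'g"] by (simp add: norm_divide)
qed

theorem proposition2:
  shows "(\<forall>(T :: 'f::cbanach \<Rightarrow> 'e::cbanach) (n :: nat).
      bounded_clinear T \<and> finite_rank T \<and> rank_of T \<le> n \<longrightarrow>
      cb_norm min_norms max_norms T \<le> gamma2_dual T \<and>
      gamma2_dual T \<le> 170 * amplification_norm min_norms max_norms n T)
    \<and> (\<forall>n :: nat. finite_cdim (UNIV :: 'g::cbanach set) \<and>
      complex_vector.dim (UNIV :: 'g set) = n \<longrightarrow>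
      ennreal (sqrt (real n) / 170) \<le> cb_norm min_norms max_norms (id :: 'g \<Rightarrow> 'g))"
proof (intro conjI allI impI)
  fix T :: "'f \<Rightarrow> 'e" and n :: nat
  assume T: "bounded_clinear T \<and> finite_rank T \<and> rank_of T \<le> n"
  then show "cb_norm min_norms max_norms T \<le> gamma2_dual T"
    by (intro cb_norm_le_gamma2_dual) simp
  have "gamma2_dual T \<le> ennreal 120 * amplification_norm min_norms max_norms n T"
    using T by (intro gamma2_dual_le_amplification_norm) simp_all
  also have "\<dots> \<le> ennreal 170 * amplification_norm min_norms max_norms n T"
    by (intro mult_right_mono ennreal_leI) simp_all
  finally show "gamma2_dual T \<le> 170 * amplification_norm min_norms max_norms n T" by simp
next
  fix n :: nat
  assume n: "finite_cdim (UNIV :: 'g set) \<and> complex_vector.dim (UNIV :: 'g set) = n"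
  show "ennreal (sqrt (real n) / 170) \<le> cb_norm min_norms max_norms (id :: 'g \<Rightarrow> 'g)" (is "_ \<le> ?cb")
  proof (cases "n = 0")
    case False
    have "ennreal (sqrt (real n) / sqrt 2) \<le> gamma2_dual (id :: 'g \<Rightarrow> 'g)"
      using n False by (intro gamma2_dual_id_ge) simp_all
    also have "\<dots> \<le> ennreal 120 * amplification_norm min_norms max_norms n (id :: 'g \<Rightarrow> 'g)"
      using n by (intro gamma2_dual_le_amplification_norm)
        (simp_all add: bounded_clinear_def id_def bounded_linear_ident finite_rank_def rank_of_def)
    also have "\<dots> \<le> ennreal 120 * ?cb"
      unfolding cb_norm_def by (intro mult_left_mono SUP_upper) simp_all
    finally have le: "ennreal (1 / 120) * ennreal (sqrt (real n) / sqrt 2) \<le> ennreal (1 / 120) * (ennreal 120 * ?cb)"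
      by (rule mult_left_mono) simp
    have "sqrt 2 * 120 \<le> 170"
      using real_le_lsqrt[of "17 / 12" 2] by (simp add: power2_eq_square)
    then have "sqrt (real n) / 170 \<le> sqrt (real n) / (sqrt 2 * 120)"
      by (intro divide_left_mono) simp_all
    then have "ennreal (sqrt (real n) / 170) \<le> ennreal (1 / 120 * (sqrt (real n) / sqrt 2))"
      by (intro ennreal_leI) (simp add: mult.commute)
    also have "\<dots> = ennreal (1 / 120) * ennreal (sqrt (real n) / sqrt 2)"
      by (rule ennreal_mult) simp_all
    also note le
    also have "ennreal (1 / 120) * (ennreal 120 * ?cb) = ?cb"
      by (simp only: ennreal_mult[symmetric] mult.assoc[symmetric]) simp
    finally show ?thesis .
  qed simp
qed

end
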